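(* Let $R$ be an associative ring with identity which is right $GC2$ and such that every finitely generated right $R$-module can be embedded in a free right $R$-module (i.e. $R$ is a right $FGF$-ring). If $R$ is right weak $CS$, then $R$ is quasi-Frobenius. Likewise, if $R$ is right $s$-$CS$, then $R$ is quasi-Frobenius.
   Context: Rings are associative with identity and modules are unitary. A right $R$-module $M$ is weak $CS$ if every semisimple submodule of $M$ is essential in a direct summand of $M$. A right $R$-module $M$ is $s$-$CS$ if every singular submodule of $M$ is essential in a direct summand of $M$ (a module is singular if the annihilator of each of its elements is an essential right ideal of $R$). A right $R$-module $M$ is $GC2$ if every submodule of $M$ isomorphic to $M$ is a direct summand of $M$. The ring $R$ is right weak $CS$ (respectively right $s$-$CS$, right $GC2$) if the right module $R_R$ is weak $CS$ (respectively $s$-$CS$, $GC2$). $R$ is quasi-Frobenius ($QF$) if it is right (or left) artinian and right (or left) self-injective. *)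

theory Defs
  imports "HOL-Algebra.AbelCoset"
begin

section \<open>Right modules over a ring with identity\<close>

text \<open>The locale \<open>module\<close> requires a commutative ring, so right modules are introduced
  here in the same style. As in the record \<open>module\<close>, the multiplicative part of the
  underlying ring record is junk.\<close>

record ('a, 'b) rmodule = "'b ring" +
  rsmult :: "'b \<Rightarrow> 'a \<Rightarrow> 'b" (infixl \<open>\<cdot>\<index>\<close> 70)

locale right_module = R?: ring R + M?: abelian_group M for R (structure) and M (structure) +
  assumes rsmult_closed [simp, intro]:
      "\<lbrakk>x \<in> carrier M; a \<in> carrier R\<rbrakk> \<Longrightarrow> x \<cdot>\<^bsub>M\<^esub> a \<in> carrier M"
    and rsmult_add_left:
      "\<lbrakk>x \<in> carrier M; y \<in> carrier M; a \<in> carrier R\<rbrakk>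
        \<Longrightarrow> (x \<oplus>\<^bsub>M\<^esub> y) \<cdot>\<^bsub>M\<^esub> a = x \<cdot>\<^bsub>M\<^esub> a \<oplus>\<^bsub>M\<^esub> y \<cdot>\<^bsub>M\<^esub> a"
    and rsmult_add_right:
      "\<lbrakk>x \<in> carrier M; a \<in> carrier R; b \<in> carrier R\<rbrakk>
        \<Longrightarrow> x \<cdot>\<^bsub>M\<^esub> (a \<oplus> b) = x \<cdot>\<^bsub>M\<^esub> a \<oplus>\<^bsub>M\<^esub> x \<cdot>\<^bsub>M\<^esub> b"
    and rsmult_assoc:
      "\<lbrakk>x \<in> carrier M; a \<in> carrier R; b \<in> carrier R\<rbrakk>
        \<Longrightarrow> x \<cdot>\<^bsub>M\<^esub> (a \<otimes> b) = (x \<cdot>\<^bsub>M\<^esub> a) \<cdot>\<^bsub>M\<^esub> b"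
    and rsmult_one [simp]: "x \<in> carrier M \<Longrightarrow> x \<cdot>\<^bsub>M\<^esub> \<one> = x"

definition regular_rmodule :: "('a, 'm) ring_scheme \<Rightarrow> ('a, 'a) rmodule" where
  "regular_rmodule R = \<lparr>carrier = carrier R, mult = mult R, one = one R,
     zero = zero R, add = add R, rsmult = mult R\<rparr>"

text \<open>As with \<open>subgroup\<close>, a submodule \<open>N\<close> of \<open>M\<close> is a set, and the module structure it
  inherits is \<open>M\<lparr>carrier := N\<rparr>\<close>.\<close>

definition rsubmodule ::
    "('a, 'm) ring_scheme \<Rightarrow> ('a, 'b, 'n) rmodule_scheme \<Rightarrow> 'b set \<Rightarrow> bool" where
  "rsubmodule R M N \<longleftrightarrow>
     subgroup N (add_monoid M) \<and> (\<forall>x\<in>N. \<forall>a\<in>carrier R. x \<cdot>\<^bsub>M\<^esub> a \<in> N)"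

definition rspan ::
    "('a, 'm) ring_scheme \<Rightarrow> ('a, 'b, 'n) rmodule_scheme \<Rightarrow> 'b set \<Rightarrow> 'b set" where
  "rspan R M S = \<Inter>{N. rsubmodule R M N \<and> S \<subseteq> N}"

definition finitely_generated_rmodule ::
    "('a, 'm) ring_scheme \<Rightarrow> ('a, 'b, 'n) rmodule_scheme \<Rightarrow> bool" where
  "finitely_generated_rmodule R M \<longleftrightarrow> (\<exists>S. finite S \<and> S \<subseteq> carrier M \<and> rspan R M S = carrier M)"

definition rmodule_hom ::
    "('a, 'm) ring_scheme \<Rightarrow> ('a, 'b, 'n) rmodule_scheme \<Rightarrow> ('a, 'c, 'o) rmodule_scheme
      \<Rightarrow> ('b \<Rightarrow> 'c) set" where
  "rmodule_hom R M N = {f \<in> carrier M \<rightarrow> carrier N.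
     (\<forall>x\<in>carrier M. \<forall>y\<in>carrier M. f (x \<oplus>\<^bsub>M\<^esub> y) = f x \<oplus>\<^bsub>N\<^esub> f y) \<and>
     (\<forall>x\<in>carrier M. \<forall>a\<in>carrier R. f (x \<cdot>\<^bsub>M\<^esub> a) = f x \<cdot>\<^bsub>N\<^esub> a)}"

definition rmodule_iso ::
    "('a, 'm) ring_scheme \<Rightarrow> ('a, 'b, 'n) rmodule_scheme \<Rightarrow> ('a, 'c, 'o) rmodule_scheme \<Rightarrow> bool"
  where
  "rmodule_iso R M N \<longleftrightarrow> (\<exists>f \<in> rmodule_hom R M N. bij_betw f (carrier M) (carrier N))"

definition rmodule_embeds ::
    "('a, 'm) ring_scheme \<Rightarrow> ('a, 'b, 'n) rmodule_scheme \<Rightarrow> ('a, 'c, 'o) rmodule_scheme \<Rightarrow> bool"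
  where
  "rmodule_embeds R M N \<longleftrightarrow> (\<exists>f \<in> rmodule_hom R M N. inj_on f (carrier M))"

definition rmodule_basis ::
    "('a, 'm) ring_scheme \<Rightarrow> ('a, 'b, 'n) rmodule_scheme \<Rightarrow> 'b set \<Rightarrow> bool" where
  "rmodule_basis R M B \<longleftrightarrow> B \<subseteq> carrier M \<and> rspan R M B = carrier M \<and>
     (\<forall>A c. finite A \<and> A \<subseteq> B \<and> c \<in> A \<rightarrow> carrier R \<and> (\<Oplus>\<^bsub>M\<^esub>b\<in>A. b \<cdot>\<^bsub>M\<^esub> c b) = \<zero>\<^bsub>M\<^esub>
        \<longrightarrow> (\<forall>b\<in>A. c b = \<zero>\<^bsub>R\<^esub>))"

definition free_rmodule ::
    "('a, 'm) ring_scheme \<Rightarrow> ('a, 'b, 'n) rmodule_scheme \<Rightarrow> bool" where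
  "free_rmodule R M \<longleftrightarrow> (\<exists>B. rmodule_basis R M B)"

definition direct_summand ::
    "('a, 'm) ring_scheme \<Rightarrow> ('a, 'b, 'n) rmodule_scheme \<Rightarrow> 'b set \<Rightarrow> bool" where
  "direct_summand R M D \<longleftrightarrow> rsubmodule R M D \<and>
     (\<exists>K. rsubmodule R M K \<and> D \<inter> K = {\<zero>\<^bsub>M\<^esub>} \<and> D <+>\<^bsub>M\<^esub> K = carrier M)"

definition essential_submodule ::
    "('a, 'm) ring_scheme \<Rightarrow> ('a, 'b, 'n) rmodule_scheme \<Rightarrow> 'b set \<Rightarrow> bool" where
  "essential_submodule R M N \<longleftrightarrow> rsubmodule R M N \<and>
     (\<forall>K. rsubmodule R M K \<and> N \<inter> K = {\<zero>\<^bsub>M\<^esub>} \<longrightarrow> K = {\<zero>\<^bsub>M\<^esub>})"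

definition essential_in_direct_summand ::
    "('a, 'm) ring_scheme \<Rightarrow> ('a, 'b, 'n) rmodule_scheme \<Rightarrow> 'b set \<Rightarrow> bool" where
  "essential_in_direct_summand R M N \<longleftrightarrow>
     (\<exists>D. direct_summand R M D \<and> essential_submodule R (M\<lparr>carrier := D\<rparr>) N)"

definition simple_rmodule ::
    "('a, 'm) ring_scheme \<Rightarrow> ('a, 'b, 'n) rmodule_scheme \<Rightarrow> bool" where
  "simple_rmodule R M \<longleftrightarrow> carrier M \<noteq> {\<zero>\<^bsub>M\<^esub>} \<and>
     (\<forall>N. rsubmodule R M N \<longrightarrow> N = {\<zero>\<^bsub>M\<^esub>} \<or> N = carrier M)"

text \<open>Semisimple: the sum of the simple submodules is everything.\<close>

definition semisimple_rmodule ::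
    "('a, 'm) ring_scheme \<Rightarrow> ('a, 'b, 'n) rmodule_scheme \<Rightarrow> bool" where
  "semisimple_rmodule R M \<longleftrightarrow>
     rspan R M (\<Union>{S. rsubmodule R M S \<and> simple_rmodule R (M\<lparr>carrier := S\<rparr>)}) = carrier M"

definition singular_rmodule ::
    "('a, 'm) ring_scheme \<Rightarrow> ('a, 'b, 'n) rmodule_scheme \<Rightarrow> bool" where
  "singular_rmodule R M \<longleftrightarrow> (\<forall>x\<in>carrier M.
     essential_submodule R (regular_rmodule R) {a \<in> carrier R. x \<cdot>\<^bsub>M\<^esub> a = \<zero>\<^bsub>M\<^esub>})"

section \<open>The conditions on modules and rings\<close>

definition weak_CS ::
    "('a, 'm) ring_scheme \<Rightarrow> ('a, 'b, 'n) rmodule_scheme \<Rightarrow> bool" where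
  "weak_CS R M \<longleftrightarrow> (\<forall>N. rsubmodule R M N \<and> semisimple_rmodule R (M\<lparr>carrier := N\<rparr>)
     \<longrightarrow> essential_in_direct_summand R M N)"

definition s_CS ::
    "('a, 'm) ring_scheme \<Rightarrow> ('a, 'b, 'n) rmodule_scheme \<Rightarrow> bool" where
  "s_CS R M \<longleftrightarrow> (\<forall>N. rsubmodule R M N \<and> singular_rmodule R (M\<lparr>carrier := N\<rparr>)
     \<longrightarrow> essential_in_direct_summand R M N)"

definition GC2 ::
    "('a, 'm) ring_scheme \<Rightarrow> ('a, 'b, 'n) rmodule_scheme \<Rightarrow> bool" where
  "GC2 R M \<longleftrightarrow> (\<forall>N. rsubmodule R M N \<and> rmodule_iso R (M\<lparr>carrier := N\<rparr>) M
     \<longrightarrow> direct_summand R M N)"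

definition right_weak_CS :: "('a, 'm) ring_scheme \<Rightarrow> bool" where
  "right_weak_CS R \<longleftrightarrow> weak_CS R (regular_rmodule R)"

definition right_s_CS :: "('a, 'm) ring_scheme \<Rightarrow> bool" where
  "right_s_CS R \<longleftrightarrow> s_CS R (regular_rmodule R)"

definition right_GC2 :: "('a, 'm) ring_scheme \<Rightarrow> bool" where
  "right_GC2 R \<longleftrightarrow> GC2 R (regular_rmodule R)"

text \<open>A hypothesis cannot quantify over types, so the modules range over those with elements of type
  \<^typ>\<open>nat \<Rightarrow> 'a\<close>. This is no restriction: the lemmas \<open>right_FGF_embeds\<close> and
  \<open>embeds_free_nat\<close> below show that, for every type \<open>'b\<close>, the condition is what one gets
  with finitely generated modules over \<open>'b\<close> and free modules over arbitrary types.\<close>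

definition right_FGF :: "('a, 'm) ring_scheme \<Rightarrow> bool" where
  "right_FGF R \<longleftrightarrow>
     (\<forall>M :: ('a, nat \<Rightarrow> 'a) rmodule. right_module R M \<and> finitely_generated_rmodule R M \<longrightarrow>
        (\<exists>F :: ('a, nat \<Rightarrow> 'a) rmodule.
           right_module R F \<and> free_rmodule R F \<and> rmodule_embeds R M F))"

definition artinian_rmodule ::
    "('a, 'm) ring_scheme \<Rightarrow> ('a, 'b, 'n) rmodule_scheme \<Rightarrow> bool" where
  "artinian_rmodule R M \<longleftrightarrow>
     (\<forall>N :: nat \<Rightarrow> 'b set. (\<forall>i. rsubmodule R M (N i)) \<and> (\<forall>i. N (Suc i) \<subseteq> N i)
        \<longrightarrow> (\<exists>k. \<forall>i\<ge>k. N i = N k))"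

text \<open>The first argument is the type of the elements of the test modules. A theorem concluding
  \<open>injective_rmodule TYPE('c) R E\<close> for a type variable \<open>'c\<close> states injectivity with
  respect to all modules, since \<open>'c\<close> is universally quantified.\<close>

definition injective_rmodule ::
    "'c itself \<Rightarrow> ('a, 'm) ring_scheme \<Rightarrow> ('a, 'b, 'n) rmodule_scheme \<Rightarrow> bool" where
  "injective_rmodule TYPE('c) R E \<longleftrightarrow>
     (\<forall>(M :: ('a, 'c) rmodule) N. right_module R M \<and> rsubmodule R M N \<longrightarrow>
        (\<forall>f \<in> rmodule_hom R (M\<lparr>carrier := N\<rparr>) E. \<exists>g \<in> rmodule_hom R M E. \<forall>x\<in>N. g x = f x))"

text \<open>For quasi-Frobenius rings each of the two conditions may be required on either side, with the
  same result; here both are on the right.\<close>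

definition quasi_frobenius :: "'c itself \<Rightarrow> ('a, 'm) ring_scheme \<Rightarrow> bool" where
  "quasi_frobenius TYPE('c) R \<longleftrightarrow>
     artinian_rmodule R (regular_rmodule R) \<and> injective_rmodule TYPE('c) R (regular_rmodule R)"

section \<open>Independence of \<open>right_FGF\<close> from the chosen element types\<close>

lemma rmodule_homD:
  assumes "f \<in> rmodule_hom R M N"
  shows "\<And>x. x \<in> carrier M \<Longrightarrow> f x \<in> carrier N"
    and "\<And>x y. \<lbrakk>x \<in> carrier M; y \<in> carrier M\<rbrakk> \<Longrightarrow> f (x \<oplus>\<^bsub>M\<^esub> y) = f x \<oplus>\<^bsub>N\<^esub> f y"
    and "\<And>x a. \<lbrakk>x \<in> carrier M; a \<in> carrier R\<rbrakk> \<Longrightarrow> f (x \<cdot>\<^bsub>M\<^esub> a) = f x \<cdot>\<^bsub>N\<^esub> a"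
  using assms by (auto simp: rmodule_hom_def)

lemma rmodule_hom_comp:
  assumes "f \<in> rmodule_hom R M N" "g \<in> rmodule_hom R N P"
  shows "g \<circ> f \<in> rmodule_hom R M P"
  using assms by (auto simp: rmodule_hom_def Pi_iff)

lemma rmodule_embeds_trans:
  assumes "rmodule_embeds R M N" "rmodule_embeds R N P"
  shows "rmodule_embeds R M P"
proof -
  obtain f g where f: "f \<in> rmodule_hom R M N" "inj_on f (carrier M)"
    and g: "g \<in> rmodule_hom R N P" "inj_on g (carrier N)"
    using assms by (auto simp: rmodule_embeds_def)
  have "inj_on (g \<circ> f) (carrier M)"
    using f g(2) rmodule_homD(1)[OF f(1)] by (intro comp_inj_on inj_on_subset[OF g(2)]) auto
  then show ?thesis
    using rmodule_hom_comp[OF f(1) g(1)] by (auto simp: rmodule_embeds_def)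
qed

lemma rsubmoduleD:
  assumes "rsubmodule R M N"
  shows "N \<subseteq> carrier M" "\<zero>\<^bsub>M\<^esub> \<in> N"
    and "\<And>x y. \<lbrakk>x \<in> N; y \<in> N\<rbrakk> \<Longrightarrow> x \<oplus>\<^bsub>M\<^esub> y \<in> N"
    and "\<And>x a. \<lbrakk>x \<in> N; a \<in> carrier R\<rbrakk> \<Longrightarrow> x \<cdot>\<^bsub>M\<^esub> a \<in> N"
  using assms subgroup.subset[of N "add_monoid M"] subgroup.one_closed[of N "add_monoid M"]
    subgroup.m_closed[of N "add_monoid M"]
  by (auto simp: rsubmodule_def)

lemma rmodule_basisD:
  assumes "rmodule_basis R M B"
  shows "B \<subseteq> carrier M" "rspan R M B = carrier M"
    and "\<And>A c. \<lbrakk>finite A; A \<subseteq> B; c \<in> A \<rightarrow> carrier R; (\<Oplus>\<^bsub>M\<^esub>b\<in>A. b \<cdot>\<^bsub>M\<^esub> c b) = \<zero>\<^bsub>M\<^esub>\<rbrakk>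
      \<Longrightarrow> \<forall>b\<in>A. c b = \<zero>\<^bsub>R\<^esub>"
  using assms by (simp_all add: rmodule_basis_def)

lemma rmodule_basisI:
  assumes "B \<subseteq> carrier M" "rspan R M B = carrier M"
    and "\<And>A c. \<lbrakk>finite A; A \<subseteq> B; c \<in> A \<rightarrow> carrier R; (\<Oplus>\<^bsub>M\<^esub>b\<in>A. b \<cdot>\<^bsub>M\<^esub> c b) = \<zero>\<^bsub>M\<^esub>\<rbrakk>
      \<Longrightarrow> \<forall>b\<in>A. c b = \<zero>\<^bsub>R\<^esub>"
  shows "rmodule_basis R M B"
  unfolding rmodule_basis_def by (intro conjI allI impI assms(1,2)) (elim conjE, rule assms(3))

context right_module
begin

lemma rsmult_uminus_one:
  assumes "x \<in> carrier M"
  shows "x \<cdot>\<^bsub>M\<^esub> (\<ominus> \<one>) = \<ominus>\<^bsub>M\<^esub> x"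
proof -
  have z: "x \<cdot>\<^bsub>M\<^esub> \<zero> = \<zero>\<^bsub>M\<^esub>"
    using assms rsmult_add_right[of x \<zero> \<zero>] by simp
  have "x \<oplus>\<^bsub>M\<^esub> x \<cdot>\<^bsub>M\<^esub> (\<ominus> \<one>) = x \<cdot>\<^bsub>M\<^esub> (\<one> \<oplus> \<ominus> \<one>)"
    using assms by (simp add: rsmult_add_right del: R.r_neg)
  then have "x \<oplus>\<^bsub>M\<^esub> x \<cdot>\<^bsub>M\<^esub> (\<ominus> \<one>) = \<zero>\<^bsub>M\<^esub>"
    using z by (simp add: R.r_neg)
  then show ?thesis
    using assms M.minus_equality M.a_comm by (metis R.a_inv_closed R.one_closed rsmult_closed)
qed

lemma rsmult_zero_right [simp]: "x \<in> carrier M \<Longrightarrow> x \<cdot>\<^bsub>M\<^esub> \<zero> = \<zero>\<^bsub>M\<^esub>"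
  using rsmult_add_right[of x \<zero> \<zero>] by simp

lemma rsmult_zero_left [simp]: "a \<in> carrier R \<Longrightarrow> \<zero>\<^bsub>M\<^esub> \<cdot>\<^bsub>M\<^esub> a = \<zero>\<^bsub>M\<^esub>"
  using rsmult_add_left[of "\<zero>\<^bsub>M\<^esub>" "\<zero>\<^bsub>M\<^esub>" a] by simp

lemma rsubmoduleI:
  assumes "N \<subseteq> carrier M" "\<zero>\<^bsub>M\<^esub> \<in> N"
    and "\<And>x y. \<lbrakk>x \<in> N; y \<in> N\<rbrakk> \<Longrightarrow> x \<oplus>\<^bsub>M\<^esub> y \<in> N"
    and "\<And>x a. \<lbrakk>x \<in> N; a \<in> carrier R\<rbrakk> \<Longrightarrow> x \<cdot>\<^bsub>M\<^esub> a \<in> N"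
  shows "rsubmodule R M N"
proof -
  have "\<ominus>\<^bsub>M\<^esub> x \<in> N" if "x \<in> N" for x
    using assms(1,4) that rsmult_uminus_one[of x] by (metis R.a_inv_closed R.one_closed subsetD)
  then have "subgroup N (add_monoid M)"
    using assms by (intro M.add.subgroupI) auto
  then show ?thesis
    using assms(4) by (simp add: rsubmodule_def)
qed

lemma carrier_rsubmodule: "rsubmodule R M (carrier M)"
  by (rule rsubmoduleI) auto

lemma rspan_rsubmodule:
  assumes "S \<subseteq> carrier M"
  shows "rsubmodule R M (rspan R M S)"
proof (rule rsubmoduleI)
  show "rspan R M S \<subseteq> carrier M"
    using assms carrier_rsubmodule by (auto simp: rspan_def)
qed (auto simp: rspan_def rsubmoduleD)

lemma rspan_superset: "S \<subseteq> rspan R M S"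
  by (auto simp: rspan_def)

lemma rspan_least: "\<lbrakk>rsubmodule R M N; S \<subseteq> N\<rbrakk> \<Longrightarrow> rspan R M S \<subseteq> N"
  by (auto simp: rspan_def)

lemma rsubmodule_right_module:
  assumes "rsubmodule R M N"
  shows "right_module R (M\<lparr>carrier := N\<rparr>)"
proof -
  have sub: "N \<subseteq> carrier M"
    using assms by (rule rsubmoduleD)
  have "abelian_group (M\<lparr>carrier := N\<rparr>)"
  proof (rule abelian_groupI)
    fix x assume "x \<in> carrier (M\<lparr>carrier := N\<rparr>)"
    then have "x \<in> N" by simp
    then have "x \<cdot>\<^bsub>M\<^esub> (\<ominus> \<one>) \<in> N" "x \<cdot>\<^bsub>M\<^esub> (\<ominus> \<one>) \<oplus>\<^bsub>M\<^esub> x = \<zero>\<^bsub>M\<^esub>"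
      using sub rsubmoduleD(4)[OF assms] by (auto simp: rsmult_uminus_one M.l_neg)
    then show "\<exists>y\<in>carrier (M\<lparr>carrier := N\<rparr>).
        y \<oplus>\<^bsub>M\<lparr>carrier := N\<rparr>\<^esub> x = \<zero>\<^bsub>M\<lparr>carrier := N\<rparr>\<^esub>" by auto
  qed (use sub in \<open>auto simp: rsubmoduleD[OF assms] M.a_ac subset_iff\<close>)
  then show ?thesis
    unfolding right_module_def right_module_axioms_def using R.ring_axioms sub
    by (auto simp: rsubmoduleD[OF assms] rsmult_add_left rsmult_add_right rsmult_assoc subset_iff)
qed

lemma rsubmodule_trans:
  assumes "rsubmodule R M N" "rsubmodule R (M\<lparr>carrier := N\<rparr>) K"
  shows "rsubmodule R M K"
proof -
  interpret N: right_module R "M\<lparr>carrier := N\<rparr>"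
    using assms(1) by (rule rsubmodule_right_module)
  show ?thesis
    using rsubmoduleD[OF assms(1)] rsubmoduleD[OF assms(2)] by (intro rsubmoduleI) auto
qed

lemma finsum_rsubmodule:
  assumes "rsubmodule R M N" "finite A" "f \<in> A \<rightarrow> N"
  shows "finsum (M\<lparr>carrier := N\<rparr>) f A = finsum M f A"
proof -
  interpret N: right_module R "M\<lparr>carrier := N\<rparr>"
    using assms(1) by (rule rsubmodule_right_module)
  have sub: "N \<subseteq> carrier M"
    using assms(1) by (rule rsubmoduleD)
  show ?thesis
    using assms(2,3)
  proof (induction A)
    case (insert x A)
    then have "f \<in> A \<rightarrow> N" "f x \<in> N" "f \<in> A \<rightarrow> carrier M" "f x \<in> carrier M"
      using sub by auto
    then show ?case
      using insert by (simp add: N.finsum_insert M.finsum_insert)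
  qed (simp add: N.finsum_empty M.finsum_empty)
qed

lemma hom_zero:
  assumes "right_module R N" "f \<in> rmodule_hom R M N"
  shows "f \<zero>\<^bsub>M\<^esub> = \<zero>\<^bsub>N\<^esub>"
proof -
  interpret N: right_module R N by fact
  have "f (\<zero>\<^bsub>M\<^esub> \<cdot>\<^bsub>M\<^esub> \<zero>) = f \<zero>\<^bsub>M\<^esub> \<cdot>\<^bsub>N\<^esub> \<zero>"
    using rmodule_homD(3)[OF assms(2)] by blast
  then show ?thesis
    using rmodule_homD(1)[OF assms(2)] by simp
qed

lemma hom_finsum:
  assumes "right_module R N" "f \<in> rmodule_hom R M N" "finite A" "g \<in> A \<rightarrow> carrier M"
  shows "f (finsum M g A) = finsum N (\<lambda>x. f (g x)) A"
proof -
  interpret N: right_module R N by fact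
  show ?thesis
    using assms(3,4)
  proof (induction A)
    case (insert x A)
    then have g: "g \<in> A \<rightarrow> carrier M" "g x \<in> carrier M" by auto
    then have "(\<lambda>x. f (g x)) \<in> A \<rightarrow> carrier N" "f (g x) \<in> carrier N"
      using rmodule_homD(1)[OF assms(2)] by auto
    then show ?case
      using insert g
      by (simp add: N.finsum_insert M.finsum_insert M.finsum_closed rmodule_homD(2)[OF assms(2)])
  qed (simp add: N.finsum_empty M.finsum_empty hom_zero[OF assms(1,2)])
qed

lemma vimage_rsubmodule:
  assumes "right_module R N" "f \<in> rmodule_hom R M N" "rsubmodule R N K"
  shows "rsubmodule R M {x \<in> carrier M. f x \<in> K}"
  using rsubmoduleD[OF assms(3)] rmodule_homD[OF assms(2)] hom_zero[OF assms(1,2)]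
  by (intro rsubmoduleI) auto

lemma finite_rspan:
  assumes "finite S" "S \<subseteq> carrier M" "x \<in> rspan R M S"
  obtains c where "c \<in> S \<rightarrow> carrier R" "x = (\<Oplus>\<^bsub>M\<^esub>s\<in>S. s \<cdot>\<^bsub>M\<^esub> c s)"
proof -
  define L where "L = {\<Oplus>\<^bsub>M\<^esub>s\<in>S. s \<cdot>\<^bsub>M\<^esub> c s | c. c \<in> S \<rightarrow> carrier R}"
  have mem: "(\<lambda>s. s \<cdot>\<^bsub>M\<^esub> c s) \<in> S \<rightarrow> carrier M" if "c \<in> S \<rightarrow> carrier R" for c
    using that assms(2) by auto
  have scale: "(\<Oplus>\<^bsub>M\<^esub>s\<in>S. s \<cdot>\<^bsub>M\<^esub> c s) \<cdot>\<^bsub>M\<^esub> a = (\<Oplus>\<^bsub>M\<^esub>s\<in>S. s \<cdot>\<^bsub>M\<^esub> (c s \<otimes> a))"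
    if "c \<in> S \<rightarrow> carrier R" "a \<in> carrier R" for c a
    using assms(1,2) that
  proof (induction S)
    case (insert s S)
    then have "(\<lambda>s. s \<cdot>\<^bsub>M\<^esub> c s) \<in> S \<rightarrow> carrier M" "(\<lambda>s. s \<cdot>\<^bsub>M\<^esub> (c s \<otimes> a)) \<in> S \<rightarrow> carrier M"
      "s \<in> carrier M" "c s \<in> carrier R" by auto
    then show ?case
      using insert
      by (simp add: M.finsum_insert M.finsum_closed rsmult_add_left rsmult_assoc)
  qed (simp add: M.finsum_empty)
  have "rsubmodule R M L"
  proof (rule rsubmoduleI)
    show "L \<subseteq> carrier M"
      using mem by (auto simp: L_def intro!: M.finsum_closed)
    have "(\<Oplus>\<^bsub>M\<^esub>s\<in>S. s \<cdot>\<^bsub>M\<^esub> \<zero>) = \<zero>\<^bsub>M\<^esub>"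
      using assms(2) by (intro M.add.finprod_one_eqI) auto
    then have "\<exists>c. \<zero>\<^bsub>M\<^esub> = (\<Oplus>\<^bsub>M\<^esub>s\<in>S. s \<cdot>\<^bsub>M\<^esub> c s) \<and> c \<in> S \<rightarrow> carrier R"
      by (intro exI[of _ "\<lambda>_. \<zero>"]) auto
    then show "\<zero>\<^bsub>M\<^esub> \<in> L"
      by (simp add: L_def)
  next
    fix x y assume "x \<in> L" "y \<in> L"
    then obtain c d where c: "c \<in> S \<rightarrow> carrier R" "x = (\<Oplus>\<^bsub>M\<^esub>s\<in>S. s \<cdot>\<^bsub>M\<^esub> c s)"
      and d: "d \<in> S \<rightarrow> carrier R" "y = (\<Oplus>\<^bsub>M\<^esub>s\<in>S. s \<cdot>\<^bsub>M\<^esub> d s)"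
      by (auto simp: L_def)
    have cd: "(\<lambda>s. c s \<oplus> d s) \<in> S \<rightarrow> carrier R"
      using c d by auto
    have "x \<oplus>\<^bsub>M\<^esub> y = (\<Oplus>\<^bsub>M\<^esub>s\<in>S. s \<cdot>\<^bsub>M\<^esub> c s \<oplus>\<^bsub>M\<^esub> s \<cdot>\<^bsub>M\<^esub> d s)"
      using c d mem by (simp add: M.finsum_addf)
    also have "\<dots> = (\<Oplus>\<^bsub>M\<^esub>s\<in>S. s \<cdot>\<^bsub>M\<^esub> (c s \<oplus> d s))"
      using mem[OF cd] c(1) d(1) assms(2)
      by (intro M.finsum_cong') (auto simp: rsmult_add_right Pi_iff subset_iff)
    finally show "x \<oplus>\<^bsub>M\<^esub> y \<in> L"
      using cd by (auto simp: L_def)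
  next
    fix x a assume "x \<in> L" "a \<in> carrier R"
    then obtain c where c: "c \<in> S \<rightarrow> carrier R" "x = (\<Oplus>\<^bsub>M\<^esub>s\<in>S. s \<cdot>\<^bsub>M\<^esub> c s)"
      by (auto simp: L_def)
    moreover have "(\<lambda>s. c s \<otimes> a) \<in> S \<rightarrow> carrier R"
      using c \<open>a \<in> carrier R\<close> by auto
    ultimately show "x \<cdot>\<^bsub>M\<^esub> a \<in> L"
      using scale[OF c(1) \<open>a \<in> carrier R\<close>] by (auto simp: L_def)
  qed
  moreover have "S \<subseteq> L"
  proof
    fix t assume t: "t \<in> S"
    have "(\<Oplus>\<^bsub>M\<^esub>s\<in>S. if t = s then s else \<zero>\<^bsub>M\<^esub>) = t"
      using t assms M.finsum_singleton[of t S "\<lambda>s. s"] by auto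
    moreover have "(\<Oplus>\<^bsub>M\<^esub>s\<in>S. s \<cdot>\<^bsub>M\<^esub> (if t = s then \<one> else \<zero>))
        = (\<Oplus>\<^bsub>M\<^esub>s\<in>S. if t = s then s else \<zero>\<^bsub>M\<^esub>)"
      using assms(2) by (intro M.finsum_cong') auto
    ultimately have "\<exists>c. t = (\<Oplus>\<^bsub>M\<^esub>s\<in>S. s \<cdot>\<^bsub>M\<^esub> c s) \<and> c \<in> S \<rightarrow> carrier R"
      by (intro exI[of _ "\<lambda>s. if t = s then \<one> else \<zero>"]) auto
    then show "t \<in> L"
      by (simp add: L_def)
  qed
  ultimately have "x \<in> L"
    using assms(3) rspan_least by blast
  then show ?thesis
    using that by (auto simp: L_def)
qed

lemma transport_right_module:
  fixes \<phi> :: "_ \<Rightarrow> 'e"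
  assumes "inj_on \<phi> (carrier M)"
  obtains N :: "('a, 'e) rmodule" where "right_module R N" "\<phi> \<in> rmodule_hom R M N"
    "carrier N = \<phi> ` carrier M"
proof -
  define \<psi> where "\<psi> = inv_into (carrier M) \<phi>"
  define N :: "('a, 'e) rmodule" where
    "N = \<lparr>carrier = \<phi> ` carrier M, mult = undefined, one = undefined, zero = \<phi> \<zero>\<^bsub>M\<^esub>,
      add = \<lambda>x y. \<phi> (\<psi> x \<oplus>\<^bsub>M\<^esub> \<psi> y), rsmult = \<lambda>x a. \<phi> (\<psi> x \<cdot>\<^bsub>M\<^esub> a)\<rparr>"
  have [simp]: "\<psi> (\<phi> x) = x" if "x \<in> carrier M" for x
    using that assms by (simp add: \<psi>_def)
  have "abelian_group N"
  proof (rule abelian_groupI)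
    fix x assume "x \<in> carrier N"
    then obtain m where "m \<in> carrier M" "x = \<phi> m" by (auto simp: N_def)
    then show "\<exists>y\<in>carrier N. y \<oplus>\<^bsub>N\<^esub> x = \<zero>\<^bsub>N\<^esub>"
      by (intro bexI[of _ "\<phi> (\<ominus>\<^bsub>M\<^esub> m)"]) (auto simp: N_def M.l_neg)
  qed (auto simp: N_def M.a_assoc intro!: arg_cong[of _ _ \<phi>] M.a_comm)
  moreover have "right_module_axioms R N"
    by unfold_locales (auto simp: N_def rsmult_add_left rsmult_add_right rsmult_assoc)
  ultimately have "right_module R N"
    using R.ring_axioms by (simp add: right_module_def)
  moreover have "\<phi> \<in> rmodule_hom R M N"
    by (auto simp: rmodule_hom_def N_def)
  ultimately show ?thesis
    using that by (simp add: N_def)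
qed

lemma finitely_generated_nat:
  assumes "finitely_generated_rmodule R M"
  obtains N :: "('a, nat \<Rightarrow> 'a) rmodule" and \<phi> where
    "right_module R N" "\<phi> \<in> rmodule_hom R M N" "bij_betw \<phi> (carrier M) (carrier N)"
proof -
  obtain S where S: "finite S" "S \<subseteq> carrier M" "rspan R M S = carrier M"
    using assms by (auto simp: finitely_generated_rmodule_def)
  obtain h :: "_ \<Rightarrow> nat" where h: "inj_on h S"
    using S(1) by (meson finite_imp_inj_to_nat_seg)
  define P where "P m d \<longleftrightarrow> (\<Oplus>\<^bsub>M\<^esub>s\<in>S. s \<cdot>\<^bsub>M\<^esub> d (h s)) = m" for m and d :: "nat \<Rightarrow> 'a"
  define \<phi> where "\<phi> m = (SOME d. P m d)" for m
  have P: "P m (\<phi> m)" if "m \<in> carrier M" for m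
  proof -
    have "m \<in> rspan R M S"
      using that S by simp
    then obtain c where c: "c \<in> S \<rightarrow> carrier R" "m = (\<Oplus>\<^bsub>M\<^esub>s\<in>S. s \<cdot>\<^bsub>M\<^esub> c s)"
      using finite_rspan[OF S(1,2)] by blast
    have "(\<Oplus>\<^bsub>M\<^esub>s\<in>S. s \<cdot>\<^bsub>M\<^esub> c (inv_into S h (h s))) = (\<Oplus>\<^bsub>M\<^esub>s\<in>S. s \<cdot>\<^bsub>M\<^esub> c s)"
      using c S h by (intro M.finsum_cong') auto
    then have "P m (\<lambda>i. c (inv_into S h i))"
      using c(2) by (simp add: P_def)
    then show ?thesis
      unfolding \<phi>_def by (rule someI[of "P m"])
  qed
  have inj: "inj_on \<phi> (carrier M)"
    by (rule inj_onI) (metis P P_def)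
  obtain N :: "('a, nat \<Rightarrow> 'a) rmodule" where "right_module R N" "\<phi> \<in> rmodule_hom R M N"
    "carrier N = \<phi> ` carrier M"
    using inj by (rule transport_right_module)
  with inj that show ?thesis
    by (auto simp: bij_betw_def)
qed

lemma basis_image:
  assumes N: "right_module R N" and f: "f \<in> rmodule_hom R M N"
    and bij: "bij_betw f (carrier M) (carrier N)" and B: "rmodule_basis R M B"
  shows "rmodule_basis R N (f ` B)"
proof -
  interpret N: right_module R N by fact
  note BM = rmodule_basisD(1)[OF B] and span = rmodule_basisD(2)[OF B]
    and indep = rmodule_basisD(3)[OF B]
  have inj: "inj_on f (carrier M)"
    using bij by (simp add: bij_betw_def)
  have BN: "f ` B \<subseteq> carrier N"
    using BM rmodule_homD(1)[OF f] by auto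
  have "carrier N \<subseteq> rspan R N (f ` B)"
  proof -
    have "B \<subseteq> {x \<in> carrier M. f x \<in> rspan R N (f ` B)}"
      using BM N.rspan_superset[of "f ` B"] by auto
    then have "carrier M \<subseteq> {x \<in> carrier M. f x \<in> rspan R N (f ` B)}"
      using rspan_least[OF vimage_rsubmodule[OF N f N.rspan_rsubmodule[OF BN]], of B] span by simp
    then have "f ` carrier M \<subseteq> rspan R N (f ` B)"
      by auto
    then show ?thesis
      using bij by (simp add: bij_betw_def)
  qed
  then have "rspan R N (f ` B) = carrier N"
    using rsubmoduleD(1)[OF N.rspan_rsubmodule[OF BN]] by (simp add: subset_antisym)
  moreover have "\<forall>b\<in>A. c b = \<zero>"
    if A: "finite A" "A \<subseteq> f ` B" and c: "c \<in> A \<rightarrow> carrier R"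
      and sum: "(\<Oplus>\<^bsub>N\<^esub>b\<in>A. b \<cdot>\<^bsub>N\<^esub> c b) = \<zero>\<^bsub>N\<^esub>" for A c
  proof -
    obtain C where C: "C \<subseteq> B" "finite C" "A = f ` C"
      using A by (meson finite_subset_image)
    have CM: "C \<subseteq> carrier M" using C BM by auto
    have cC: "(\<lambda>x. c (f x)) \<in> C \<rightarrow> carrier R" using c C by auto
    have mem: "(\<lambda>x. x \<cdot>\<^bsub>M\<^esub> c (f x)) \<in> C \<rightarrow> carrier M" using CM cC by auto
    have memN: "(\<lambda>b. b \<cdot>\<^bsub>N\<^esub> c b) \<in> f ` C \<rightarrow> carrier N"
      using CM cC rmodule_homD(1)[OF f] by (auto simp: Pi_iff subset_iff)
    have "f (\<Oplus>\<^bsub>M\<^esub>x\<in>C. x \<cdot>\<^bsub>M\<^esub> c (f x)) = (\<Oplus>\<^bsub>N\<^esub>x\<in>C. f (x \<cdot>\<^bsub>M\<^esub> c (f x)))"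
      by (rule hom_finsum[OF N f C(2) mem])
    also have "\<dots> = (\<Oplus>\<^bsub>N\<^esub>x\<in>C. f x \<cdot>\<^bsub>N\<^esub> c (f x))"
      using memN CM cC by (intro N.finsum_cong') (auto simp: rmodule_homD(3)[OF f] Pi_iff subset_iff)
    also have "\<dots> = (\<Oplus>\<^bsub>N\<^esub>b\<in>A. b \<cdot>\<^bsub>N\<^esub> c b)"
      using N.finsum_reindex[OF memN inj_on_subset[OF inj CM]] C(3) by simp
    finally have "f (\<Oplus>\<^bsub>M\<^esub>x\<in>C. x \<cdot>\<^bsub>M\<^esub> c (f x)) = f \<zero>\<^bsub>M\<^esub>"
      using sum hom_zero[OF N f] by simp
    then have "(\<Oplus>\<^bsub>M\<^esub>x\<in>C. x \<cdot>\<^bsub>M\<^esub> c (f x)) = \<zero>\<^bsub>M\<^esub>"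
      using inj_onD[OF inj] M.finsum_closed[OF mem] M.zero_closed by blast
    then show ?thesis
      using indep[OF C(2,1) cC] C(3) by blast
  qed
  ultimately show ?thesis
    using BN by (intro rmodule_basisI)
qed

lemma rspan_subbasis:
  assumes B: "rmodule_basis R M B" and A: "A \<subseteq> B"
  shows "rmodule_basis R (M\<lparr>carrier := rspan R M A\<rparr>) A"
proof -
  let ?N = "M\<lparr>carrier := rspan R M A\<rparr>"
  note BM = rmodule_basisD(1)[OF B]
  have sub: "rsubmodule R M (rspan R M A)"
    using A BM by (intro rspan_rsubmodule) auto
  interpret N: right_module R ?N
    using sub by (rule rsubmodule_right_module)
  have AN: "A \<subseteq> rspan R M A" by (rule rspan_superset)
  have spanN: "rsubmodule R ?N (rspan R ?N A)"
    using AN by (intro N.rspan_rsubmodule) auto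
  have "rspan R ?N A = rspan R M A"
    using rsubmoduleD(1)[OF spanN] rspan_least[OF rsubmodule_trans[OF sub spanN] N.rspan_superset]
    by auto
  moreover have "\<forall>b\<in>C. c b = \<zero>"
    if C: "finite C" "C \<subseteq> A" "c \<in> C \<rightarrow> carrier R" "(\<Oplus>\<^bsub>?N\<^esub>b\<in>C. b \<cdot>\<^bsub>M\<^esub> c b) = \<zero>\<^bsub>M\<^esub>" for C c
  proof -
    have "(\<lambda>b. b \<cdot>\<^bsub>M\<^esub> c b) \<in> C \<rightarrow> rspan R M A"
      using C AN rsubmoduleD(4)[OF sub] by (auto simp: Pi_iff subset_iff)
    then have "(\<Oplus>\<^bsub>M\<^esub>b\<in>C. b \<cdot>\<^bsub>M\<^esub> c b) = \<zero>\<^bsub>M\<^esub>"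
      using finsum_rsubmodule[OF sub C(1)] C(4) by simp
    moreover have "C \<subseteq> B"
      using A C by blast
    ultimately show ?thesis
      using rmodule_basisD(3)[OF B C(1) _ C(3)] by blast
  qed
  ultimately show ?thesis
    using AN by (intro rmodule_basisI) simp_all
qed

lemma rspan_mono: "S \<subseteq> T \<Longrightarrow> rspan R M S \<subseteq> rspan R M T"
  by (auto simp: rspan_def)

lemma rspan_finitary:
  assumes "S \<subseteq> carrier M" "x \<in> rspan R M S"
  obtains A where "finite A" "A \<subseteq> S" "x \<in> rspan R M A"
proof -
  define L where "L = (\<Union>A\<in>{A. finite A \<and> A \<subseteq> S}. rspan R M A)"
  have LI: "y \<in> L" if "finite A" "A \<subseteq> S" "y \<in> rspan R M A" for y A
    unfolding L_def using that by blast
  have LE: "\<exists>A. finite A \<and> A \<subseteq> S \<and> y \<in> rspan R M A" if "y \<in> L" for y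
    using that unfolding L_def by blast
  have sub: "rsubmodule R M (rspan R M A)" if "A \<subseteq> S" for A
    using that assms(1) by (intro rspan_rsubmodule) (rule subset_trans)
  have "rsubmodule R M L"
  proof (rule rsubmoduleI)
    show "L \<subseteq> carrier M"
      using LE rsubmoduleD(1)[OF sub] by blast
    show "\<zero>\<^bsub>M\<^esub> \<in> L"
      by (rule LI[OF _ _ rsubmoduleD(2)[OF sub[of "{}"]]]) simp_all
  next
    fix x y assume "x \<in> L" "y \<in> L"
    then obtain A C where A: "finite A" "A \<subseteq> S" "x \<in> rspan R M A"
      and C: "finite C" "C \<subseteq> S" "y \<in> rspan R M C"
      using LE by meson
    have AC: "A \<union> C \<subseteq> S"
      using A(2) C(2) by (rule Un_least)
    have "x \<in> rspan R M (A \<union> C)" "y \<in> rspan R M (A \<union> C)"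
      using subsetD[OF rspan_mono A(3)] subsetD[OF rspan_mono C(3)] by simp_all
    then have "x \<oplus>\<^bsub>M\<^esub> y \<in> rspan R M (A \<union> C)"
      by (rule rsubmoduleD(3)[OF sub[OF AC]])
    then show "x \<oplus>\<^bsub>M\<^esub> y \<in> L"
      by (rule LI[OF finite_UnI[OF A(1) C(1)] AC])
  next
    fix x a assume "x \<in> L" and a: "a \<in> carrier R"
    then obtain A where A: "finite A" "A \<subseteq> S" "x \<in> rspan R M A"
      using LE by meson
    show "x \<cdot>\<^bsub>M\<^esub> a \<in> L"
      by (rule LI[OF A(1,2) rsubmoduleD(4)[OF sub[OF A(2)] A(3) a]])
  qed
  moreover have "S \<subseteq> L"
  proof
    fix s assume "s \<in> S"
    then show "s \<in> L"
      using rspan_superset[of "{s}"] by (intro LI[of "{s}"]) simp_all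
  qed
  ultimately have "x \<in> L"
    using assms(2) rspan_least by (meson subsetD)
  then show ?thesis
    using LE that by meson
qed

lemma right_FGF_embeds:
  assumes "right_FGF R" "finitely_generated_rmodule R M"
  obtains F :: "('a, nat \<Rightarrow> 'a) rmodule" where
    "right_module R F" "free_rmodule R F" "rmodule_embeds R M F"
proof -
  obtain N :: "('a, nat \<Rightarrow> 'a) rmodule" and \<phi> where N: "right_module R N"
    and \<phi>: "\<phi> \<in> rmodule_hom R M N" "bij_betw \<phi> (carrier M) (carrier N)"
    using assms(2) by (rule finitely_generated_nat)
  interpret N: right_module R N by fact
  obtain S where S: "finite S" "S \<subseteq> carrier M" "rspan R M S = carrier M"
    using assms(2) by (auto simp: finitely_generated_rmodule_def)
  have SN: "\<phi> ` S \<subseteq> carrier N"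
    using S \<phi> by (auto simp: bij_betw_def)
  have "S \<subseteq> {x \<in> carrier M. \<phi> x \<in> rspan R N (\<phi> ` S)}"
    using S(2) N.rspan_superset[of "\<phi> ` S"] by auto
  then have "carrier M \<subseteq> {x \<in> carrier M. \<phi> x \<in> rspan R N (\<phi> ` S)}"
    using rspan_least[OF vimage_rsubmodule[OF N \<phi>(1) N.rspan_rsubmodule[OF SN]], of S] S(3) by simp
  then have "\<phi> ` carrier M \<subseteq> rspan R N (\<phi> ` S)"
    by auto
  then have "rspan R N (\<phi> ` S) = carrier N"
    using \<phi>(2) rsubmoduleD(1)[OF N.rspan_rsubmodule[OF SN]]
    by (simp add: bij_betw_def subset_antisym)
  then have "finitely_generated_rmodule R N"
    using S(1) SN by (auto simp: finitely_generated_rmodule_def)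
  then obtain F :: "('a, nat \<Rightarrow> 'a) rmodule" where
    F: "right_module R F" "free_rmodule R F" "rmodule_embeds R N F"
    using assms(1) N by (auto simp: right_FGF_def)
  moreover have "rmodule_embeds R M N"
    using \<phi> by (auto simp: rmodule_embeds_def bij_betw_def)
  ultimately show ?thesis
    using that rmodule_embeds_trans by blast
qed

lemma embeds_free_nat:
  fixes F :: "('a, 'e, 'f) rmodule_scheme"
  assumes fg: "finitely_generated_rmodule R M"
    and F: "right_module R F" "free_rmodule R F" "rmodule_embeds R M F"
  obtains F' :: "('a, nat \<Rightarrow> 'a) rmodule" where
    "right_module R F'" "free_rmodule R F'" "rmodule_embeds R M F'"
proof -
  interpret F: right_module R F by fact
  obtain B where B: "rmodule_basis R F B"
    using F(2) by (auto simp: free_rmodule_def)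
  note BF = rmodule_basisD(1,2)[OF B]
  obtain f where f: "f \<in> rmodule_hom R M F" "inj_on f (carrier M)"
    using F(3) by (auto simp: rmodule_embeds_def)
  obtain S where S: "finite S" "S \<subseteq> carrier M" "rspan R M S = carrier M"
    using fg by (auto simp: finitely_generated_rmodule_def)
  have "\<forall>s\<in>S. \<exists>A. finite A \<and> A \<subseteq> B \<and> f s \<in> rspan R F A"
  proof
    fix s assume "s \<in> S"
    then have "f s \<in> rspan R F B"
      using S(2) BF(2) rmodule_homD(1)[OF f(1)] by auto
    then show "\<exists>A. finite A \<and> A \<subseteq> B \<and> f s \<in> rspan R F A"
      using F.rspan_finitary[OF BF(1)] by metis
  qed
  then obtain A where A: "\<And>s. s \<in> S \<Longrightarrow> finite (A s) \<and> A s \<subseteq> B \<and> f s \<in> rspan R F (A s)"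
    by metis
  define C where "C = (\<Union>s\<in>S. A s)"
  have C: "finite C" "C \<subseteq> B"
    using A S(1) by (auto simp: C_def)
  let ?G = "F\<lparr>carrier := rspan R F C\<rparr>"
  have sub: "rsubmodule R F (rspan R F C)"
    using C BF by (intro F.rspan_rsubmodule) auto
  have basis: "rmodule_basis R ?G C"
    using B C(2) by (rule F.rspan_subbasis)
  interpret G: right_module R ?G
    using sub by (rule F.rsubmodule_right_module)
  have "S \<subseteq> {x \<in> carrier M. f x \<in> rspan R F C}"
  proof
    fix s assume s: "s \<in> S"
    then have "rspan R F (A s) \<subseteq> rspan R F C"
      by (intro F.rspan_mono) (auto simp: C_def)
    then show "s \<in> {x \<in> carrier M. f x \<in> rspan R F C}"
      using A[OF s] S(2) s by auto
  qed
  then have "carrier M \<subseteq> {x \<in> carrier M. f x \<in> rspan R F C}"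
    using rspan_least[OF vimage_rsubmodule[OF F(1) f(1) sub], of S] S(3) by simp
  then have "f \<in> rmodule_hom R M ?G"
    using f(1) by (auto simp: rmodule_hom_def)
  then have MG: "rmodule_embeds R M ?G"
    using f(2) by (auto simp: rmodule_embeds_def)
  have "finitely_generated_rmodule R ?G"
    using rmodule_basisD(1,2)[OF basis] C(1) unfolding finitely_generated_rmodule_def by blast
  then obtain F' :: "('a, nat \<Rightarrow> 'a) rmodule" and \<phi> where F': "right_module R F'"
    and \<phi>: "\<phi> \<in> rmodule_hom R ?G F'" "bij_betw \<phi> (carrier ?G) (carrier F')"
    by (rule G.finitely_generated_nat)
  have "free_rmodule R F'"
    using G.basis_image[OF F' \<phi> basis] by (auto simp: free_rmodule_def)
  moreover have "rmodule_embeds R ?G F'"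
    using \<phi> by (auto simp: rmodule_embeds_def bij_betw_def)
  ultimately show ?thesis
    using that F' rmodule_embeds_trans[OF MG] by blast
qed

end

end

theory Submission
  imports Defs "HOL-Algebra.Free_Abelian_Groups"
begin

text \<open>
  FGF says that submodules of \<open>R\<^sup>2\<close> are solution sets of
  finitely many linear equations, so that every maximal right ideal is an annihilator \<open>r(c)\<close>, and GC2
  says that \<open>r(a) = 0\<close> forces \<open>a\<close> to have a left inverse. Either CS condition makes a sum of singular
  minimal right ideals essential in some \<open>fR\<close> with \<open>f\<close> idempotent; nothing more is used of it.

  Let \<open>W\<close> represent the isomorphism types of singular simple right modules, embedded in \<open>R\<close>, with
  \<open>\<Sum>W\<close> essential in \<open>eR\<close>. By GC2, every \<open>D \<subseteq> W\<close> splits \<open>eR\<close> into a part with socle \<open>\<Sum>D\<close> and one with socle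
  \<open>\<Sum>(W - D)\<close>, and an endomorphism of \<open>eR\<close> vanishing on the socle is quasi-regular. Hence filters on \<open>W\<close>
  that are separated by some \<open>D\<close> give non-isomorphic simple quotients of \<open>eR\<close>, and each of these
  quotients has its type in \<open>W\<close>. If \<open>W\<close> were infinite, an independent family of subsets
  would give \<open>2\<^bsup>|W|\<^esup>\<close> separated filters; so \<open>W\<close> is finite, and the principal filters show that every
  singular simple module is a quotient of \<open>eR\<close>. Nonsingular simple modules are projective.

  Consequently \<open>R\<close> is a direct summand of a finite sum of right ideals \<open>hR\<close>, each having an essential
  simple socle. Any embedding of such an \<open>hR\<close> into \<open>R\<close> splits by GC2, which together with
  FGF gives Baer's criterion. Every \<open>R/I\<close> embeds in a finite sum of the \<open>hR\<close>, so it is finitely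
  cogenerated, and \<open>R\<close> is right artinian.
\<close>

section \<open>Products and quotients of right modules\<close>

text \<open>Once every maximal right ideal is some r(c), each simple right module is a right ideal
  cR, and for simple c and d the modules cR and dR are isomorphic exactly when r(cx) = r(d) for some
  nonzero cx. So modules and their maps can be replaced by elements and left multiplications. The
  obstacle is that eR is not known to be injective: nothing extends from its socle. GC2 is the
  substitute. An injective endomorphism t of eR, completed to t + (1 - e), is injective on R and has
  a left inverse; hence an endomorphism that fixes the socle is invertible, which is all that the
  counting needs. If simple quotients of eR lying over D and over W - D were isomorphic, passing
  between the two summands of eR and back would give an endomorphism that kills the socle but fixes
  the quotient. Properties of the whole ring are then obtained by a trace argument: the elements b
  for which a property holds form a two-sided ideal, and it suffices that every h lies in
  it.\<close>

definition prod_rmodule ::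
    "('a, 'b, 'm) rmodule_scheme \<Rightarrow> ('a, 'c, 'n) rmodule_scheme \<Rightarrow> ('a, 'b \<times> 'c) rmodule" where
  "prod_rmodule M N = \<lparr>carrier = carrier M \<times> carrier N, mult = undefined, one = undefined,
     ring.zero = (\<zero>\<^bsub>M\<^esub>, \<zero>\<^bsub>N\<^esub>), ring.add = (\<lambda>(x, y) (x', y'). (x \<oplus>\<^bsub>M\<^esub> x', y \<oplus>\<^bsub>N\<^esub> y')),
     rsmult = (\<lambda>(x, y) a. (x \<cdot>\<^bsub>M\<^esub> a, y \<cdot>\<^bsub>N\<^esub> a))\<rparr>"

lemma prod_rmodule_simps [simp]:
  "carrier (prod_rmodule M N) = carrier M \<times> carrier N"
  "\<zero>\<^bsub>prod_rmodule M N\<^esub> = (\<zero>\<^bsub>M\<^esub>, \<zero>\<^bsub>N\<^esub>)"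
  "(x, y) \<oplus>\<^bsub>prod_rmodule M N\<^esub> (x', y') = (x \<oplus>\<^bsub>M\<^esub> x', y \<oplus>\<^bsub>N\<^esub> y')"
  "(x, y) \<cdot>\<^bsub>prod_rmodule M N\<^esub> a = (x \<cdot>\<^bsub>M\<^esub> a, y \<cdot>\<^bsub>N\<^esub> a)"
  by (simp_all add: prod_rmodule_def)

lemma regular_rmodule_simps [simp]:
  "carrier (regular_rmodule R) = carrier R"
  "\<zero>\<^bsub>regular_rmodule R\<^esub> = \<zero>\<^bsub>R\<^esub>"
  "x \<oplus>\<^bsub>regular_rmodule R\<^esub> y = x \<oplus>\<^bsub>R\<^esub> y"
  "x \<cdot>\<^bsub>regular_rmodule R\<^esub> a = x \<otimes>\<^bsub>R\<^esub> a"
  by (simp_all add: regular_rmodule_def)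

lemma prod_right_module:
  assumes "right_module R M" "right_module R N"
  shows "right_module R (prod_rmodule M N)"
proof -
  interpret M: right_module R M by fact
  interpret N: right_module R N by fact
  have "abelian_group (prod_rmodule M N)"
  proof (rule abelian_groupI)
    fix x assume "x \<in> carrier (prod_rmodule M N)"
    then show "\<exists>y\<in>carrier (prod_rmodule M N). y \<oplus>\<^bsub>prod_rmodule M N\<^esub> x = \<zero>\<^bsub>prod_rmodule M N\<^esub>"
      by (intro bexI[of _ "(\<ominus>\<^bsub>M\<^esub> fst x, \<ominus>\<^bsub>N\<^esub> snd x)"]) (auto simp: M.M.l_neg N.M.l_neg)
  qed (auto simp: M.M.a_assoc N.M.a_assoc intro: M.M.a_comm N.M.a_comm)
  moreover have "right_module_axioms R (prod_rmodule M N)"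
    by unfold_locales
      (auto simp: M.rsmult_add_left M.rsmult_add_right M.rsmult_assoc
        N.rsmult_add_left N.rsmult_add_right N.rsmult_assoc)
  ultimately show ?thesis
    using M.R.ring_axioms by (simp add: right_module_def)
qed

lemma (in ring) regular_right_module: "right_module R (regular_rmodule R)"
proof -
  have "abelian_group (regular_rmodule R)"
    by (rule abelian_groupI) (auto simp: a_assoc intro: l_neg a_comm)
  moreover have "right_module_axioms R (regular_rmodule R)"
    by unfold_locales (auto simp: l_distr r_distr m_assoc)
  ultimately show ?thesis
    using ring_axioms by (simp add: right_module_def)
qed

context right_module
begin

lemma rsubmodule_a_inv: "\<lbrakk>rsubmodule R M K; x \<in> K\<rbrakk> \<Longrightarrow> \<ominus>\<^bsub>M\<^esub> x \<in> K"
  using rsmult_uminus_one[of x] rsubmoduleD[of R M K] by (metis R.a_inv_closed R.one_closed subsetD)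

lemma rsmult_a_inv:
  assumes "x \<in> carrier M" "a \<in> carrier R"
  shows "(\<ominus>\<^bsub>M\<^esub> x) \<cdot>\<^bsub>M\<^esub> a = \<ominus>\<^bsub>M\<^esub> (x \<cdot>\<^bsub>M\<^esub> a)"
proof -
  have "(\<ominus>\<^bsub>M\<^esub> x) \<cdot>\<^bsub>M\<^esub> a \<oplus>\<^bsub>M\<^esub> x \<cdot>\<^bsub>M\<^esub> a = (\<ominus>\<^bsub>M\<^esub> x \<oplus>\<^bsub>M\<^esub> x) \<cdot>\<^bsub>M\<^esub> a"
    using assms by (simp add: rsmult_add_left)
  then show ?thesis
    using assms by (simp add: M.l_neg M.minus_equality)
qed

lemma rsubmodule_add_cyclic:
  assumes G: "rsubmodule R M G" and p: "p \<in> carrier M"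
  shows "rsubmodule R M {g \<oplus>\<^bsub>M\<^esub> p \<cdot>\<^bsub>M\<^esub> a | g a. g \<in> G \<and> a \<in> carrier R}" (is "rsubmodule R M ?L")
    and "G \<subseteq> {g \<oplus>\<^bsub>M\<^esub> p \<cdot>\<^bsub>M\<^esub> a | g a. g \<in> G \<and> a \<in> carrier R}"
    and "p \<in> {g \<oplus>\<^bsub>M\<^esub> p \<cdot>\<^bsub>M\<^esub> a | g a. g \<in> G \<and> a \<in> carrier R}"
proof -
  note GM = rsubmoduleD[OF G]
  have GC: "g \<in> carrier M" if "g \<in> G" for g
    using that GM(1) by blast
  have eq: "g = g \<oplus>\<^bsub>M\<^esub> p \<cdot>\<^bsub>M\<^esub> \<zero>" if "g \<in> G" for g
    using that GC p by simp
  show sub: "G \<subseteq> ?L"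
    using eq by blast
  show "p \<in> ?L"
    using p GM(2) by (intro CollectI exI[of _ "\<zero>\<^bsub>M\<^esub>"] exI[of _ "\<one>"]) auto
  show "rsubmodule R M ?L"
  proof (rule rsubmoduleI)
    show "?L \<subseteq> carrier M"
      using GC p by auto
    show "\<zero>\<^bsub>M\<^esub> \<in> ?L"
      using sub GM(2) by blast
  next
    fix x y assume "x \<in> ?L" "y \<in> ?L"
    then obtain g a h b where *: "g \<in> G" "a \<in> carrier R" "x = g \<oplus>\<^bsub>M\<^esub> p \<cdot>\<^bsub>M\<^esub> a"
      "h \<in> G" "b \<in> carrier R" "y = h \<oplus>\<^bsub>M\<^esub> p \<cdot>\<^bsub>M\<^esub> b" by auto
    then have "x \<oplus>\<^bsub>M\<^esub> y = (g \<oplus>\<^bsub>M\<^esub> h) \<oplus>\<^bsub>M\<^esub> p \<cdot>\<^bsub>M\<^esub> (a \<oplus> b)"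
      using GC p by (simp add: rsmult_add_right M.a_ac)
    then show "x \<oplus>\<^bsub>M\<^esub> y \<in> ?L"
      using * GM(3) by blast
  next
    fix x b assume "x \<in> ?L" and b: "b \<in> carrier R"
    then obtain g a where *: "g \<in> G" "a \<in> carrier R" "x = g \<oplus>\<^bsub>M\<^esub> p \<cdot>\<^bsub>M\<^esub> a" by auto
    then have "x \<cdot>\<^bsub>M\<^esub> b = g \<cdot>\<^bsub>M\<^esub> b \<oplus>\<^bsub>M\<^esub> p \<cdot>\<^bsub>M\<^esub> (a \<otimes> b)"
      using GC p b by (simp add: rsmult_add_left rsmult_assoc)
    then show "x \<cdot>\<^bsub>M\<^esub> b \<in> ?L"
      using * b GM(4) by blast
  qed
qed

lemma rsubmodule_Union_chain:
  assumes "\<And>K. K \<in> C \<Longrightarrow> rsubmodule R M K" "C \<noteq> {}" "subset.chain UNIV C"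
  shows "rsubmodule R M (\<Union>C)"
proof (rule rsubmoduleI)
  show "\<Union>C \<subseteq> carrier M" "\<zero>\<^bsub>M\<^esub> \<in> \<Union>C"
    using assms(1,2) rsubmoduleD(1,2) by blast+
next
  fix x y assume "x \<in> \<Union>C" "y \<in> \<Union>C"
  then obtain K L where KL: "K \<in> C" "L \<in> C" "x \<in> K" "y \<in> L" by auto
  then have "K \<subseteq> L \<or> L \<subseteq> K"
    using assms(3) by (auto simp: subset_chain_def)
  then show "x \<oplus>\<^bsub>M\<^esub> y \<in> \<Union>C"
    using KL rsubmoduleD(3)[OF assms(1)] by (metis UnionI subsetD)
next
  fix x a assume "x \<in> \<Union>C" "a \<in> carrier R"
  then show "x \<cdot>\<^bsub>M\<^esub> a \<in> \<Union>C"
    using rsubmoduleD(4)[OF assms(1)] by blast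
qed

text \<open>Cosets are replaced by chosen representatives: \<pi> picks one element of each coset,
  and the operations of Q are those of M followed by \<pi>. The element type stays that of
  M.\<close>

lemma quotient_right_module:
  assumes K: "rsubmodule R M K"
  obtains Q :: "('a, 'c) rmodule" and \<pi> where "right_module R Q" "\<pi> \<in> rmodule_hom R M Q"
    "carrier Q = \<pi> ` carrier M" "\<And>x. x \<in> carrier M \<Longrightarrow> \<pi> x = \<zero>\<^bsub>Q\<^esub> \<longleftrightarrow> x \<in> K"
proof -
  note KM = rsubmoduleD[OF K]
  define E where "E x y \<longleftrightarrow> y \<in> carrier M \<and> x \<ominus>\<^bsub>M\<^esub> y \<in> K" for x y
  define \<pi> where "\<pi> x = (SOME y. E x y)" for x
  have pi: "\<pi> x \<in> carrier M" "x \<ominus>\<^bsub>M\<^esub> \<pi> x \<in> K" if "x \<in> carrier M" for x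
  proof -
    have "E x x"
      using that KM(2) by (simp add: E_def a_minus_def M.r_neg)
    then have "E x (\<pi> x)"
      unfolding \<pi>_def by (rule someI[of "E x"])
    then show "\<pi> x \<in> carrier M" "x \<ominus>\<^bsub>M\<^esub> \<pi> x \<in> K"
      by (simp_all add: E_def)
  qed
  have trans: "x \<ominus>\<^bsub>M\<^esub> z \<in> K" if "x \<ominus>\<^bsub>M\<^esub> y \<in> K" "y \<ominus>\<^bsub>M\<^esub> z \<in> K"
    "x \<in> carrier M" "y \<in> carrier M" "z \<in> carrier M" for x y z
  proof -
    have "x \<ominus>\<^bsub>M\<^esub> z = (x \<ominus>\<^bsub>M\<^esub> y) \<oplus>\<^bsub>M\<^esub> (y \<ominus>\<^bsub>M\<^esub> z)"
      using that(3-5) by (metis M.a_assoc M.a_inv_closed M.l_neg M.l_zero a_minus_def M.add.m_closed)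
    then show ?thesis
      using that KM(3) by simp
  qed
  have sym: "y \<ominus>\<^bsub>M\<^esub> x \<in> K" if "x \<ominus>\<^bsub>M\<^esub> y \<in> K" "x \<in> carrier M" "y \<in> carrier M" for x y
  proof -
    have "y \<ominus>\<^bsub>M\<^esub> x = \<ominus>\<^bsub>M\<^esub> (x \<ominus>\<^bsub>M\<^esub> y)"
      using that(2,3) by (simp add: a_minus_def M.minus_add M.a_comm)
    then show ?thesis
      using that rsubmodule_a_inv[OF K] by simp
  qed
  have eq: "\<pi> x = \<pi> y \<longleftrightarrow> x \<ominus>\<^bsub>M\<^esub> y \<in> K" if xy: "x \<in> carrier M" "y \<in> carrier M" for x y
  proof
    assume "\<pi> x = \<pi> y"
    then show "x \<ominus>\<^bsub>M\<^esub> y \<in> K"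
      using trans[OF pi(2)[OF xy(1)] _ xy(1) pi(1)[OF xy(1)] xy(2)] sym[OF pi(2)[OF xy(2)] xy(2)]
        pi(1)[OF xy(2)] by simp
  next
    assume *: "x \<ominus>\<^bsub>M\<^esub> y \<in> K"
    \<comment> \<open>Congruent x and y define the same predicate, so \<open>SOME\<close> picks the
      same representative for both.\<close>
    have "E x z \<longleftrightarrow> E y z" for z
      unfolding E_def using trans[OF * _ xy] trans[OF sym[OF * xy] _ xy(2,1)] by blast
    then have "E x = E y"
      by (simp add: fun_eq_iff)
    then show "\<pi> x = \<pi> y"
      by (simp add: \<pi>_def)
  qed
  define Q :: "('a, 'c) rmodule" where
    "Q = \<lparr>carrier = \<pi> ` carrier M, mult = undefined, one = undefined, ring.zero = \<pi> \<zero>\<^bsub>M\<^esub>,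
      ring.add = \<lambda>x y. \<pi> (x \<oplus>\<^bsub>M\<^esub> y), rsmult = \<lambda>x a. \<pi> (x \<cdot>\<^bsub>M\<^esub> a)\<rparr>"
  have add: "\<pi> (\<pi> x \<oplus>\<^bsub>M\<^esub> \<pi> y) = \<pi> (x \<oplus>\<^bsub>M\<^esub> y)" if xy: "x \<in> carrier M" "y \<in> carrier M" for x y
  proof -
    have "(x \<oplus>\<^bsub>M\<^esub> y) \<ominus>\<^bsub>M\<^esub> (\<pi> x \<oplus>\<^bsub>M\<^esub> \<pi> y) = (x \<ominus>\<^bsub>M\<^esub> \<pi> x) \<oplus>\<^bsub>M\<^esub> (y \<ominus>\<^bsub>M\<^esub> \<pi> y)"
      using xy pi(1) by (simp add: a_minus_def M.minus_add M.a_ac)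
    then have "(x \<oplus>\<^bsub>M\<^esub> y) \<ominus>\<^bsub>M\<^esub> (\<pi> x \<oplus>\<^bsub>M\<^esub> \<pi> y) \<in> K"
      using KM(3)[OF pi(2)[OF xy(1)] pi(2)[OF xy(2)]] by simp
    then have "\<pi> (x \<oplus>\<^bsub>M\<^esub> y) = \<pi> (\<pi> x \<oplus>\<^bsub>M\<^esub> \<pi> y)"
      using xy pi(1) by (subst eq) auto
    then show ?thesis
      by (rule HOL.sym)
  qed
  have smult: "\<pi> (\<pi> x \<cdot>\<^bsub>M\<^esub> a) = \<pi> (x \<cdot>\<^bsub>M\<^esub> a)" if xa: "x \<in> carrier M" "a \<in> carrier R" for x a
  proof -
    have "x \<cdot>\<^bsub>M\<^esub> a \<ominus>\<^bsub>M\<^esub> \<pi> x \<cdot>\<^bsub>M\<^esub> a = (x \<ominus>\<^bsub>M\<^esub> \<pi> x) \<cdot>\<^bsub>M\<^esub> a"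
      using xa pi(1) by (simp add: a_minus_def rsmult_add_left rsmult_a_inv)
    then have "x \<cdot>\<^bsub>M\<^esub> a \<ominus>\<^bsub>M\<^esub> \<pi> x \<cdot>\<^bsub>M\<^esub> a \<in> K"
      using KM(4)[OF pi(2)] xa by simp
    then have "\<pi> (x \<cdot>\<^bsub>M\<^esub> a) = \<pi> (\<pi> x \<cdot>\<^bsub>M\<^esub> a)"
      using xa pi(1) by (subst eq) auto
    then show ?thesis
      by (rule HOL.sym)
  qed
  have ab: "abelian_group Q"
  proof (rule abelian_groupI)
    fix x y z assume "x \<in> carrier Q" "y \<in> carrier Q" "z \<in> carrier Q"
    then obtain u v w where *: "u \<in> carrier M" "v \<in> carrier M" "w \<in> carrier M"
      "x = \<pi> u" "y = \<pi> v" "z = \<pi> w" by (auto simp: Q_def)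
    have "\<pi> (\<pi> (\<pi> u \<oplus>\<^bsub>M\<^esub> \<pi> v) \<oplus>\<^bsub>M\<^esub> \<pi> w) = \<pi> ((u \<oplus>\<^bsub>M\<^esub> v) \<oplus>\<^bsub>M\<^esub> w)"
      using * pi(1) by (simp add: add)
    moreover have "\<pi> (\<pi> u \<oplus>\<^bsub>M\<^esub> \<pi> (\<pi> v \<oplus>\<^bsub>M\<^esub> \<pi> w)) = \<pi> (u \<oplus>\<^bsub>M\<^esub> (v \<oplus>\<^bsub>M\<^esub> w))"
      using * pi(1) by (simp add: add)
    ultimately show "x \<oplus>\<^bsub>Q\<^esub> y \<oplus>\<^bsub>Q\<^esub> z = x \<oplus>\<^bsub>Q\<^esub> (y \<oplus>\<^bsub>Q\<^esub> z)"
      using * by (simp add: Q_def M.a_assoc)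
  next
    fix x assume "x \<in> carrier Q"
    then obtain u where u: "u \<in> carrier M" "x = \<pi> u" by (auto simp: Q_def)
    then show "\<exists>y\<in>carrier Q. y \<oplus>\<^bsub>Q\<^esub> x = \<zero>\<^bsub>Q\<^esub>"
      by (intro bexI[of _ "\<pi> (\<ominus>\<^bsub>M\<^esub> u)"]) (auto simp: Q_def add M.l_neg)
    show "\<zero>\<^bsub>Q\<^esub> \<oplus>\<^bsub>Q\<^esub> x = x"
      using u by (simp add: Q_def add)
  next
    fix x y assume "x \<in> carrier Q" "y \<in> carrier Q"
    then obtain u v where "u \<in> carrier M" "v \<in> carrier M" "x = \<pi> u" "y = \<pi> v"
      by (auto simp: Q_def)
    then show "x \<oplus>\<^bsub>Q\<^esub> y \<in> carrier Q" "x \<oplus>\<^bsub>Q\<^esub> y = y \<oplus>\<^bsub>Q\<^esub> x"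
      using M.a_comm[of u v] by (simp_all add: Q_def add)
  qed (simp add: Q_def)
  have "right_module_axioms R Q"
  proof
    fix x y a b assume "x \<in> carrier Q" "y \<in> carrier Q" and a: "a \<in> carrier R" and b: "b \<in> carrier R"
    then obtain u v where uv: "u \<in> carrier M" "v \<in> carrier M" "x = \<pi> u" "y = \<pi> v"
      by (auto simp: Q_def)
    show "x \<cdot>\<^bsub>Q\<^esub> a \<in> carrier Q"
      using uv a pi(1) by (auto simp: Q_def)
    show "(x \<oplus>\<^bsub>Q\<^esub> y) \<cdot>\<^bsub>Q\<^esub> a = x \<cdot>\<^bsub>Q\<^esub> a \<oplus>\<^bsub>Q\<^esub> y \<cdot>\<^bsub>Q\<^esub> a"
      using uv a by (simp add: Q_def smult add rsmult_add_left)
    show "x \<cdot>\<^bsub>Q\<^esub> (a \<oplus> b) = x \<cdot>\<^bsub>Q\<^esub> a \<oplus>\<^bsub>Q\<^esub> x \<cdot>\<^bsub>Q\<^esub> b"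
      using uv a b by (simp add: Q_def smult add rsmult_add_right)
    show "x \<cdot>\<^bsub>Q\<^esub> (a \<otimes> b) = (x \<cdot>\<^bsub>Q\<^esub> a) \<cdot>\<^bsub>Q\<^esub> b"
      using uv a b by (simp add: Q_def smult rsmult_assoc)
  next
    fix x assume "x \<in> carrier Q"
    then show "x \<cdot>\<^bsub>Q\<^esub> \<one> = x"
      by (auto simp: Q_def smult)
  qed
  then have "right_module R Q"
    using ab R.ring_axioms by (simp add: right_module_def)
  moreover have "\<pi> \<in> rmodule_hom R M Q"
    by (auto simp: rmodule_hom_def Q_def add smult)
  moreover have "\<pi> x = \<zero>\<^bsub>Q\<^esub> \<longleftrightarrow> x \<in> K" if "x \<in> carrier M" for x
    using eq[OF that M.zero_closed] that M.minus_equality[of "\<zero>\<^bsub>M\<^esub>" "\<zero>\<^bsub>M\<^esub>"]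
    by (simp add: Q_def a_minus_def)
  ultimately show ?thesis
    using that by (simp add: Q_def)
qed

lemma rsubmodule_restrict:
  assumes "rsubmodule R M N" "rsubmodule R M S" "S \<subseteq> N"
  shows "rsubmodule R (M\<lparr>carrier := N\<rparr>) S"
proof -
  interpret N: right_module R "M\<lparr>carrier := N\<rparr>"
    using assms(1) by (rule rsubmodule_right_module)
  show ?thesis
    using rsubmoduleD[OF assms(2)] assms(3) by (intro N.rsubmoduleI) auto
qed

lemma finsum_rsmult:
  assumes "finite A" "g \<in> A \<rightarrow> carrier M" "a \<in> carrier R"
  shows "finsum M g A \<cdot>\<^bsub>M\<^esub> a = (\<Oplus>\<^bsub>M\<^esub>x\<in>A. g x \<cdot>\<^bsub>M\<^esub> a)"
  using assms(1,2)
proof (induction A)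
  case (insert x A)
  then have g: "g \<in> A \<rightarrow> carrier M" "g x \<in> carrier M" by auto
  then have "(\<lambda>x. g x \<cdot>\<^bsub>M\<^esub> a) \<in> A \<rightarrow> carrier M"
    using assms(3) by auto
  then show ?case
    using insert g assms(3) by (simp add: M.finsum_insert M.finsum_closed rsmult_add_left)
qed (simp add: M.finsum_empty assms(3))

lemma cyclic_rsubmodule:
  assumes "x \<in> carrier M"
  shows "rsubmodule R M {x \<cdot>\<^bsub>M\<^esub> a | a. a \<in> carrier R}"
proof -
  have "rsubmodule R M {\<zero>\<^bsub>M\<^esub>}"
    by (rule rsubmoduleI) auto
  then have "rsubmodule R M {g \<oplus>\<^bsub>M\<^esub> x \<cdot>\<^bsub>M\<^esub> a | g a. g \<in> {\<zero>\<^bsub>M\<^esub>} \<and> a \<in> carrier R}"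
    using assms by (rule rsubmodule_add_cyclic(1))
  moreover have "{g \<oplus>\<^bsub>M\<^esub> x \<cdot>\<^bsub>M\<^esub> a | g a. g \<in> {\<zero>\<^bsub>M\<^esub>} \<and> a \<in> carrier R}
      = {x \<cdot>\<^bsub>M\<^esub> a | a. a \<in> carrier R}"
    using assms by auto (metis M.l_zero rsmult_closed)+
  ultimately show ?thesis
    by simp
qed

end

section \<open>Right ideals and the hypotheses in terms of elements\<close>

abbreviation right_ideal :: "('a, 'm) ring_scheme \<Rightarrow> 'a set \<Rightarrow> bool" where
  "right_ideal R I \<equiv> rsubmodule R (regular_rmodule R) I"

definition right_ideal_sum :: "('a, 'm) ring_scheme \<Rightarrow> 'a set set \<Rightarrow> 'a set" where
  "right_ideal_sum R \<S> = rspan R (regular_rmodule R) (\<Union>\<S>)"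

text \<open>Simplicity as a module, in the form that every nonzero element generates S.\<close>

definition minimal_right_ideal :: "('a, 'm) ring_scheme \<Rightarrow> 'a set \<Rightarrow> bool" where
  "minimal_right_ideal R S \<longleftrightarrow> right_ideal R S \<and> S \<noteq> {\<zero>\<^bsub>R\<^esub>} \<and>
     (\<forall>s\<in>S. s \<noteq> \<zero>\<^bsub>R\<^esub> \<longrightarrow> (\<forall>t\<in>S. \<exists>a\<in>carrier R. s \<otimes>\<^bsub>R\<^esub> a = t))"

text \<open>Membership in the right singular ideal: the right annihilator of x is essential, tested
  on the cyclic right ideals yR.\<close>

definition singular_elem :: "('a, 'm) ring_scheme \<Rightarrow> 'a \<Rightarrow> bool" where
  "singular_elem R x \<longleftrightarrow> (\<forall>y\<in>carrier R. y \<noteq> \<zero>\<^bsub>R\<^esub> \<longrightarrow>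
     (\<exists>a\<in>carrier R. y \<otimes>\<^bsub>R\<^esub> a \<noteq> \<zero>\<^bsub>R\<^esub> \<and> x \<otimes>\<^bsub>R\<^esub> (y \<otimes>\<^bsub>R\<^esub> a) = \<zero>\<^bsub>R\<^esub>))"

text \<open>The right ideal \<open>N\<close> is essential in the right ideal \<open>eR = {x. e x = x}\<close>.\<close>

definition essential_in_idem :: "('a, 'm) ring_scheme \<Rightarrow> 'a set \<Rightarrow> 'a \<Rightarrow> bool" where
  "essential_in_idem R N e \<longleftrightarrow> e \<in> carrier R \<and> e \<otimes>\<^bsub>R\<^esub> e = e \<and> (\<forall>x\<in>N. e \<otimes>\<^bsub>R\<^esub> x = x) \<and>
     (\<forall>x\<in>carrier R. e \<otimes>\<^bsub>R\<^esub> x = x \<and> x \<noteq> \<zero>\<^bsub>R\<^esub> \<longrightarrow>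
        (\<exists>a\<in>carrier R. x \<otimes>\<^bsub>R\<^esub> a \<in> N \<and> x \<otimes>\<^bsub>R\<^esub> a \<noteq> \<zero>\<^bsub>R\<^esub>))"

context ring
begin

lemma minus_eq_zero_iff: "\<lbrakk>x \<in> carrier R; y \<in> carrier R\<rbrakk> \<Longrightarrow> x \<ominus> y = \<zero> \<longleftrightarrow> x = y"
  by (metis a_inv_closed a_minus_def l_neg r_neg minus_equality minus_minus)

lemma l_minus_distr:
  "\<lbrakk>x \<in> carrier R; y \<in> carrier R; z \<in> carrier R\<rbrakk> \<Longrightarrow> (x \<ominus> y) \<otimes> z = x \<otimes> z \<ominus> y \<otimes> z"
  by (simp add: a_minus_def l_distr l_minus)

lemma r_minus_distr:
  "\<lbrakk>x \<in> carrier R; y \<in> carrier R; z \<in> carrier R\<rbrakk> \<Longrightarrow> z \<otimes> (x \<ominus> y) = z \<otimes> x \<ominus> z \<otimes> y"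
  by (simp add: a_minus_def r_distr r_minus)

lemma minus_self: "x \<in> carrier R \<Longrightarrow> x \<ominus> x = \<zero>"
  by (simp add: a_minus_def r_neg)

lemma minus_zero_right: "x \<in> carrier R \<Longrightarrow> x \<ominus> \<zero> = x"
  by (simp add: a_minus_def)

lemma right_idealD:
  assumes "right_ideal R I"
  shows "I \<subseteq> carrier R" "\<zero> \<in> I" "\<And>x y. \<lbrakk>x \<in> I; y \<in> I\<rbrakk> \<Longrightarrow> x \<oplus> y \<in> I"
    and "\<And>x a. \<lbrakk>x \<in> I; a \<in> carrier R\<rbrakk> \<Longrightarrow> x \<otimes> a \<in> I"
    and "\<And>x. x \<in> I \<Longrightarrow> x \<in> carrier R"
  using rsubmoduleD[OF assms] by auto

lemma right_ideal_minus:
  assumes "right_ideal R I" "x \<in> I" "y \<in> I"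
  shows "x \<ominus> y \<in> I"
proof -
  have "y \<otimes> (\<ominus> \<one>) \<in> I"
    using assms by (intro right_idealD(4)) auto
  then have "\<ominus> y \<in> I"
    using right_idealD(5)[OF assms(1,3)] by (simp add: r_minus)
  then show ?thesis
    using right_idealD(3)[OF assms(1,2)] by (simp add: a_minus_def)
qed

lemma right_idealI:
  assumes "I \<subseteq> carrier R" "\<zero> \<in> I" "\<And>x y. \<lbrakk>x \<in> I; y \<in> I\<rbrakk> \<Longrightarrow> x \<oplus> y \<in> I"
    and "\<And>x a. \<lbrakk>x \<in> I; a \<in> carrier R\<rbrakk> \<Longrightarrow> x \<otimes> a \<in> I"
  shows "right_ideal R I"
  by (rule right_module.rsubmoduleI[OF regular_right_module]) (use assms in auto)

lemma right_ideal_cyclic: "x \<in> carrier R \<Longrightarrow> right_ideal R {x \<otimes> a | a. a \<in> carrier R}"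
  using right_module.cyclic_rsubmodule[OF regular_right_module, of x] by simp

text \<open>The quotient of R x R by K is generated by the images of the two unit vectors and embeds
  in a free module. Only finitely many basis elements occur in these images, and the coordinates
  there are the coefficients of the equations. Two variables suffice for the sequel: K = I x R
  yields annihilators, and graphs yield extensions of maps.\<close>

lemma right_FGF_relations:
  assumes FGF: "right_FGF R"
    and K: "rsubmodule R (prod_rmodule (regular_rmodule R) (regular_rmodule R)) K"
  obtains F where "finite F" "F \<subseteq> carrier R \<times> carrier R"
    "\<And>x y. \<lbrakk>x \<in> carrier R; y \<in> carrier R\<rbrakk> \<Longrightarrow>
       (x, y) \<in> K \<longleftrightarrow> (\<forall>(a, b)\<in>F. a \<otimes> x \<oplus> b \<otimes> y = \<zero>)"
proof -
  let ?P = "prod_rmodule (regular_rmodule R) (regular_rmodule R)"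
  interpret P: right_module R ?P
    by (intro prod_right_module regular_right_module)
  obtain Q :: "('a, 'a \<times> 'a) rmodule" and \<pi> where Q: "right_module R Q"
    and \<pi>: "\<pi> \<in> rmodule_hom R ?P Q" "carrier Q = \<pi> ` carrier ?P"
    and ker: "\<And>x. x \<in> carrier ?P \<Longrightarrow> \<pi> x = \<zero>\<^bsub>Q\<^esub> \<longleftrightarrow> x \<in> K"
    by (rule P.quotient_right_module[OF K]) (rule that)
  interpret Q: right_module R Q by fact
  have decomp: "g (x, y) = g (\<one>, \<zero>) \<cdot>\<^bsub>L\<^esub> x \<oplus>\<^bsub>L\<^esub> g (\<zero>, \<one>) \<cdot>\<^bsub>L\<^esub> y"
    if g: "g \<in> rmodule_hom R ?P L" and xy: "x \<in> carrier R" "y \<in> carrier R"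
    for g :: "'a \<times> 'a \<Rightarrow> 'z" and L :: "('a, 'z) rmodule" and x y
  proof -
    have "g (\<one>, \<zero>) \<cdot>\<^bsub>L\<^esub> x \<oplus>\<^bsub>L\<^esub> g (\<zero>, \<one>) \<cdot>\<^bsub>L\<^esub> y = g ((\<one>, \<zero>) \<cdot>\<^bsub>?P\<^esub> x) \<oplus>\<^bsub>L\<^esub> g ((\<zero>, \<one>) \<cdot>\<^bsub>?P\<^esub> y)"
      using xy by (subst (1 2) rmodule_homD(3)[OF g]) auto
    also have "\<dots> = g ((\<one>, \<zero>) \<cdot>\<^bsub>?P\<^esub> x \<oplus>\<^bsub>?P\<^esub> (\<zero>, \<one>) \<cdot>\<^bsub>?P\<^esub> y)"
      using xy by (subst rmodule_homD(2)[OF g]) auto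
    finally show ?thesis
      using xy by simp
  qed
  let ?S = "{\<pi> (\<one>, \<zero>), \<pi> (\<zero>, \<one>)}"
  have SQ: "?S \<subseteq> carrier Q"
    using \<pi>(2) by auto
  note span = rsubmoduleD[OF Q.rspan_rsubmodule[OF SQ]]
  have gen: "\<pi> (\<one>, \<zero>) \<in> rspan R Q ?S" "\<pi> (\<zero>, \<one>) \<in> rspan R Q ?S"
    using Q.rspan_superset[of ?S] by simp_all
  have "\<pi> (x, y) \<in> rspan R Q ?S" if "x \<in> carrier R" "y \<in> carrier R" for x y
    unfolding decomp[OF \<pi>(1) that] by (rule span(3)[OF span(4)[OF gen(1) that(1)] span(4)[OF gen(2) that(2)]])
  then have "rspan R Q ?S = carrier Q"
    using span(1) \<pi>(2) by auto
  then have "finitely_generated_rmodule R Q"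
    unfolding finitely_generated_rmodule_def using SQ by (intro exI[of _ ?S]) simp
  then obtain F :: "('a, nat \<Rightarrow> 'a) rmodule" where F: "right_module R F"
    and free: "free_rmodule R F" and emb: "rmodule_embeds R Q F"
    by (rule Q.right_FGF_embeds[OF FGF])
  interpret F: right_module R F by fact
  obtain B where B: "rmodule_basis R F B"
    using free by (auto simp: free_rmodule_def)
  note BF = rmodule_basisD[OF B]
  obtain f where f: "f \<in> rmodule_hom R Q F" "inj_on f (carrier Q)"
    using emb by (auto simp: rmodule_embeds_def)
  define h where "h = f \<circ> \<pi>"
  have h: "h \<in> rmodule_hom R ?P F"
    unfolding h_def using \<pi>(1) f(1) by (rule rmodule_hom_comp)
  have hker: "h z = \<zero>\<^bsub>F\<^esub> \<longleftrightarrow> z \<in> K" if z: "z \<in> carrier ?P" for z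
  proof -
    have "h z = \<zero>\<^bsub>F\<^esub> \<longleftrightarrow> f (\<pi> z) = f \<zero>\<^bsub>Q\<^esub>"
      using Q.hom_zero[OF F f(1)] by (simp add: h_def)
    also have "\<dots> \<longleftrightarrow> \<pi> z = \<zero>\<^bsub>Q\<^esub>"
      by (rule inj_on_eq_iff[OF f(2) rmodule_homD(1)[OF \<pi>(1) z] Q.M.zero_closed])
    finally show ?thesis
      using ker[OF z] by simp
  qed
  define u where "u = h (\<one>, \<zero>)"
  define v where "v = h (\<zero>, \<one>)"
  have uv: "u \<in> rspan R F B" "v \<in> rspan R F B"
    unfolding u_def v_def BF(2) by (intro rmodule_homD(1)[OF h]; simp)+
  obtain A1 where A1: "finite A1" "A1 \<subseteq> B" "u \<in> rspan R F A1"
    by (rule F.rspan_finitary[OF BF(1) uv(1)])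
  obtain A2 where A2: "finite A2" "A2 \<subseteq> B" "v \<in> rspan R F A2"
    by (rule F.rspan_finitary[OF BF(1) uv(2)])
  \<comment> \<open>One finite part of the basis carries both images, so that the two coordinate
    families share an index set.\<close>
  define A where "A = A1 \<union> A2"
  have A: "finite A" "A \<subseteq> B" "A \<subseteq> carrier F"
    using A1(1,2) A2(1,2) BF(1) unfolding A_def by blast+
  have uvA: "u \<in> rspan R F A" "v \<in> rspan R F A"
    by (rule subsetD[OF F.rspan_mono A1(3)], simp add: A_def)
      (rule subsetD[OF F.rspan_mono A2(3)], simp add: A_def)
  obtain c where c: "c \<in> A \<rightarrow> carrier R" "u = (\<Oplus>\<^bsub>F\<^esub>b\<in>A. b \<cdot>\<^bsub>F\<^esub> c b)"
    by (rule F.finite_rspan[OF A(1,3) uvA(1)])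
  obtain d where d: "d \<in> A \<rightarrow> carrier R" "v = (\<Oplus>\<^bsub>F\<^esub>b\<in>A. b \<cdot>\<^bsub>F\<^esub> d b)"
    by (rule F.finite_rspan[OF A(1,3) uvA(2)])
  have mem: "(\<lambda>b. b \<cdot>\<^bsub>F\<^esub> k b) \<in> A \<rightarrow> carrier F" if "k \<in> A \<rightarrow> carrier R" for k
    using that A(3) by auto
  have hxy: "h (x, y) = (\<Oplus>\<^bsub>F\<^esub>b\<in>A. b \<cdot>\<^bsub>F\<^esub> (c b \<otimes> x \<oplus> d b \<otimes> y))"
    if xy: "x \<in> carrier R" "y \<in> carrier R" for x y
  proof -
    have m: "(\<lambda>b. b \<cdot>\<^bsub>F\<^esub> c b \<cdot>\<^bsub>F\<^esub> x) \<in> A \<rightarrow> carrier F" "(\<lambda>b. b \<cdot>\<^bsub>F\<^esub> d b \<cdot>\<^bsub>F\<^esub> y) \<in> A \<rightarrow> carrier F"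
      using mem[OF c(1)] mem[OF d(1)] xy by auto
    have "h (x, y) = u \<cdot>\<^bsub>F\<^esub> x \<oplus>\<^bsub>F\<^esub> v \<cdot>\<^bsub>F\<^esub> y"
      unfolding u_def v_def by (rule decomp[OF h xy])
    also have "\<dots> = (\<Oplus>\<^bsub>F\<^esub>b\<in>A. b \<cdot>\<^bsub>F\<^esub> c b \<cdot>\<^bsub>F\<^esub> x) \<oplus>\<^bsub>F\<^esub> (\<Oplus>\<^bsub>F\<^esub>b\<in>A. b \<cdot>\<^bsub>F\<^esub> d b \<cdot>\<^bsub>F\<^esub> y)"
      unfolding c(2) d(2)
      by (simp only: F.finsum_rsmult[OF A(1) mem[OF c(1)] xy(1)] F.finsum_rsmult[OF A(1) mem[OF d(1)] xy(2)])
    also have "\<dots> = (\<Oplus>\<^bsub>F\<^esub>b\<in>A. b \<cdot>\<^bsub>F\<^esub> c b \<cdot>\<^bsub>F\<^esub> x \<oplus>\<^bsub>F\<^esub> b \<cdot>\<^bsub>F\<^esub> d b \<cdot>\<^bsub>F\<^esub> y)"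
      using F.M.finsum_addf[OF m] by simp
    also have "\<dots> = (\<Oplus>\<^bsub>F\<^esub>b\<in>A. b \<cdot>\<^bsub>F\<^esub> (c b \<otimes> x \<oplus> d b \<otimes> y))"
    proof (rule F.M.finsum_cong')
      fix b assume b: "b \<in> A"
      then have "b \<in> carrier F" "c b \<in> carrier R" "d b \<in> carrier R"
        using A(3) c(1) d(1) by auto
      then show "b \<cdot>\<^bsub>F\<^esub> c b \<cdot>\<^bsub>F\<^esub> x \<oplus>\<^bsub>F\<^esub> b \<cdot>\<^bsub>F\<^esub> d b \<cdot>\<^bsub>F\<^esub> y = b \<cdot>\<^bsub>F\<^esub> (c b \<otimes> x \<oplus> d b \<otimes> y)"
        using xy by (simp add: F.rsmult_add_right F.rsmult_assoc)
    qed (use c(1) d(1) xy A(3) in \<open>auto simp: Pi_iff subset_iff\<close>)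
    finally show ?thesis .
  qed
  show ?thesis
  proof (rule that)
    show "finite ((\<lambda>b. (c b, d b)) ` A)" "(\<lambda>b. (c b, d b)) ` A \<subseteq> carrier R \<times> carrier R"
      using A(1) c(1) d(1) by auto
    fix x y assume xy: "x \<in> carrier R" "y \<in> carrier R"
    have k: "(\<lambda>b. c b \<otimes> x \<oplus> d b \<otimes> y) \<in> A \<rightarrow> carrier R"
      using c(1) d(1) xy by auto
    have "(x, y) \<in> K \<longleftrightarrow> (\<Oplus>\<^bsub>F\<^esub>b\<in>A. b \<cdot>\<^bsub>F\<^esub> (c b \<otimes> x \<oplus> d b \<otimes> y)) = \<zero>\<^bsub>F\<^esub>"
      using hker[of "(x, y)"] hxy[OF xy] xy by simp
    also have "\<dots> \<longleftrightarrow> (\<forall>b\<in>A. c b \<otimes> x \<oplus> d b \<otimes> y = \<zero>)"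
    proof
      assume "\<forall>b\<in>A. c b \<otimes> x \<oplus> d b \<otimes> y = \<zero>"
      then show "(\<Oplus>\<^bsub>F\<^esub>b\<in>A. b \<cdot>\<^bsub>F\<^esub> (c b \<otimes> x \<oplus> d b \<otimes> y)) = \<zero>\<^bsub>F\<^esub>"
        using A(3) by (intro F.M.add.finprod_one_eqI) auto
    qed (rule BF(3)[OF A(1,2) k])
    finally show "(x, y) \<in> K \<longleftrightarrow> (\<forall>(a, b)\<in>(\<lambda>b. (c b, d b)) ` A. a \<otimes> x \<oplus> b \<otimes> y = \<zero>)"
      by auto
  qed
qed

text \<open>aR is isomorphic to R, so GC2 makes it a direct summand, and 1 = ab + k with k in a
  complement. Then ka = a(1 - ba) lies in aR and in the complement, hence vanishes, and a = aba
  cancels to ba = 1.\<close>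

lemma right_GC2_left_inverse:
  assumes "right_GC2 R" and a: "a \<in> carrier R"
    and inj: "\<And>x. \<lbrakk>x \<in> carrier R; a \<otimes> x = \<zero>\<rbrakk> \<Longrightarrow> x = \<zero>"
  obtains b where "b \<in> carrier R" "b \<otimes> a = \<one>"
proof -
  let ?M = "regular_rmodule R" and ?N = "{a \<otimes> x | x. x \<in> carrier R}"
  have cancel: "x = y" if "x \<in> carrier R" "y \<in> carrier R" "a \<otimes> x = a \<otimes> y" for x y
  proof -
    have "a \<otimes> (x \<ominus> y) = a \<otimes> x \<ominus> a \<otimes> y"
      using that a by (simp add: a_minus_def r_distr r_minus)
    then have "x \<ominus> y = \<zero>"
      using that a inj[of "x \<ominus> y"] by (simp add: a_minus_def r_neg)
    then show ?thesis
      using that by (simp add: minus_eq_zero_iff)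
  qed
  have N: "right_ideal R ?N"
    using a by (rule right_ideal_cyclic)
  \<comment> \<open>The inverse of left multiplication by a, as an isomorphism from aR onto
    R.\<close>
  define f where "f n = (THE x. x \<in> carrier R \<and> a \<otimes> x = n)" for n
  have f: "f (a \<otimes> x) = x" if "x \<in> carrier R" for x
    unfolding f_def using that cancel by (intro the_equality) auto
  have f_add: "f (a \<otimes> x \<oplus> a \<otimes> y) = x \<oplus> y" if "x \<in> carrier R" "y \<in> carrier R" for x y
    using that f[of "x \<oplus> y"] a by (simp add: r_distr)
  have f_mult: "f (a \<otimes> x \<otimes> y) = x \<otimes> y" if "x \<in> carrier R" "y \<in> carrier R" for x y
    using that f[of "x \<otimes> y"] a by (simp add: m_assoc)
  have "f \<in> rmodule_hom R (?M\<lparr>carrier := ?N\<rparr>) ?M"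
    unfolding rmodule_hom_def using f a f_add f_mult by auto
  moreover have "bij_betw f ?N (carrier R)"
    by (rule bij_betw_byWitness[where f' = "\<lambda>x. a \<otimes> x"]) (use f a in auto)
  ultimately have "rmodule_iso R (?M\<lparr>carrier := ?N\<rparr>) ?M"
    by (auto simp: rmodule_iso_def)
  then have "direct_summand R ?M ?N"
    using assms(1) N by (simp add: right_GC2_def GC2_def)
  then obtain K where K: "right_ideal R K" "?N \<inter> K = {\<zero>}" "?N <+>\<^bsub>?M\<^esub> K = carrier R"
    by (auto simp: direct_summand_def)
  then have "\<one> \<in> ?N <+>\<^bsub>?M\<^esub> K"
    by simp
  then obtain b k where b: "b \<in> carrier R" and k: "k \<in> K" "\<one> = a \<otimes> b \<oplus> k"
    by (auto simp: set_add_def set_mult_def)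
  note kR = right_idealD(5)[OF K(1) k(1)]
  have "a = (a \<otimes> b \<oplus> k) \<otimes> a"
    using l_one[OF a] by (simp only: k(2))
  also have "\<dots> = a \<otimes> (b \<otimes> a) \<oplus> k \<otimes> a"
    using a b kR by (simp add: l_distr m_assoc)
  finally have eq: "a = a \<otimes> (b \<otimes> a) \<oplus> k \<otimes> a" .
  have "a \<otimes> (\<one> \<ominus> b \<otimes> a) = a \<ominus> a \<otimes> (b \<otimes> a)"
    using a b by (simp add: a_minus_def r_distr r_minus)
  also have "\<dots> = k \<otimes> a"
    using eq a b kR by (metis a_minus_def add.inv_solve_right' add.m_comm m_closed)
  finally have "k \<otimes> a \<in> ?N"
    using a b by (intro CollectI exI[of _ "\<one> \<ominus> b \<otimes> a"]) auto
  then have "k \<otimes> a = \<zero>"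
    using K(2) right_idealD(4)[OF K(1) k(1) a] by blast
  then have "a \<otimes> \<one> = a \<otimes> (b \<otimes> a)"
    using eq a b by simp
  then have "b \<otimes> a = \<one>"
    using cancel[of \<one> "b \<otimes> a"] a b by simp
  with b that show ?thesis
    by blast
qed

text \<open>e is the component of 1 in the summand D. For x in D the element kx = x - ex lies in
  both D and the complement, so e acts as the identity on D.\<close>

lemma essential_in_direct_summandE:
  assumes "essential_in_direct_summand R (regular_rmodule R) N"
  obtains e where "essential_in_idem R N e"
proof -
  let ?M = "regular_rmodule R"
  interpret M: right_module R ?M
    by (rule regular_right_module)
  obtain D where D: "direct_summand R ?M D" "essential_submodule R (?M\<lparr>carrier := D\<rparr>) N"
    using assms by (auto simp: essential_in_direct_summand_def)
  obtain K where DI: "right_ideal R D" and K: "right_ideal R K" "D \<inter> K = {\<zero>}"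
    "D <+>\<^bsub>?M\<^esub> K = carrier R"
    using D(1) by (auto simp: direct_summand_def)
  have "\<one> \<in> D <+>\<^bsub>?M\<^esub> K"
    using K(3) by simp
  then obtain e k where e: "e \<in> D" and k: "k \<in> K" "\<one> = e \<oplus> k"
    by (auto simp: set_add_def set_mult_def)
  have eR: "e \<in> carrier R" and kR: "k \<in> carrier R"
    using right_idealD(5)[OF DI e] right_idealD(5)[OF K(1) k(1)] .
  have id: "e \<otimes> x = x" if x: "x \<in> D" for x
  proof -
    note xR = right_idealD(5)[OF DI x]
    have "x = e \<otimes> x \<oplus> k \<otimes> x"
      using k(2) xR eR kR l_distr by (metis l_one)
    then have "k \<otimes> x = x \<ominus> e \<otimes> x"
      using xR eR kR by (metis a_minus_def add.inv_solve_right' add.m_comm m_closed)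
    then have "k \<otimes> x \<in> D"
      using right_ideal_minus[OF DI x right_idealD(4)[OF DI e xR]] by simp
    then have "k \<otimes> x = \<zero>"
      using K(2) right_idealD(4)[OF K(1) k(1) xR] by blast
    with \<open>x = e \<otimes> x \<oplus> k \<otimes> x\<close> show ?thesis
      using xR eR by simp
  qed
  interpret D: right_module R "?M\<lparr>carrier := D\<rparr>"
    using DI by (rule M.rsubmodule_right_module)
  have ND: "rsubmodule R (?M\<lparr>carrier := D\<rparr>) N"
    using D(2) by (simp add: essential_submodule_def)
  have "\<exists>a\<in>carrier R. x \<otimes> a \<in> N \<and> x \<otimes> a \<noteq> \<zero>" if x: "x \<in> carrier R" "e \<otimes> x = x" "x \<noteq> \<zero>" for x
  proof (rule ccontr)
    assume none: "\<not> ?thesis"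
    have "x \<in> D"
      using x right_idealD(4)[OF DI e x(1)] by simp
    let ?K = "{x \<otimes> a | a. a \<in> carrier R}"
    have "rsubmodule R (?M\<lparr>carrier := D\<rparr>) ?K"
      using \<open>x \<in> D\<close> D.cyclic_rsubmodule[of x] by simp
    moreover have "N \<inter> ?K = {\<zero>}"
    proof -
      have "\<zero> \<in> N"
        using rsubmoduleD(2)[OF ND] by simp
      moreover have "\<zero> \<in> ?K"
        using x(1) by (intro CollectI exI[of _ \<zero>]) simp
      ultimately show ?thesis
        using none by blast
    qed
    ultimately have "?K = {\<zero>}"
      using D(2) unfolding essential_submodule_def by simp
    moreover have "x \<in> ?K"
      using x(1) by (intro CollectI exI[of _ \<one>]) simp
    ultimately show False
      using x(3) by blast
  qed
  then have "essential_in_idem R N e"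
    unfolding essential_in_idem_def using eR id e rsubmoduleD(1)[OF ND] by auto
  then show ?thesis
    by (rule that)
qed

lemma right_ideal_singular_elems: "right_ideal R {x \<in> carrier R. singular_elem R x}"
proof (rule right_idealI)
  show "\<zero> \<in> {x \<in> carrier R. singular_elem R x}"
    unfolding singular_elem_def by (auto intro!: bexI[of _ \<one>])
next
  fix x y assume *: "x \<in> {x \<in> carrier R. singular_elem R x}" "y \<in> {x \<in> carrier R. singular_elem R x}"
  have "\<exists>a\<in>carrier R. z \<otimes> a \<noteq> \<zero> \<and> (x \<oplus> y) \<otimes> (z \<otimes> a) = \<zero>"
    if z: "z \<in> carrier R" "z \<noteq> \<zero>" for z
  proof -
    obtain a where a: "a \<in> carrier R" "z \<otimes> a \<noteq> \<zero>" "x \<otimes> (z \<otimes> a) = \<zero>"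
      using * z by (auto simp: singular_elem_def)
    moreover have "z \<otimes> a \<in> carrier R"
      using z a by simp
    ultimately obtain b where b: "b \<in> carrier R" "z \<otimes> a \<otimes> b \<noteq> \<zero>" "y \<otimes> (z \<otimes> a \<otimes> b) = \<zero>"
      using * by (auto simp: singular_elem_def)
    have "x \<otimes> (z \<otimes> a \<otimes> b) = x \<otimes> (z \<otimes> a) \<otimes> b"
      using * z a(1) b(1) by (simp add: m_assoc)
    then have "(x \<oplus> y) \<otimes> (z \<otimes> a \<otimes> b) = \<zero>"
      using a(1,3) b(1,3) * z by (simp add: l_distr)
    then show ?thesis
      using a b z by (intro bexI[of _ "a \<otimes> b"]) (auto simp: m_assoc)
  qed
  then show "x \<oplus> y \<in> {x \<in> carrier R. singular_elem R x}"
    using * by (auto simp: singular_elem_def)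
next
  fix x b assume *: "x \<in> {x \<in> carrier R. singular_elem R x}" and b: "b \<in> carrier R"
  have "\<exists>a\<in>carrier R. z \<otimes> a \<noteq> \<zero> \<and> (x \<otimes> b) \<otimes> (z \<otimes> a) = \<zero>"
    if z: "z \<in> carrier R" "z \<noteq> \<zero>" for z
  \<comment> \<open>If bz = 0, then z itself is killed by xb; otherwise the singularity of x is
    applied to bz.\<close>
  proof (cases "b \<otimes> z = \<zero>")
    case True
    then show ?thesis
      using z b * by (intro bexI[of _ \<one>]) (auto simp: m_assoc)
  next
    case False
    then obtain a where a: "a \<in> carrier R" "b \<otimes> z \<otimes> a \<noteq> \<zero>" "x \<otimes> (b \<otimes> z \<otimes> a) = \<zero>"
      using * z b m_closed[OF b z(1)] unfolding singular_elem_def by blast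
    then have "z \<otimes> a \<noteq> \<zero>"
      using z b by (auto simp: m_assoc)
    then show ?thesis
      using a z b * by (intro bexI[of _ a]) (auto simp: m_assoc)
  qed
  then show "x \<otimes> b \<in> {x \<in> carrier R. singular_elem R x}"
    using * b by (auto simp: singular_elem_def)
qed auto

lemma right_ideal_sum_right_ideal:
  assumes "\<And>S. S \<in> \<S> \<Longrightarrow> right_ideal R S"
  shows "right_ideal R (right_ideal_sum R \<S>)"
  unfolding right_ideal_sum_def
  by (rule right_module.rspan_rsubmodule[OF regular_right_module]) (use right_idealD(1)[OF assms] in auto)

lemma right_ideal_sum_upper: "S \<in> \<S> \<Longrightarrow> S \<subseteq> right_ideal_sum R \<S>"
  unfolding right_ideal_sum_def
  using right_module.rspan_superset[OF regular_right_module] by blast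

lemma right_ideal_sum_least: "\<lbrakk>right_ideal R I; \<And>S. S \<in> \<S> \<Longrightarrow> S \<subseteq> I\<rbrakk> \<Longrightarrow> right_ideal_sum R \<S> \<subseteq> I"
  unfolding right_ideal_sum_def
  by (rule right_module.rspan_least[OF regular_right_module]) auto

lemma minimal_right_idealD:
  assumes "minimal_right_ideal R S"
  shows "right_ideal R S" "\<exists>s\<in>S. s \<noteq> \<zero>"
    and "\<And>s t. \<lbrakk>s \<in> S; s \<noteq> \<zero>; t \<in> S\<rbrakk> \<Longrightarrow> \<exists>a\<in>carrier R. s \<otimes> a = t"
  using assms right_idealD(2)[of S] unfolding minimal_right_ideal_def by blast+

lemma simple_rmodule_if_minimal:
  assumes "minimal_right_ideal R S"
  shows "simple_rmodule R (regular_rmodule R\<lparr>carrier := S\<rparr>)"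
proof -
  have "N = {\<zero>} \<or> N = S" if N: "rsubmodule R (regular_rmodule R\<lparr>carrier := S\<rparr>) N" for N
  proof (rule disjCI)
    assume "N \<noteq> S"
    note ND = rsubmoduleD[OF N, simplified]
    have "S \<subseteq> N" if "n \<in> N" "n \<noteq> \<zero>" for n
      using that ND(1,4) minimal_right_idealD(3)[OF assms, of n] by blast
    then show "N = {\<zero>}"
      using ND(1,2) \<open>N \<noteq> S\<close> by blast
  qed
  then show ?thesis
    using minimal_right_idealD(2)[OF assms] by (auto simp: simple_rmodule_def)
qed

text \<open>The right ideal in question is semisimple, as a sum of simple ones, and also singular,
  since the singular elements form a right ideal. So each of the two CS conditions applies to
  it.\<close>

lemma singular_socle_essential:
  assumes "right_weak_CS R \<or> right_s_CS R"
    and S: "\<And>S. S \<in> \<S> \<Longrightarrow> minimal_right_ideal R S"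
    and sing: "\<And>S x. \<lbrakk>S \<in> \<S>; x \<in> S\<rbrakk> \<Longrightarrow> singular_elem R x"
  obtains e where "essential_in_idem R (right_ideal_sum R \<S>) e"
proof -
  let ?M = "regular_rmodule R" and ?N = "right_ideal_sum R \<S>"
  interpret M: right_module R ?M
    by (rule regular_right_module)
  have SI: "right_ideal R S" if "S \<in> \<S>" for S
    using S[OF that] by (rule minimal_right_idealD)
  have N: "right_ideal R ?N"
    using SI by (rule right_ideal_sum_right_ideal)
  interpret N: right_module R "?M\<lparr>carrier := ?N\<rparr>"
    using N by (rule M.rsubmodule_right_module)
  from assms(1) have "essential_in_direct_summand R ?M ?N"
  proof
    assume "right_weak_CS R"
    moreover have "semisimple_rmodule R (?M\<lparr>carrier := ?N\<rparr>)"
    proof -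
      let ?U = "\<Union>{S. rsubmodule R (?M\<lparr>carrier := ?N\<rparr>) S
        \<and> simple_rmodule R (?M\<lparr>carrier := ?N\<rparr>\<lparr>carrier := S\<rparr>)}"
      have U: "?U \<subseteq> ?N"
        using rsubmoduleD(1) by force
      then have sub: "rsubmodule R (?M\<lparr>carrier := ?N\<rparr>) (rspan R (?M\<lparr>carrier := ?N\<rparr>) ?U)"
        by (intro N.rspan_rsubmodule) simp
      have "T \<subseteq> rspan R (?M\<lparr>carrier := ?N\<rparr>) ?U" if "T \<in> \<S>" for T
      proof -
        have "rsubmodule R (?M\<lparr>carrier := ?N\<rparr>) T"
          using N SI[OF that] right_ideal_sum_upper[OF that] by (rule M.rsubmodule_restrict)
        then have "T \<subseteq> ?U"
          using simple_rmodule_if_minimal[OF S[OF that]] by auto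
        then show ?thesis
          using N.rspan_superset by blast
      qed
      then have "?N \<subseteq> rspan R (?M\<lparr>carrier := ?N\<rparr>) ?U"
        by (intro right_ideal_sum_least M.rsubmodule_trans[OF N sub])
      then show ?thesis
        using rsubmoduleD(1)[OF sub] by (auto simp: semisimple_rmodule_def)
    qed
    ultimately show ?thesis
      using N by (simp add: right_weak_CS_def weak_CS_def)
  next
    assume "right_s_CS R"
    moreover have "singular_rmodule R (?M\<lparr>carrier := ?N\<rparr>)"
    proof -
      have "?N \<subseteq> {x \<in> carrier R. singular_elem R x}"
        using sing right_idealD(1)[OF SI]
        by (intro right_ideal_sum_least right_ideal_singular_elems) blast
      moreover have "essential_submodule R ?M {a \<in> carrier R. x \<otimes> a = \<zero>}"
        if x: "x \<in> carrier R" "singular_elem R x" for x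
      proof -
        have "right_ideal R {a \<in> carrier R. x \<otimes> a = \<zero>}"
          using x(1) by (intro right_idealI) (auto simp: r_distr m_assoc[symmetric])
        moreover have "K = {\<zero>}"
          if K: "right_ideal R K" "{a \<in> carrier R. x \<otimes> a = \<zero>} \<inter> K = {\<zero>}" for K
        proof (rule ccontr)
          assume "K \<noteq> {\<zero>}"
          then obtain k where k: "k \<in> K" "k \<noteq> \<zero>"
            using right_idealD(2)[OF K(1)] by blast
          then obtain a where "a \<in> carrier R" "k \<otimes> a \<noteq> \<zero>" "x \<otimes> (k \<otimes> a) = \<zero>"
            using x(2) right_idealD(5)[OF K(1)] by (auto simp: singular_elem_def)
          then show False
            using right_idealD(4)[OF K(1) k(1)] right_idealD(5)[OF K(1)] K(2) by blast
        qed
        ultimately show ?thesis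
          by (simp add: essential_submodule_def)
      qed
      ultimately show ?thesis
        by (auto simp: singular_rmodule_def)
    qed
    ultimately show ?thesis
      using N by (simp add: right_s_CS_def s_CS_def)
  qed
  then show ?thesis
    using that essential_in_direct_summandE by blast
qed

end

section \<open>Simple elements\<close>

text \<open>Equality of right annihilators means that sending xa to ya is a well defined isomorphism
  from xR onto yR.\<close>

definition same_ann :: "('a, 'm) ring_scheme \<Rightarrow> 'a \<Rightarrow> 'a \<Rightarrow> bool" where
  "same_ann R x y \<longleftrightarrow> (\<forall>a\<in>carrier R. x \<otimes>\<^bsub>R\<^esub> a = \<zero>\<^bsub>R\<^esub> \<longleftrightarrow> y \<otimes>\<^bsub>R\<^esub> a = \<zero>\<^bsub>R\<^esub>)"

definition simple_elem :: "('a, 'm) ring_scheme \<Rightarrow> 'a \<Rightarrow> bool" where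
  "simple_elem R c \<longleftrightarrow> c \<in> carrier R \<and> c \<noteq> \<zero>\<^bsub>R\<^esub> \<and>
     (\<forall>x\<in>carrier R. c \<otimes>\<^bsub>R\<^esub> x \<noteq> \<zero>\<^bsub>R\<^esub> \<longrightarrow> (\<exists>y\<in>carrier R. c \<otimes>\<^bsub>R\<^esub> x \<otimes>\<^bsub>R\<^esub> y = c))"

text \<open>For simple elements \<open>c\<close> and \<open>d\<close> this says that the modules \<open>cR\<close> and \<open>dR\<close> are isomorphic.\<close>

definition iso_elem :: "('a, 'm) ring_scheme \<Rightarrow> 'a \<Rightarrow> 'a \<Rightarrow> bool" where
  "iso_elem R c d \<longleftrightarrow> (\<exists>x\<in>carrier R. c \<otimes>\<^bsub>R\<^esub> x \<noteq> \<zero>\<^bsub>R\<^esub> \<and> same_ann R (c \<otimes>\<^bsub>R\<^esub> x) d)"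

context ring
begin

lemma same_annD:
  "\<lbrakk>same_ann R x y; a \<in> carrier R\<rbrakk> \<Longrightarrow> x \<otimes> a = \<zero> \<longleftrightarrow> y \<otimes> a = \<zero>"
  by (simp add: same_ann_def)

lemma same_ann_refl: "same_ann R x x"
  by (simp add: same_ann_def)

lemma same_ann_sym: "same_ann R x y \<Longrightarrow> same_ann R y x"
  by (simp add: same_ann_def)

lemma same_ann_trans: "\<lbrakk>same_ann R x y; same_ann R y z\<rbrakk> \<Longrightarrow> same_ann R x z"
  by (simp add: same_ann_def)

lemma same_ann_mult:
  "\<lbrakk>same_ann R x y; x \<in> carrier R; y \<in> carrier R; a \<in> carrier R\<rbrakk> \<Longrightarrow> same_ann R (x \<otimes> a) (y \<otimes> a)"
  by (simp add: same_ann_def m_assoc)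

lemma same_ann_nonzero:
  "\<lbrakk>same_ann R x y; x \<in> carrier R; y \<in> carrier R; x \<noteq> \<zero>\<rbrakk> \<Longrightarrow> y \<noteq> \<zero>"
  using same_annD[of x y \<one>] by auto

lemma same_ann_cancel:
  assumes "same_ann R x y" "x \<in> carrier R" "y \<in> carrier R" "a \<in> carrier R" "b \<in> carrier R"
  shows "x \<otimes> a = x \<otimes> b \<longleftrightarrow> y \<otimes> a = y \<otimes> b"
  using same_annD[OF assms(1), of "a \<ominus> b"] assms by (simp add: r_minus_distr minus_eq_zero_iff)

lemma singular_elem_same_ann: "\<lbrakk>same_ann R x y; singular_elem R x\<rbrakk> \<Longrightarrow> singular_elem R y"
  unfolding singular_elem_def same_ann_def by (meson m_closed)

lemma singular_elem_mult:
  "\<lbrakk>singular_elem R x; x \<in> carrier R; a \<in> carrier R\<rbrakk> \<Longrightarrow> singular_elem R (x \<otimes> a)"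
  using right_idealD(4)[OF right_ideal_singular_elems, of x a] by simp

lemma simple_elemD:
  assumes "simple_elem R c"
  shows "c \<in> carrier R" "c \<noteq> \<zero>"
    and "\<And>x. \<lbrakk>x \<in> carrier R; c \<otimes> x \<noteq> \<zero>\<rbrakk> \<Longrightarrow> \<exists>y\<in>carrier R. c \<otimes> x \<otimes> y = c"
  using assms by (auto simp: simple_elem_def)

text \<open>Simplicity of cR makes r(c) a maximal right ideal, so it cannot grow to the proper right
  ideal r(d).\<close>

lemma simple_elem_ann_le:
  assumes c: "simple_elem R c" and d: "d \<in> carrier R" "d \<noteq> \<zero>"
    and le: "\<And>a. \<lbrakk>a \<in> carrier R; c \<otimes> a = \<zero>\<rbrakk> \<Longrightarrow> d \<otimes> a = \<zero>"
  shows "same_ann R c d"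
proof -
  note cR = simple_elemD(1)[OF c]
  have "c \<otimes> a = \<zero>" if a: "a \<in> carrier R" "d \<otimes> a = \<zero>" for a
  proof (rule ccontr)
    assume "c \<otimes> a \<noteq> \<zero>"
    then obtain y where y: "y \<in> carrier R" "c \<otimes> a \<otimes> y = c"
      using simple_elemD(3)[OF c a(1)] by blast
    then have "c \<otimes> (\<one> \<ominus> a \<otimes> y) = \<zero>"
      using a(1) cR by (simp add: r_minus_distr m_assoc minus_self)
    then have "d \<otimes> (\<one> \<ominus> a \<otimes> y) = \<zero>"
      using le a(1) y(1) by simp
    moreover have "d \<otimes> (a \<otimes> y) = \<zero>"
      using a y(1) d(1) by (simp add: m_assoc[symmetric])
    ultimately show False
      using a(1) y(1) d by (simp add: r_minus_distr minus_eq_zero_iff)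
  qed
  then show ?thesis
    using le by (auto simp: same_ann_def)
qed

text \<open>Schur's lemma for left multiplication by r on cR.\<close>

lemma simple_elem_lmult:
  assumes "simple_elem R c" "r \<in> carrier R" "r \<otimes> c \<noteq> \<zero>"
  shows "same_ann R c (r \<otimes> c)"
  using assms simple_elemD(1)[OF assms(1)] by (intro simple_elem_ann_le) (auto simp: m_assoc)

lemma simple_elem_same_ann:
  assumes c: "simple_elem R c" and d: "d \<in> carrier R" and cd: "same_ann R c d"
  shows "simple_elem R d"
proof -
  note cR = simple_elemD(1)[OF c]
  have "\<exists>y\<in>carrier R. d \<otimes> x \<otimes> y = d" if x: "x \<in> carrier R" "d \<otimes> x \<noteq> \<zero>" for x
  proof -
    obtain y where y: "y \<in> carrier R" "c \<otimes> x \<otimes> y = c"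
      using simple_elemD(3)[OF c x(1)] x same_annD[OF cd] by blast
    then have "c \<otimes> (x \<otimes> y) = c \<otimes> \<one>"
      using cR x by (simp add: m_assoc)
    then have "d \<otimes> (x \<otimes> y) = d \<otimes> \<one>"
      using same_ann_cancel[OF cd cR d] x y by simp
    then show ?thesis
      using x y d by (intro bexI[of _ y]) (simp_all add: m_assoc)
  qed
  then show ?thesis
    using d same_ann_nonzero[OF cd cR d] simple_elemD(2)[OF c] by (simp add: simple_elem_def)
qed

lemma simple_elem_rmult:
  assumes c: "simple_elem R c" and x: "x \<in> carrier R" "c \<otimes> x \<noteq> \<zero>"
  shows "simple_elem R (c \<otimes> x)"
proof -
  note cR = simple_elemD(1)[OF c]
  have "\<exists>z\<in>carrier R. c \<otimes> x \<otimes> y \<otimes> z = c \<otimes> x" if y: "y \<in> carrier R" "c \<otimes> x \<otimes> y \<noteq> \<zero>" for y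
  proof -
    obtain z where "z \<in> carrier R" "c \<otimes> (x \<otimes> y) \<otimes> z = c"
      using simple_elemD(3)[OF c, of "x \<otimes> y"] x y cR by (auto simp: m_assoc)
    then show ?thesis
      using x y cR by (intro bexI[of _ "z \<otimes> x"]) (auto simp: m_assoc[symmetric])
  qed
  then show ?thesis
    using x cR by (simp add: simple_elem_def)
qed

lemma iso_elem_rmult:
  assumes "c \<in> carrier R" "x \<in> carrier R" "c \<otimes> x \<noteq> \<zero>"
  shows "iso_elem R c (c \<otimes> x)"
  using assms same_ann_refl by (auto simp: iso_elem_def)

lemma iso_elem_refl: "simple_elem R c \<Longrightarrow> iso_elem R c c"
  using iso_elem_rmult[of c \<one>] simple_elemD[of c] by simp

text \<open>cx generates cR, so c = cxy, and the isomorphism from cxR to dR sends c to dy.\<close>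

lemma iso_elem_sym:
  assumes c: "simple_elem R c" and d: "d \<in> carrier R" and cd: "iso_elem R c d"
  shows "iso_elem R d c"
proof -
  note cR = simple_elemD(1,2)[OF c]
  obtain x where x: "x \<in> carrier R" "c \<otimes> x \<noteq> \<zero>" "same_ann R (c \<otimes> x) d"
    using cd by (auto simp: iso_elem_def)
  obtain y where y: "y \<in> carrier R" "c \<otimes> x \<otimes> y = c"
    using simple_elemD(3)[OF c x(1,2)] by blast
  have "same_ann R c (d \<otimes> y)"
    using same_ann_mult[OF x(3) _ d y(1)] y(2) x(1) cR(1) by simp
  then show ?thesis
    using y(1) d cR same_ann_nonzero[of c "d \<otimes> y"] same_ann_sym by (auto simp: iso_elem_def)
qed

lemma iso_elem_trans:
  assumes "c \<in> carrier R" "d \<in> carrier R" "iso_elem R c d" "iso_elem R d f"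
  shows "iso_elem R c f"
proof -
  obtain x where x: "x \<in> carrier R" "same_ann R (c \<otimes> x) d"
    using assms(3) by (auto simp: iso_elem_def)
  obtain z where z: "z \<in> carrier R" "d \<otimes> z \<noteq> \<zero>" "same_ann R (d \<otimes> z) f"
    using assms(4) by (auto simp: iso_elem_def)
  have "same_ann R (c \<otimes> x \<otimes> z) (d \<otimes> z)"
    using same_ann_mult[OF x(2) _ assms(2) z(1)] assms(1) x(1) by simp
  then have "same_ann R (c \<otimes> (x \<otimes> z)) (d \<otimes> z)"
    using assms(1) x(1) z(1) by (simp add: m_assoc)
  moreover from this have "c \<otimes> (x \<otimes> z) \<noteq> \<zero>"
    using same_ann_nonzero[OF same_ann_sym] z assms(1,2) x(1) by simp
  ultimately show ?thesis
    unfolding iso_elem_def using x(1) z same_ann_trans by (intro bexI[of _ "x \<otimes> z"]) auto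
qed

lemma iso_elem_same_ann:
  "\<lbrakk>iso_elem R c d; same_ann R d f\<rbrakk> \<Longrightarrow> iso_elem R c f"
  unfolding iso_elem_def using same_ann_trans by blast

lemma iso_elem_simple:
  assumes "simple_elem R c" "d \<in> carrier R" "iso_elem R c d"
  shows "simple_elem R d"
  using assms simple_elem_same_ann simple_elem_rmult unfolding iso_elem_def by blast

lemma iso_elem_singular:
  assumes "singular_elem R c" "c \<in> carrier R" "iso_elem R c d"
  shows "singular_elem R d"
  using assms singular_elem_same_ann singular_elem_mult unfolding iso_elem_def by blast

lemma simple_elem_minimal:
  assumes c: "simple_elem R c"
  shows "minimal_right_ideal R {c \<otimes> a | a. a \<in> carrier R}"
proof -
  note cR = simple_elemD(1,2)[OF c]
  have "right_ideal R {c \<otimes> a | a. a \<in> carrier R}"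
    using cR(1) by (rule right_ideal_cyclic)
  moreover have "c \<in> {c \<otimes> a | a. a \<in> carrier R}"
    using cR(1) by (intro CollectI exI[of _ \<one>]) simp
  moreover have "\<exists>a\<in>carrier R. c \<otimes> x \<otimes> a = c \<otimes> t"
    if x: "x \<in> carrier R" "c \<otimes> x \<noteq> \<zero>" and t: "t \<in> carrier R" for x t
  proof -
    obtain y where "y \<in> carrier R" "c \<otimes> x \<otimes> y = c"
      using simple_elemD(3)[OF c x] by blast
    then show ?thesis
      using cR(1) x(1) t by (intro bexI[of _ "y \<otimes> t"]) (auto simp: m_assoc[symmetric])
  qed
  ultimately show ?thesis
    using cR(2) unfolding minimal_right_ideal_def by blast
qed

text \<open>A simple element \<open>c\<close> that is not singular has an annihilator that misses some \<open>yR \<noteq> 0\<close>;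
  being maximal, the annihilator is a direct summand.\<close>

lemma nonsingular_simple_elem:
  assumes c: "simple_elem R c" and ns: "\<not> singular_elem R c"
  obtains g where "g \<in> carrier R" "g \<otimes> g = g" "simple_elem R g" "c \<otimes> g = c"
proof -
  note cR = simple_elemD(1,2)[OF c]
  obtain y where y: "y \<in> carrier R" "y \<noteq> \<zero>"
    and inj: "\<And>a. \<lbrakk>a \<in> carrier R; c \<otimes> (y \<otimes> a) = \<zero>\<rbrakk> \<Longrightarrow> y \<otimes> a = \<zero>"
    using ns unfolding singular_elem_def by blast
  have "c \<otimes> y \<noteq> \<zero>"
    using inj[of \<one>] y by auto
  then obtain b where b: "b \<in> carrier R" "c \<otimes> y \<otimes> b = c"
    using simple_elemD(3)[OF c y(1)] by blast
  \<comment> \<open>Left multiplication by c is injective on yR, which contains g, and cg = c. So gg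
    and g have the same image under c and coincide.\<close>
  define g where "g = y \<otimes> b"
  have g: "g \<in> carrier R" "c \<otimes> g = c"
    using y b cR by (simp_all add: g_def m_assoc)
  have cancel: "g \<otimes> u = g \<otimes> v" if uv: "u \<in> carrier R" "v \<in> carrier R" and "c \<otimes> (g \<otimes> u) = c \<otimes> (g \<otimes> v)" for u v
  proof -
    have "c \<otimes> (y \<otimes> (b \<otimes> (u \<ominus> v))) = \<zero>"
      using that y b cR by (simp add: g_def m_assoc r_minus_distr minus_self)
    then have "y \<otimes> (b \<otimes> (u \<ominus> v)) = \<zero>"
      using inj uv b by simp
    then show ?thesis
      using uv y b by (simp add: g_def m_assoc r_minus_distr minus_eq_zero_iff)
  qed
  have gg: "g \<otimes> g = g"
    using cancel[of g \<one>] g cR by (simp add: m_assoc[symmetric])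
  have "\<exists>z\<in>carrier R. g \<otimes> x \<otimes> z = g" if x: "x \<in> carrier R" "g \<otimes> x \<noteq> \<zero>" for x
  proof -
    have eq: "c \<otimes> (g \<otimes> x) = c \<otimes> x"
      using g cR x by (simp add: m_assoc[symmetric])
    then have "c \<otimes> x \<noteq> \<zero>"
      using cancel[of x \<zero>] x g cR by auto
    then obtain z where z: "z \<in> carrier R" "c \<otimes> x \<otimes> z = c"
      using simple_elemD(3)[OF c x(1)] by blast
    have "c \<otimes> (g \<otimes> (x \<otimes> z)) = c \<otimes> (g \<otimes> \<one>)"
      using eq z x g cR by (simp add: m_assoc[symmetric])
    then show ?thesis
      using cancel[of "x \<otimes> z" \<one>] x z g by (intro bexI[of _ z]) (simp_all add: m_assoc)
  qed
  then have "simple_elem R g"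
    using g cR by (auto simp: simple_elem_def)
  then show ?thesis
    using that g gg by blast
qed

lemma idempotent_not_singular:
  assumes "g \<in> carrier R" "g \<otimes> g = g" "g \<noteq> \<zero>"
  shows "\<not> singular_elem R g"
proof
  assume "singular_elem R g"
  then obtain a where "a \<in> carrier R" "g \<otimes> a \<noteq> \<zero>" "g \<otimes> (g \<otimes> a) = \<zero>"
    using assms unfolding singular_elem_def by blast
  then show False
    using assms by (simp add: m_assoc[symmetric])
qed

text \<open>A sum of simple right ideals contains no simple types other than those of its summands.
  The induction removes one summand at a time.\<close>

lemma rspan_simple_elems:
  assumes D: "\<And>w. w \<in> D \<Longrightarrow> simple_elem R w"
    and x: "x \<in> rspan R (regular_rmodule R) D" "x \<noteq> \<zero>"
  obtains y w where "y \<in> carrier R" "w \<in> D" "x \<otimes> y \<noteq> \<zero>" "iso_elem R w (x \<otimes> y)"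
proof -
  let ?M = "regular_rmodule R"
  interpret M: right_module R ?M
    by (rule regular_right_module)
  have DR: "D \<subseteq> carrier R"
    using simple_elemD(1)[OF D] by blast
  obtain A where A: "finite A" "A \<subseteq> D" "x \<in> rspan R ?M A"
    by (rule M.rspan_finitary[OF _ x(1)]) (simp add: DR)
  have AR: "A \<subseteq> carrier ?M"
    using A(2) DR by auto
  obtain c where c: "c \<in> A \<rightarrow> carrier R" "x = (\<Oplus>\<^bsub>?M\<^esub>w\<in>A. w \<cdot>\<^bsub>?M\<^esub> c w)"
    by (rule M.finite_rspan[OF A(1) AR A(3)])
  have "\<exists>y\<in>carrier R. \<exists>w\<in>D. (\<Oplus>\<^bsub>?M\<^esub>w\<in>A. w \<otimes> c w) \<otimes> y \<noteq> \<zero> \<and> iso_elem R w ((\<Oplus>\<^bsub>?M\<^esub>w\<in>A. w \<otimes> c w) \<otimes> y)"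
    if "finite A" "A \<subseteq> D" "c \<in> A \<rightarrow> carrier R" "(\<Oplus>\<^bsub>?M\<^esub>w\<in>A. w \<otimes> c w) \<noteq> \<zero>" for A c
    using that
  proof (induction A arbitrary: c)
    case empty
    then show ?case
      using M.M.finsum_empty[of "\<lambda>w. w \<otimes> c w"] by simp
  next
    case (insert w A)
    have w: "simple_elem R w" "w \<in> carrier R" and cw: "c w \<in> carrier R" and cA: "c \<in> A \<rightarrow> carrier R"
      using insert.prems D simple_elemD(1) by auto
    have mem: "(\<lambda>w. w \<otimes> c w) \<in> A \<rightarrow> carrier ?M" if "c \<in> A \<rightarrow> carrier R" for c
      using that insert.prems(1) DR by auto
    define s where "s = w \<otimes> c w"
    define v where "v = (\<Oplus>\<^bsub>?M\<^esub>w\<in>A. w \<otimes> c w)"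
    have s: "s \<in> carrier R" and v: "v \<in> carrier R"
      using w cw M.M.finsum_closed[OF mem[OF cA]] by (simp_all add: s_def v_def)
    have sum: "(\<Oplus>\<^bsub>?M\<^esub>w\<in>insert w A. w \<otimes> c w) = s \<oplus> v"
      using M.M.finsum_insert[OF insert.hyps mem[OF cA]] w cw by (simp add: s_def v_def)
    have scale: "v \<otimes> z = (\<Oplus>\<^bsub>?M\<^esub>w\<in>A. w \<otimes> (c w \<otimes> z))" if z: "z \<in> carrier R" for z
    proof -
      have "v \<otimes> z = (\<Oplus>\<^bsub>?M\<^esub>w\<in>A. w \<otimes> c w \<otimes> z)"
        using M.finsum_rsmult[OF insert.hyps(1) mem[OF cA] z] by (simp add: v_def)
      also have "\<dots> = (\<Oplus>\<^bsub>?M\<^esub>w\<in>A. w \<otimes> (c w \<otimes> z))"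
        using cA insert.prems(1) DR z by (intro M.M.finsum_cong') (auto simp: m_assoc Pi_iff subset_iff)
      finally show ?thesis .
    qed
    show ?case
    \<comment> \<open>Either some z kills s but not v, and the induction hypothesis applies to vz;
      or r(s) is contained in r(s + v), and s + v has the type of s.\<close>
    proof (cases "\<exists>z\<in>carrier R. s \<otimes> z = \<zero> \<and> v \<otimes> z \<noteq> \<zero>")
      case True
      then obtain z where z: "z \<in> carrier R" "s \<otimes> z = \<zero>" "v \<otimes> z \<noteq> \<zero>" by blast
      have "(\<lambda>w. c w \<otimes> z) \<in> A \<rightarrow> carrier R"
        using cA z(1) by auto
      then obtain y w' where "y \<in> carrier R" "w' \<in> D" "v \<otimes> z \<otimes> y \<noteq> \<zero>" "iso_elem R w' (v \<otimes> z \<otimes> y)"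
        using insert.IH[of "\<lambda>w. c w \<otimes> z"] insert.prems(1) z scale by auto
      moreover have "(s \<oplus> v) \<otimes> (z \<otimes> y) = v \<otimes> z \<otimes> y" if "y \<in> carrier R" for y
        using that z s v by (simp add: l_distr m_assoc[symmetric])
      ultimately show ?thesis
        unfolding sum using z(1) by (intro bexI[of _ "z \<otimes> y"] bexI[of _ w']) auto
    next
      case False
      have sv: "s \<oplus> v \<noteq> \<zero>"
        using insert.prems(3) sum by simp
      have "s \<noteq> \<zero>"
        using False sv v by (metis l_null l_zero one_closed r_one)
      then have "simple_elem R s"
        using simple_elem_rmult[OF w(1) cw] by (simp add: s_def)
      moreover have "(s \<oplus> v) \<otimes> a = \<zero>" if "a \<in> carrier R" "s \<otimes> a = \<zero>" for a
        using False that s v by (auto simp: l_distr)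
      ultimately have "same_ann R s (s \<oplus> v)"
        using sv s v by (intro simple_elem_ann_le) auto
      moreover have "iso_elem R w s"
        unfolding s_def using \<open>s \<noteq> \<zero>\<close> w(2) cw by (intro iso_elem_rmult) (simp_all add: s_def)
      ultimately have "iso_elem R w (s \<oplus> v)"
        by (rule iso_elem_same_ann[rotated])
      then show ?thesis
        unfolding sum using sv s v insert.prems(1) by (intro bexI[of _ \<one>] bexI[of _ w]) auto
    qed
  qed
  from this[OF A(1,2) c(1)] show ?thesis
    using c(2) x(2) that by auto
qed

end

section \<open>Maximal right ideals as annihilators\<close>

text \<open>The three assumptions are the elementwise forms of FGF, GC2 and the CS condition. From
  here on the first two hypotheses are used only in this form, without free modules or direct
  summands.\<close>

locale fgf_ring = ring R for R (structure) +
  assumes relations: "rsubmodule R (prod_rmodule (regular_rmodule R) (regular_rmodule R)) K \<Longrightarrow>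
      \<exists>F. finite F \<and> F \<subseteq> carrier R \<times> carrier R \<and> (\<forall>x\<in>carrier R. \<forall>y\<in>carrier R.
        (x, y) \<in> K \<longleftrightarrow> (\<forall>(a, b)\<in>F. a \<otimes> x \<oplus> b \<otimes> y = \<zero>))"
    and left_inverse: "\<lbrakk>a \<in> carrier R; \<And>x. \<lbrakk>x \<in> carrier R; a \<otimes> x = \<zero>\<rbrakk> \<Longrightarrow> x = \<zero>\<rbrakk> \<Longrightarrow>
      \<exists>b\<in>carrier R. b \<otimes> a = \<one>"
    and singular_essential: "\<lbrakk>\<And>S. S \<in> \<S> \<Longrightarrow> minimal_right_ideal R S;
      \<And>S x. \<lbrakk>S \<in> \<S>; x \<in> S\<rbrakk> \<Longrightarrow> singular_elem R x\<rbrakk> \<Longrightarrow>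
      \<exists>e. essential_in_idem R (right_ideal_sum R \<S>) e"
begin

text \<open>The equations of I x R, read at y = 0.\<close>

lemma right_ideal_annihilator:
  assumes I: "right_ideal R I"
  obtains F where "finite F" "F \<subseteq> carrier R"
    "\<And>x. x \<in> carrier R \<Longrightarrow> x \<in> I \<longleftrightarrow> (\<forall>a\<in>F. a \<otimes> x = \<zero>)"
proof -
  let ?M = "regular_rmodule R"
  interpret P: right_module R "prod_rmodule ?M ?M"
    by (intro prod_right_module regular_right_module)
  have "rsubmodule R (prod_rmodule ?M ?M) (I \<times> carrier R)"
    using right_idealD[OF I] by (intro P.rsubmoduleI) auto
  then obtain F where F: "finite F" "F \<subseteq> carrier R \<times> carrier R"
    and rel0: "\<forall>x\<in>carrier R. \<forall>y\<in>carrier R.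
      (x, y) \<in> I \<times> carrier R \<longleftrightarrow> (\<forall>(a, b)\<in>F. a \<otimes> x \<oplus> b \<otimes> y = \<zero>)"
    using relations[of "I \<times> carrier R"] by blast
  have rel: "x \<in> I \<longleftrightarrow> (\<forall>(a, b)\<in>F. a \<otimes> x \<oplus> b \<otimes> y = \<zero>)"
    if "x \<in> carrier R" "y \<in> carrier R" for x y
    using rel0[THEN bspec, THEN bspec, OF that] that(2) by simp
  show ?thesis
  proof (rule that)
    show "finite (fst ` F)" "fst ` F \<subseteq> carrier R"
      using F by auto
    fix x assume x: "x \<in> carrier R"
    have "a \<otimes> x \<oplus> b \<otimes> \<zero> = a \<otimes> x" if "(a, b) \<in> F" for a b
      using F(2) that x by auto
    then show "x \<in> I \<longleftrightarrow> (\<forall>a\<in>fst ` F. a \<otimes> x = \<zero>)"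
      unfolding rel[OF x zero_closed] by force
  qed
qed

text \<open>A maximal right ideal T above I is a finite intersection of annihilators. Each nonzero c
  among the annihilating elements has r(c) = T by maximality, so cR is isomorphic to R/T.\<close>

lemma proper_right_ideal_annihilated:
  assumes I: "right_ideal R I" and one: "\<one> \<notin> I"
  obtains c where "simple_elem R c" "\<And>x. x \<in> I \<Longrightarrow> c \<otimes> x = \<zero>"
proof -
  interpret M: right_module R "regular_rmodule R"
    by (rule regular_right_module)
  define \<A> where "\<A> = {J. right_ideal R J \<and> I \<subseteq> J \<and> \<one> \<notin> J}"
  have "\<exists>T\<in>\<A>. \<forall>X\<in>\<A>. T \<subseteq> X \<longrightarrow> X = T"
  proof (rule subset_Zorn_nonempty)
    show "\<A> \<noteq> {}"
      using I one by (auto simp: \<A>_def)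
    fix \<C> assume C: "\<C> \<noteq> {}" "subset.chain \<A> \<C>"
    then have "right_ideal R (\<Union>\<C>)"
      by (intro M.rsubmodule_Union_chain) (auto simp: \<A>_def subset_chain_def)
    then show "\<Union>\<C> \<in> \<A>"
      using C by (auto simp: \<A>_def subset_chain_def)
  qed
  then obtain T where T: "right_ideal R T" "I \<subseteq> T" "\<one> \<notin> T"
    and max: "\<And>X. \<lbrakk>right_ideal R X; T \<subseteq> X; \<one> \<notin> X\<rbrakk> \<Longrightarrow> X = T"
    by (auto simp: \<A>_def)
  obtain F where F: "F \<subseteq> carrier R"
    and ann: "\<And>x. x \<in> carrier R \<Longrightarrow> x \<in> T \<longleftrightarrow> (\<forall>a\<in>F. a \<otimes> x = \<zero>)"
    using right_ideal_annihilator[OF T(1)] by metis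
  obtain c where c: "c \<in> F" "c \<otimes> \<one> \<noteq> \<zero>"
    using ann[of \<one>] T(3) by auto
  have cR: "c \<in> carrier R" "c \<noteq> \<zero>"
    using c F by auto
  have cT: "c \<otimes> x = \<zero>" if "x \<in> T" for x
    using that ann c(1) right_idealD(5)[OF T(1)] by blast
  have "\<exists>y\<in>carrier R. c \<otimes> x \<otimes> y = c" if x: "x \<in> carrier R" "c \<otimes> x \<noteq> \<zero>" for x
  proof -
    have "x \<notin> T"
      using x(2) cT by blast
    \<comment> \<open>T + xR is strictly larger than T and hence contains 1.\<close>
    let ?X = "{t \<oplus> x \<otimes> a | t a. t \<in> T \<and> a \<in> carrier R}"
    have "right_ideal R ?X" "T \<subseteq> ?X" "x \<in> ?X"
      using M.rsubmodule_add_cyclic[OF T(1), of x] x(1) by simp_all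
    then have "\<one> \<in> ?X"
      using max[of ?X] \<open>x \<notin> T\<close> by blast
    then obtain t y where ty: "t \<in> T" "y \<in> carrier R" "\<one> = t \<oplus> x \<otimes> y"
      by blast
    have tR: "t \<in> carrier R"
      using ty(1) right_idealD(5)[OF T(1)] by blast
    have "c = c \<otimes> (t \<oplus> x \<otimes> y)"
      using r_one[OF cR(1)] by (simp only: ty(3))
    also have "\<dots> = c \<otimes> x \<otimes> y"
      using cR x(1) ty tR cT by (simp add: r_distr m_assoc)
    finally show ?thesis
      using ty(2) by metis
  qed
  then have "simple_elem R c"
    using cR by (simp add: simple_elem_def)
  then show ?thesis
    using that cT T(2) by blast
qed

text \<open>GC2 speaks of R only. Adding 1 - e makes t act as the identity on the complement of eR,
  so that t + (1 - e) is injective on all of R.\<close>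

lemma corner_left_inverse:
  assumes e: "e \<in> carrier R" "e \<otimes> e = e" and t: "t \<in> carrier R" "e \<otimes> t = t" "t \<otimes> e = t"
    and inj: "\<And>x. \<lbrakk>x \<in> carrier R; e \<otimes> x = x; t \<otimes> x = \<zero>\<rbrakk> \<Longrightarrow> x = \<zero>"
  obtains d where "d \<in> carrier R" "e \<otimes> d = d" "d \<otimes> e = d" "d \<otimes> t = e"
proof -
  let ?a = "t \<oplus> (\<one> \<ominus> e)"
  have "\<exists>b\<in>carrier R. b \<otimes> ?a = \<one>"
  proof (rule left_inverse)
    show "?a \<in> carrier R"
      using e t by simp
    fix x assume x: "x \<in> carrier R" "?a \<otimes> x = \<zero>"
    have ax: "?a \<otimes> x = t \<otimes> x \<oplus> (x \<ominus> e \<otimes> x)"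
      using e t x(1) by (simp add: l_distr l_minus_distr)
    have "e \<otimes> (t \<otimes> x \<oplus> (x \<ominus> e \<otimes> x)) = t \<otimes> x"
      using e t x(1) by (simp add: r_distr r_minus_distr m_assoc[symmetric] minus_self)
    then have tx: "t \<otimes> x = \<zero>"
      using x(2) ax e(1) by simp
    then have "e \<otimes> x = x"
      using x ax e by (simp add: minus_eq_zero_iff)
    then show "x = \<zero>"
      using inj x(1) tx by blast
  qed
  then obtain b where b: "b \<in> carrier R" "b \<otimes> ?a = \<one>"
    by blast
  have "?a \<otimes> e = t"
    using e t by (simp add: l_distr l_minus_distr minus_self)
  then have bt: "b \<otimes> t = e"
    using b e t m_assoc[of b ?a e] by simp
  show ?thesis
  proof (rule that)
    \<comment> \<open>The left inverse b on R is cut down to the corner eRe.\<close>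
    show "e \<otimes> b \<otimes> e \<otimes> t = e"
      using b(1) e t bt by (simp add: m_assoc)
  qed (use b(1) e in \<open>simp_all add: m_assoc[symmetric], simp_all add: m_assoc\<close>)
qed

end

section \<open>Essential submodules of eR and representatives of the simple types\<close>

context ring
begin

lemma essential_in_idemD:
  assumes "essential_in_idem R N e"
  shows "e \<in> carrier R" "e \<otimes> e = e" "\<And>x. x \<in> N \<Longrightarrow> e \<otimes> x = x"
    and "\<And>x. \<lbrakk>x \<in> carrier R; e \<otimes> x = x; x \<noteq> \<zero>\<rbrakk> \<Longrightarrow>
      \<exists>a\<in>carrier R. x \<otimes> a \<in> N \<and> x \<otimes> a \<noteq> \<zero>"
  using assms by (auto simp: essential_in_idem_def)

lemma essential_in_idem_inj:
  assumes N: "essential_in_idem R N e" and t: "t \<in> carrier R"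
    and inj: "\<And>n. \<lbrakk>n \<in> N; t \<otimes> n = \<zero>\<rbrakk> \<Longrightarrow> n = \<zero>"
    and x: "x \<in> carrier R" "e \<otimes> x = x" "t \<otimes> x = \<zero>"
  shows "x = \<zero>"
proof (rule ccontr)
  assume "x \<noteq> \<zero>"
  then obtain a where a: "a \<in> carrier R" "x \<otimes> a \<in> N" "x \<otimes> a \<noteq> \<zero>"
    using essential_in_idemD(4)[OF N x(1,2)] by blast
  have "t \<otimes> (x \<otimes> a) = \<zero>"
    using x a(1) t by (simp add: m_assoc[symmetric])
  then show False
    using inj a by blast
qed

lemma rspan_right_ideal: "D \<subseteq> carrier R \<Longrightarrow> right_ideal R (rspan R (regular_rmodule R) D)"
  using right_module.rspan_rsubmodule[OF regular_right_module, of D] by simp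

lemma rspan_subset: "D \<subseteq> rspan R (regular_rmodule R) D"
  by (rule right_module.rspan_superset[OF regular_right_module])

lemma rspan_minimal: "\<lbrakk>right_ideal R I; D \<subseteq> I\<rbrakk> \<Longrightarrow> rspan R (regular_rmodule R) D \<subseteq> I"
  by (rule right_module.rspan_least[OF regular_right_module])

lemma right_ideal_sum_cyclic:
  assumes "D \<subseteq> carrier R"
  shows "right_ideal_sum R ((\<lambda>w. {w \<otimes> a | a. a \<in> carrier R}) ` D) = rspan R (regular_rmodule R) D"
    (is "?L = ?N")
proof
  note N = right_idealD[OF rspan_right_ideal[OF assms]]
  have "{w \<otimes> a | a. a \<in> carrier R} \<subseteq> ?N" if "w \<in> D" for w
    using N(4)[OF subsetD[OF rspan_subset that]] by blast
  then show "?L \<subseteq> ?N"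
    by (intro right_ideal_sum_least rspan_right_ideal[OF assms]) blast
  have "right_ideal R ?L"
    using right_ideal_cyclic assms by (intro right_ideal_sum_right_ideal) blast
  moreover have "w \<in> ?L" if w: "w \<in> D" for w
  proof -
    have "w = w \<otimes> \<one>"
      using w assms by auto
    then have "w \<in> {w \<otimes> a | a. a \<in> carrier R}"
      by blast
    then show ?thesis
      by (rule subsetD[OF right_ideal_sum_upper[OF imageI[OF w]]])
  qed
  then have "D \<subseteq> ?L"
    by blast
  ultimately show "?N \<subseteq> ?L"
    by (rule rspan_minimal)
qed

text \<open>\<open>rep\<close> chooses by a predicate that depends only on the isomorphism class, so
  it is constant on classes and its image meets each class exactly once.\<close>

lemma iso_elem_representatives:
  obtains W where "\<And>w. w \<in> W \<Longrightarrow> simple_elem R w" "\<And>w. w \<in> W \<Longrightarrow> singular_elem R w"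
    "\<And>w w'. \<lbrakk>w \<in> W; w' \<in> W; iso_elem R w w'\<rbrakk> \<Longrightarrow> w = w'"
    "\<And>c. \<lbrakk>simple_elem R c; singular_elem R c\<rbrakk> \<Longrightarrow> \<exists>w\<in>W. iso_elem R c w"
proof -
  define X where "X = {c. simple_elem R c \<and> singular_elem R c}"
  define rep where "rep c = (SOME d. d \<in> X \<and> iso_elem R c d)" for c
  have X: "simple_elem R c" "singular_elem R c" "c \<in> carrier R" if "c \<in> X" for c
    using that simple_elemD(1) by (auto simp: X_def)
  have rep: "rep c \<in> X \<and> iso_elem R c (rep c)" if "c \<in> X" for c
    unfolding rep_def by (rule someI[of _ c]) (use that iso_elem_refl[OF X(1)] in blast)
  have sym: "iso_elem R d c" if "c \<in> X" "d \<in> X" "iso_elem R c d" for c d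
    by (rule iso_elem_sym[OF X(1)[OF that(1)] X(3)[OF that(2)] that(3)])
  have trans: "iso_elem R c f" if "c \<in> X" "d \<in> X" "iso_elem R c d" "iso_elem R d f" for c d f
    by (rule iso_elem_trans[OF X(3)[OF that(1)] X(3)[OF that(2)] that(3,4)])
  have eq: "rep c = rep d" if "c \<in> X" "d \<in> X" "iso_elem R c d" for c d
  proof -
    have "f \<in> X \<and> iso_elem R c f \<longleftrightarrow> f \<in> X \<and> iso_elem R d f" for f
      using trans[OF that(2) that(1) sym[OF that], of f] trans[OF that(1) that(2) that(3), of f] by blast
    then show ?thesis
      by (simp add: rep_def)
  qed
  show ?thesis
  proof (rule that)
    fix w assume "w \<in> rep ` X"
    then show "simple_elem R w" "singular_elem R w"
      using rep X by auto
  next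
    fix w w' assume "w \<in> rep ` X" "w' \<in> rep ` X" and iso: "iso_elem R w w'"
    then obtain c d where c: "c \<in> X" "w = rep c" and d: "d \<in> X" "w' = rep d"
      by auto
    have "iso_elem R c (rep d)"
      using trans[OF c(1), of "rep c" "rep d"] rep[OF c(1)] iso c(2) d(2) by simp
    then have "iso_elem R c d"
      using trans[of c "rep d" d] sym[of d "rep d"] rep[OF d(1)] c(1) d(1) by blast
    then show "w = w'"
      using eq c d by simp
  next
    fix c assume "simple_elem R c" "singular_elem R c"
    then show "\<exists>w\<in>rep ` X. iso_elem R c w"
      using rep[of c] by (auto simp: X_def)
  qed
qed

end

text \<open>Being the identity on N, t is injective on N and, by essentiality, on fR. This takes the
  place of the uniqueness of injective hulls.\<close>

lemma (in fgf_ring) hull_left_inverse: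
  assumes N: "essential_in_idem R N f" and t: "t \<in> carrier R" "f \<otimes> t = t" "t \<otimes> f = t"
    and id: "\<And>n. n \<in> N \<Longrightarrow> t \<otimes> n = n"
  obtains d where "d \<in> carrier R" "f \<otimes> d = d" "d \<otimes> f = d" "d \<otimes> t = f"
proof (rule corner_left_inverse[OF essential_in_idemD(1,2)[OF N] t])
  fix x assume "x \<in> carrier R" "f \<otimes> x = x" "t \<otimes> x = \<zero>"
  then show "x = \<zero>"
    by (rule essential_in_idem_inj[OF N t(1), rotated]) (simp add: id)
qed (rule that)

lemma (in fgf_ring) rspan_essential:
  assumes "\<And>w. w \<in> D \<Longrightarrow> simple_elem R w" "\<And>w. w \<in> D \<Longrightarrow> singular_elem R w"
  obtains f where "essential_in_idem R (rspan R (regular_rmodule R) D) f"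
proof -
  let ?S = "(\<lambda>w. {w \<otimes> a | a. a \<in> carrier R}) ` D"
  have DR: "D \<subseteq> carrier R"
    using assms(1) simple_elemD(1) by blast
  have "\<exists>e. essential_in_idem R (right_ideal_sum R ?S) e"
  proof (rule singular_essential)
    show "minimal_right_ideal R S" if "S \<in> ?S" for S
      using that simple_elem_minimal assms(1) by blast
    show "singular_elem R x" if "S \<in> ?S" "x \<in> S" for S x
      using that assms(2) DR singular_elem_mult by blast
  qed
  then show ?thesis
    using that unfolding right_ideal_sum_cyclic[OF DR] by blast
qed

section \<open>The hull of the singular socle\<close>

text \<open>By \<open>proper_right_ideal_annihilated\<close> every simple right module is isomorphic
  to cR for a simple element c, so W represents all singular simple modules and not only some right
  ideals.\<close>

locale socle_hull = fgf_ring R for R (structure) +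
  fixes W :: "'a set" and e :: 'a
  assumes W_simple: "w \<in> W \<Longrightarrow> simple_elem R w"
    and W_singular: "w \<in> W \<Longrightarrow> singular_elem R w"
    and W_unique: "\<lbrakk>w \<in> W; w' \<in> W; iso_elem R w w'\<rbrakk> \<Longrightarrow> w = w'"
    and W_complete: "\<lbrakk>simple_elem R c; singular_elem R c\<rbrakk> \<Longrightarrow> \<exists>w\<in>W. iso_elem R c w"
    and e_hull: "essential_in_idem R (rspan R (regular_rmodule R) W) e"
begin

abbreviation "soc D \<equiv> rspan R (regular_rmodule R) D"

lemma W_carrier: "w \<in> W \<Longrightarrow> w \<in> carrier R"
  using W_simple simple_elemD(1) by blast

lemma e_idem: "e \<in> carrier R" "e \<otimes> e = e"
  using essential_in_idemD[OF e_hull] by blast+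

lemma e_fixes: "w \<in> W \<Longrightarrow> e \<otimes> w = w"
  using essential_in_idemD(3)[OF e_hull] rspan_subset by blast

text \<open>By Schur's lemma a nonzero rw has the type of w. In the socle over D it can only have a
  type from D, and distinct elements of W have distinct types.\<close>

lemma soc_type:
  assumes D: "D \<subseteq> W" and w: "w \<in> W" and r: "r \<in> carrier R" and x: "r \<otimes> w \<in> soc D" "r \<otimes> w \<noteq> \<zero>"
  shows "w \<in> D"
proof -
  have wR: "w \<in> carrier R" and rw: "r \<otimes> w \<in> carrier R"
    using w W_carrier r by auto
  have "simple_elem R v" if "v \<in> D" for v
    using that D W_simple by blast
  then obtain y w' where y: "y \<in> carrier R" "r \<otimes> w \<otimes> y \<noteq> \<zero>"
    and w': "w' \<in> D" "iso_elem R w' (r \<otimes> w \<otimes> y)"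
    by (rule rspan_simple_elems[OF _ x])
  have eq: "r \<otimes> w \<otimes> y = r \<otimes> (w \<otimes> y)"
    using r wR y(1) by (rule m_assoc)
  then have "w \<otimes> y \<noteq> \<zero>"
    using y(2) r by auto
  note wy = this
  have "same_ann R (w \<otimes> y) (r \<otimes> w \<otimes> y)"
    unfolding eq by (rule simple_elem_lmult[OF simple_elem_rmult[OF W_simple[OF w] y(1) wy] r])
      (use y(2) eq in simp)
  then have iso: "iso_elem R w (r \<otimes> w \<otimes> y)"
    by (rule iso_elem_same_ann[OF iso_elem_rmult[OF wR y(1) wy]])
  have "w' \<in> W"
    using D w' by blast
  then have "iso_elem R (r \<otimes> w \<otimes> y) w'"
    using iso_elem_sym[OF W_simple _ w'(2)] rw y(1) by simp
  then have "iso_elem R w w'"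
    using iso_elem_trans[OF wR _ iso] rw y(1) by simp
  then show ?thesis
    using W_unique[OF w \<open>w' \<in> W\<close>] w'(1) by simp
qed

text \<open>A simple right ideal inside fR meets the essential submodule \<open>soc D\<close> and
  therefore lies in it.\<close>

lemma hull_type:
  assumes D: "D \<subseteq> W" and f: "essential_in_idem R (soc D) f" and w: "w \<in> W"
    and r: "r \<in> carrier R" and x: "f \<otimes> (r \<otimes> w) = r \<otimes> w" "r \<otimes> w \<noteq> \<zero>"
  shows "w \<in> D"
proof -
  have wR: "w \<in> carrier R"
    using w W_carrier by blast
  obtain a where a: "a \<in> carrier R" "r \<otimes> w \<otimes> a \<in> soc D" "r \<otimes> w \<otimes> a \<noteq> \<zero>"
    using essential_in_idemD(4)[OF f _ x] r wR by auto
  have "w \<otimes> a \<noteq> \<zero>"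
    using a(1,3) r wR by (auto simp: m_assoc)
  then obtain z where z: "z \<in> carrier R" "w \<otimes> a \<otimes> z = w"
    using simple_elemD(3)[OF W_simple[OF w] a(1)] by blast
  have DR: "D \<subseteq> carrier R"
    using D W_carrier by blast
  have "r \<otimes> w = r \<otimes> w \<otimes> a \<otimes> z"
    using z a(1) r wR by (simp add: m_assoc)
  then have "r \<otimes> w \<in> soc D"
    using right_idealD(4)[OF rspan_right_ideal[OF DR] a(2) z(1)] by simp
  then show ?thesis
    by (rule soc_type[OF D w r _ x(2)])
qed

text \<open>e - t fixes the socle, so it has a left inverse d. Then d fixes the socle too and has a
  left inverse d', which must equal e - t; so the inverse is two-sided.\<close>

lemma hull_invertible:
  assumes t: "t \<in> carrier R" "e \<otimes> t = t" "t \<otimes> e = t" and zero: "\<And>w. w \<in> W \<Longrightarrow> t \<otimes> w = \<zero>"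
  obtains d where "d \<in> carrier R" "d \<otimes> (e \<ominus> t) = e" "(e \<ominus> t) \<otimes> d = e"
proof -
  note e = e_idem
  have WR: "W \<subseteq> carrier R"
    using W_carrier by blast
  have "right_ideal R {n \<in> carrier R. t \<otimes> n = \<zero>}"
    using t(1) by (intro right_idealI) (auto simp: r_distr m_assoc[symmetric])
  then have "soc W \<subseteq> {n \<in> carrier R. t \<otimes> n = \<zero>}"
    using zero WR by (intro rspan_minimal) auto
  then have fix_n: "(e \<ominus> t) \<otimes> n = n" if "n \<in> soc W" for n
    using that essential_in_idemD(3)[OF e_hull that] e t(1) by (auto simp: l_minus_distr minus_zero_right)
  have socR: "n \<in> carrier R" if "n \<in> soc W" for n
    using right_idealD(5)[OF rspan_right_ideal[OF WR] that] .
  have et: "e \<ominus> t \<in> carrier R" "e \<otimes> (e \<ominus> t) = e \<ominus> t" "(e \<ominus> t) \<otimes> e = e \<ominus> t"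
    using e t by (simp_all add: r_minus_distr l_minus_distr)
  obtain d where d: "d \<in> carrier R" "e \<otimes> d = d" "d \<otimes> e = d" "d \<otimes> (e \<ominus> t) = e"
    by (rule hull_left_inverse[OF e_hull et fix_n])
  have "d \<otimes> n = n" if n: "n \<in> soc W" for n
  proof -
    have "d \<otimes> ((e \<ominus> t) \<otimes> n) = e \<otimes> n"
      using d et(1) socR[OF n] by (simp add: m_assoc[symmetric])
    then show ?thesis
      using fix_n n essential_in_idemD(3)[OF e_hull] by simp
  qed
  then obtain d' where d': "d' \<in> carrier R" "d' \<otimes> d = e" "d' \<otimes> e = d'"
    by (rule hull_left_inverse[OF e_hull d(1-3)])
  have "d' = d' \<otimes> (d \<otimes> (e \<ominus> t))"
    using d(4) d'(3) by simp
  also have "\<dots> = e \<ominus> t"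
    using d'(1,2) d(1) et by (simp add: m_assoc[symmetric])
  finally show ?thesis
    using that d d' by simp
qed

text \<open>A hull fR of \<open>soc D\<close> need not lie in eR. Left multiplication by e maps it
  injectively into eR, and p projects eR onto the image. The clauses with r say more than vanishing
  on W: they kill every copy rw of a type, since the maps x met later move the chosen w to other
  copies.\<close>

lemma socle_projection:
  assumes D: "D \<subseteq> W"
  obtains p where "p \<in> carrier R" "e \<otimes> p = p" "p \<otimes> e = p" "p \<otimes> p = p"
    "\<And>w. w \<in> D \<Longrightarrow> p \<otimes> w = w"
    "\<And>w r. \<lbrakk>w \<in> W - D; r \<in> carrier R\<rbrakk> \<Longrightarrow> p \<otimes> (r \<otimes> w) = \<zero>"
    "\<And>w r. \<lbrakk>w \<in> D; r \<in> carrier R\<rbrakk> \<Longrightarrow> (e \<ominus> p) \<otimes> (r \<otimes> w) = \<zero>"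
proof -
  note e = e_idem
  obtain f where f: "essential_in_idem R (soc D) f"
    using rspan_essential[of D] D W_simple W_singular by blast
  note fD = essential_in_idemD[OF f]
  have soc_mono: "soc D \<subseteq> soc W"
    using D right_module.rspan_mono[OF regular_right_module] by blast
  have WR: "W \<subseteq> carrier R" and DR: "D \<subseteq> carrier R"
    using D W_carrier by blast+
  \<comment> \<open>The composite fR to eR to fR. It fixes \<open>soc D\<close>, hence has a left
    inverse u on fR.\<close>
  define t where "t = f \<otimes> e \<otimes> f"
  have t: "t \<in> carrier R" "f \<otimes> t = t" "t \<otimes> f = t"
    using fD(1,2) e by (simp_all add: t_def m_assoc) (simp add: m_assoc[symmetric])
  have t_fix: "t \<otimes> n = n" if "n \<in> soc D" for n
    using that soc_mono right_idealD(5)[OF rspan_right_ideal[OF DR] that] e fD(1) fD(3)[OF that]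
      essential_in_idemD(3)[OF e_hull] by (auto simp: t_def m_assoc)
  obtain u where u: "u \<in> carrier R" "f \<otimes> u = u" "u \<otimes> f = u" "u \<otimes> t = f"
    by (rule hull_left_inverse[OF f t t_fix])
  define p where "p = e \<otimes> u \<otimes> e"
  have p: "p \<in> carrier R" "e \<otimes> p = p" "p \<otimes> e = p"
    using e u(1) by (simp_all add: p_def m_assoc) (simp add: m_assoc[symmetric])
  \<comment> \<open>This identity makes p = eue idempotent: ueu = u(fef)u = (ut)u = fu = u.\<close>
  have "u \<otimes> e \<otimes> u = (u \<otimes> f) \<otimes> e \<otimes> (f \<otimes> u)"
    using u by simp
  also have "\<dots> = (u \<otimes> t) \<otimes> u"
    using u(1) fD(1) e by (simp only: t_def m_assoc m_closed)
  finally have "u \<otimes> e \<otimes> u = u"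
    using u by simp
  then have "u \<otimes> (e \<otimes> (u \<otimes> e)) = u \<otimes> e"
    using u(1) e by (simp add: m_assoc[symmetric])
  moreover have "p \<otimes> p = e \<otimes> (u \<otimes> ((e \<otimes> e) \<otimes> (u \<otimes> e)))"
    using u(1) e(1) by (simp only: p_def m_assoc m_closed)
  ultimately have pp: "p \<otimes> p = p"
    using u(1) e by (simp add: p_def m_assoc)
  have p_fix: "p \<otimes> w = w" if w: "w \<in> D" for w
  proof -
    have wR: "w \<in> carrier R" and ws: "w \<in> soc D" and ew: "e \<otimes> w = w"
      using w D W_carrier rspan_subset[of D] e_fixes by blast+
    have "u \<otimes> w = u \<otimes> (t \<otimes> w)"
      using t_fix[OF ws] by simp
    also have "\<dots> = w"
      using u t wR fD(3)[OF ws] by (simp add: m_assoc[symmetric])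
    finally show ?thesis
      using wR ew u(1) e(1) by (simp add: p_def m_assoc)
  qed
  have p_zero: "p \<otimes> (r \<otimes> w) = \<zero>" if w: "w \<in> W - D" and r: "r \<in> carrier R" for w r
  proof -
    have wR: "w \<in> carrier R"
      using w W_carrier by blast
    have "u \<otimes> e \<otimes> r \<otimes> w = \<zero>"
    proof (rule ccontr)
      assume "u \<otimes> e \<otimes> r \<otimes> w \<noteq> \<zero>"
      moreover have "f \<otimes> (u \<otimes> e \<otimes> r \<otimes> w) = u \<otimes> e \<otimes> r \<otimes> w"
        using u(1,2) e(1) r wR fD(1) by (simp add: m_assoc[symmetric])
      ultimately show False
        using hull_type[OF D f, of w "u \<otimes> e \<otimes> r"] u(1) e(1) r w by blast
    qed
    then show ?thesis
      using u(1) e(1) r wR by (simp add: p_def m_assoc)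
  qed
  have compl: "(e \<ominus> p) \<otimes> (r \<otimes> w) = \<zero>" if w: "w \<in> D" and r: "r \<in> carrier R" for w r
  proof (rule ccontr)
    assume nz: "(e \<ominus> p) \<otimes> (r \<otimes> w) \<noteq> \<zero>"
    have wR: "w \<in> carrier R" and wW: "w \<in> W"
      using w D W_carrier by blast+
    define q where "q = e \<ominus> p"
    have q: "q \<in> carrier R" "e \<otimes> q = q" "p \<otimes> q = \<zero>"
      using e p pp by (simp_all add: q_def r_minus_distr minus_self)
    have x: "q \<otimes> r \<otimes> w \<in> carrier R" "q \<otimes> r \<otimes> w \<noteq> \<zero>" "e \<otimes> (q \<otimes> r \<otimes> w) = q \<otimes> r \<otimes> w"
      using nz q r wR e(1) by (simp_all add: q_def[symmetric] m_assoc[symmetric])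
    obtain a where a: "a \<in> carrier R" "q \<otimes> r \<otimes> w \<otimes> a \<in> soc W" "q \<otimes> r \<otimes> w \<otimes> a \<noteq> \<zero>"
      using essential_in_idemD(4)[OF e_hull x(1,3,2)] by blast
    \<comment> \<open>The elements whose part outside pR lies in the socle over W - D. This right
      ideal contains W, hence the whole socle, so a nonzero qrwa in the socle has a type outside
      D.\<close>
    let ?J = "{n \<in> carrier R. n \<ominus> p \<otimes> n \<in> soc (W - D)}"
    have "W - D \<subseteq> carrier R"
      using WR by blast
    note J = right_idealD[OF rspan_right_ideal[OF this]]
    have "right_ideal R ?J"
    proof (rule right_idealI)
      show "\<zero> \<in> ?J"
        using p(1) J(2) by (simp add: minus_self)
    next
      fix x y assume "x \<in> ?J" "y \<in> ?J"
      moreover from this have "x \<oplus> y \<ominus> p \<otimes> (x \<oplus> y) = (x \<ominus> p \<otimes> x) \<oplus> (y \<ominus> p \<otimes> y)"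
        using p(1) by (simp add: r_distr a_minus_def minus_add a_ac)
      ultimately show "x \<oplus> y \<in> ?J"
        using J(3) by simp
    next
      fix x b assume "x \<in> ?J" and b: "b \<in> carrier R"
      moreover from this have "x \<otimes> b \<ominus> p \<otimes> (x \<otimes> b) = (x \<ominus> p \<otimes> x) \<otimes> b"
        using p(1) by (simp add: l_minus_distr m_assoc)
      ultimately show "x \<otimes> b \<in> ?J"
        using J(4) by simp
    qed auto
    moreover have "w' \<in> ?J" if "w' \<in> W" for w'
    proof (cases "w' \<in> D")
      case True
      then show ?thesis
        using p_fix[OF True] W_carrier[OF that] J(2) by (simp add: minus_self)
    next
      case False
      then show ?thesis
        using p_zero[of w' \<one>] that W_carrier[OF that] p(1) rspan_subset[of "W - D"]
        by (auto simp: minus_zero_right)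
    qed
    ultimately have "soc W \<subseteq> ?J"
      by (intro rspan_minimal) auto
    then have "q \<otimes> r \<otimes> w \<otimes> a \<ominus> p \<otimes> (q \<otimes> r \<otimes> w \<otimes> a) \<in> soc (W - D)"
      using a(2) by blast
    moreover have "p \<otimes> (q \<otimes> r \<otimes> w \<otimes> a) = \<zero>"
      using q p(1) r wR a(1) by (simp add: m_assoc[symmetric])
    ultimately have mem: "q \<otimes> r \<otimes> w \<otimes> a \<in> soc (W - D)"
      using x(1) a(1) by (simp add: minus_zero_right)
    have "w \<otimes> a \<noteq> \<zero>"
      using a(1,3) q(1) r wR by (auto simp: m_assoc)
    then obtain z where z: "z \<in> carrier R" "w \<otimes> a \<otimes> z = w"
      using simple_elemD(3)[OF W_simple[OF wW] a(1)] by blast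
    have "q \<otimes> r \<otimes> w = q \<otimes> r \<otimes> w \<otimes> a \<otimes> z"
      using z a(1) q(1) r wR by (simp add: m_assoc)
    then have "q \<otimes> r \<otimes> w \<in> soc (W - D)"
      using J(4)[OF mem z(1)] by simp
    then show False
      using soc_type[of "W - D" w "q \<otimes> r"] wW w q(1) r x(2) by auto
  qed
  show ?thesis
    by (rule that[OF p pp p_fix p_zero compl])
qed

end

section \<open>Counting the singular simple modules\<close>

text \<open>hR is a uniform right ideal with simple essential socle sR: every nonzero element of hR
  has s as a multiple.\<close>

definition uniform_idem :: "('a, 'm) ring_scheme \<Rightarrow> 'a \<Rightarrow> 'a \<Rightarrow> bool" where
  "uniform_idem R h s \<longleftrightarrow> h \<in> carrier R \<and> h \<otimes>\<^bsub>R\<^esub> h = h \<and> simple_elem R s \<and> h \<otimes>\<^bsub>R\<^esub> s = s \<and>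
     (\<forall>x\<in>carrier R. h \<otimes>\<^bsub>R\<^esub> x = x \<and> x \<noteq> \<zero>\<^bsub>R\<^esub> \<longrightarrow> (\<exists>a\<in>carrier R. x \<otimes>\<^bsub>R\<^esub> a = s))"

definition two_sided_ideal :: "('a, 'm) ring_scheme \<Rightarrow> 'a set \<Rightarrow> bool" where
  "two_sided_ideal R A \<longleftrightarrow> right_ideal R A \<and> (\<forall>x\<in>A. \<forall>r\<in>carrier R. r \<otimes>\<^bsub>R\<^esub> x \<in> A)"

lemma (in ring) uniform_idemD:
  assumes "uniform_idem R h s"
  shows "h \<in> carrier R" "h \<otimes> h = h" "simple_elem R s" "h \<otimes> s = s"
    and "\<And>x. \<lbrakk>x \<in> carrier R; h \<otimes> x = x; x \<noteq> \<zero>\<rbrakk> \<Longrightarrow> \<exists>a\<in>carrier R. x \<otimes> a = s"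
  using assms by (auto simp: uniform_idem_def)

lemma (in ring) uniform_idem_simple:
  assumes g: "g \<in> carrier R" "g \<otimes> g = g" "simple_elem R g"
  shows "uniform_idem R g g"
proof -
  have "\<exists>a\<in>carrier R. x \<otimes> a = g" if "x \<in> carrier R" "g \<otimes> x = x" "x \<noteq> \<zero>" for x
    using simple_elemD(3)[OF g(3), of x] that by simp
  then show ?thesis
    using g by (simp add: uniform_idem_def)
qed

lemma (in ring) two_sided_idealD:
  assumes "two_sided_ideal R A"
  shows "right_ideal R A" "\<And>x r. \<lbrakk>x \<in> A; r \<in> carrier R\<rbrakk> \<Longrightarrow> r \<otimes> x \<in> A"
  using assms by (auto simp: two_sided_ideal_def)

text \<open>Instead of W, take the set of its finite subsets, which has the same cardinality, and
  let \<open>D i\<close> consist of those containing i. The point A itself lies in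
  \<open>D i\<close> for all i in A and avoids all \<open>D j\<close> with j in B, even for infinite
  B.\<close>

lemma independent_family:
  assumes "infinite W"
  obtains D :: "'a \<Rightarrow> 'a set" where
    "\<And>A B. \<lbrakk>finite A; A \<subseteq> W; B \<inter> A = {}; B \<subseteq> W\<rbrakk> \<Longrightarrow>
      \<exists>w\<in>W. (\<forall>i\<in>A. w \<in> D i) \<and> (\<forall>j\<in>B. w \<notin> D j)"
    "\<And>i. D i \<subseteq> W"
proof -
  obtain \<phi> where \<phi>: "bij_betw \<phi> (Fpow W) W"
    using eqpoll_Fpow[OF assms] by (auto simp: eqpoll_def)
  define D where "D i = \<phi> ` {F \<in> Fpow W. i \<in> F}" for i
  show ?thesis
  proof (rule that)
    fix A B assume A: "finite A" "A \<subseteq> W" and B: "B \<inter> A = {}" "B \<subseteq> W"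
    then have AF: "A \<in> Fpow W"
      by (simp add: Fpow_def)
    have "\<phi> A \<notin> D j" if "j \<in> B" for j
    proof
      assume "\<phi> A \<in> D j"
      then obtain F where F: "F \<in> Fpow W" "j \<in> F" "\<phi> A = \<phi> F"
        by (auto simp: D_def)
      then have "A = F"
        using AF \<phi> by (auto simp: bij_betw_def dest: inj_onD)
      then show False
        using F(2) that B by blast
    qed
    moreover have "\<phi> A \<in> D i" if "i \<in> A" for i
      using AF that by (auto simp: D_def)
    moreover have "\<phi> A \<in> W"
      using AF \<phi> by (auto simp: bij_betw_def)
    ultimately show "\<exists>w\<in>W. (\<forall>i\<in>A. w \<in> D i) \<and> (\<forall>j\<in>B. w \<notin> D j)"
      by blast
  next
    show "D i \<subseteq> W" for i
      using \<phi> by (auto simp: D_def bij_betw_def)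
  qed
qed

section \<open>Simple quotients of eR attached to filters on W\<close>

context socle_hull
begin

text \<open>The simple quotient \<open>cR\<close> of \<open>eR\<close> is concentrated on \<open>E\<close>, in the way in which an
  ultrafilter is concentrated on each of its members.\<close>

definition kills :: "'a set \<Rightarrow> 'a \<Rightarrow> bool" where
  "kills E c \<longleftrightarrow> (\<forall>x\<in>carrier R. (\<forall>w\<in>E. \<forall>r\<in>carrier R. e \<otimes> (x \<otimes> (r \<otimes> w)) = \<zero>) \<longrightarrow> c \<otimes> x = \<zero>)"

lemma killsD:
  "\<lbrakk>kills E c; x \<in> carrier R; \<And>w r. \<lbrakk>w \<in> E; r \<in> carrier R\<rbrakk> \<Longrightarrow> e \<otimes> (x \<otimes> (r \<otimes> w)) = \<zero>\<rbrakk> \<Longrightarrow> c \<otimes> x = \<zero>"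
  by (simp add: kills_def)

lemma kills_mono: "\<lbrakk>kills E c; E \<subseteq> E'\<rbrakk> \<Longrightarrow> kills E' c"
  unfolding kills_def by (meson subsetD)

text \<open>A singular c is covered by completeness of W. For nonsingular c, left multiplication by
  c is injective on some yR, hence on eyR because ce = c. So cR is isomorphic to a submodule of eR
  and, by essentiality, to a simple part of its socle.\<close>

lemma simple_quotient_type:
  assumes c: "simple_elem R c" and ce: "c \<otimes> e = c"
  shows "\<exists>w\<in>W. iso_elem R c w"
proof (cases "singular_elem R c")
  case True
  then show ?thesis
    using W_complete c by blast
next
  case False
  note cR = simple_elemD(1)[OF c] and e = e_idem
  obtain y where y: "y \<in> carrier R" "y \<noteq> \<zero>"
    and inj: "\<And>a. \<lbrakk>a \<in> carrier R; c \<otimes> (y \<otimes> a) = \<zero>\<rbrakk> \<Longrightarrow> y \<otimes> a = \<zero>"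
    using False unfolding singular_elem_def by blast
  have ceq: "c \<otimes> (e \<otimes> (y \<otimes> a)) = c \<otimes> (y \<otimes> a)" if "a \<in> carrier R" for a
  proof -
    have "c \<otimes> (e \<otimes> (y \<otimes> a)) = (c \<otimes> e) \<otimes> (y \<otimes> a)"
      using cR e y(1) that by (simp add: m_assoc)
    then show ?thesis
      using ce by simp
  qed
  have "c \<otimes> y \<noteq> \<zero>"
    using inj[of \<one>] y by auto
  then have ey: "e \<otimes> y \<in> carrier R" "e \<otimes> (e \<otimes> y) = e \<otimes> y" "e \<otimes> y \<noteq> \<zero>"
    using ceq[of \<one>] y(1) e cR m_assoc[of e e y] by auto
  obtain a where a: "a \<in> carrier R" "e \<otimes> y \<otimes> a \<in> soc W" "e \<otimes> y \<otimes> a \<noteq> \<zero>"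
    using essential_in_idemD(4)[OF e_hull ey] by blast
  obtain b w where b: "b \<in> carrier R" "w \<in> W" "e \<otimes> y \<otimes> a \<otimes> b \<noteq> \<zero>" "iso_elem R w (e \<otimes> y \<otimes> a \<otimes> b)"
    by (rule rspan_simple_elems[OF W_simple a(2,3)])
  define z where "z = e \<otimes> y \<otimes> a \<otimes> b"
  have zR: "z \<in> carrier R" and z_eq: "z = e \<otimes> (y \<otimes> (a \<otimes> b))"
    using e y(1) a(1) b(1) by (simp_all add: z_def m_assoc)
  have cz: "c \<otimes> z \<noteq> \<zero>"
  proof
    assume "c \<otimes> z = \<zero>"
    then have "y \<otimes> (a \<otimes> b) = \<zero>"
      using inj[of "a \<otimes> b"] ceq[of "a \<otimes> b"] a(1) b(1) by (simp add: z_eq)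
    then show False
      using b(3) e(1) by (simp add: z_def[symmetric] z_eq)
  qed
  have wz: "iso_elem R w z"
    using b(4) by (simp add: z_def)
  have "same_ann R z (c \<otimes> z)"
    by (rule simple_elem_lmult[OF iso_elem_simple[OF W_simple[OF b(2)] zR wz] cR cz])
  then have "iso_elem R w (c \<otimes> z)"
    by (rule iso_elem_same_ann[OF wz])
  then have "iso_elem R (c \<otimes> z) w"
    using iso_elem_sym[OF W_simple[OF b(2)]] cR zR by simp
  then have "iso_elem R c w"
    using iso_elem_trans[OF cR _ iso_elem_rmult[OF cR zR cz]] cR zR by simp
  then show ?thesis
    using b(2) by blast
qed

text \<open>As for a reduced product, the elements that vanish on a finite intersection of members
  of the family form a right ideal. It is proper by the finite intersection property, so some simple
  c annihilates it.\<close>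

lemma simple_quotient_for_filter:
  assumes fip: "\<And>\<E>. \<lbrakk>finite \<E>; \<E> \<subseteq> \<F>\<rbrakk> \<Longrightarrow> \<exists>w\<in>W. \<forall>E\<in>\<E>. w \<in> E"
  obtains c where "simple_elem R c" "c \<otimes> e = c" "\<And>E. \<lbrakk>E \<in> \<F>; E \<subseteq> W\<rbrakk> \<Longrightarrow> kills E c"
proof -
  note e = e_idem
  \<comment> \<open>The zero set of x: the types that left multiplication by ex kills in all their
    copies.\<close>
  define Z where "Z x = {w \<in> W. \<forall>r\<in>carrier R. e \<otimes> (x \<otimes> (r \<otimes> w)) = \<zero>}" for x
  define K where "K = {x \<in> carrier R. \<exists>\<E>. finite \<E> \<and> \<E> \<subseteq> \<F> \<and> (\<forall>w\<in>W. (\<forall>E\<in>\<E>. w \<in> E) \<longrightarrow> w \<in> Z x)}"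
  have KI: "x \<in> K" if "x \<in> carrier R" "finite \<E>" "\<E> \<subseteq> \<F>" "\<And>w. \<lbrakk>w \<in> W; \<forall>E\<in>\<E>. w \<in> E\<rbrakk> \<Longrightarrow> w \<in> Z x" for x \<E>
    unfolding K_def using that by (intro CollectI conjI exI[of _ \<E>]) simp_all
  have KD: "x \<in> carrier R \<and> (\<exists>\<E>. finite \<E> \<and> \<E> \<subseteq> \<F> \<and> (\<forall>w. w \<in> W \<longrightarrow> (\<forall>E\<in>\<E>. w \<in> E) \<longrightarrow> w \<in> Z x))"
    if "x \<in> K" for x
    using that by (auto simp: K_def)
  have "right_ideal R K"
  proof (rule right_idealI)
    show "\<zero> \<in> K"
      by (rule KI[of _ "{}"]) (use W_carrier e in \<open>auto simp: Z_def\<close>)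
  next
    fix x y assume "x \<in> K" "y \<in> K"
    then obtain \<E> \<E>' where x: "x \<in> carrier R" "finite \<E>" "\<E> \<subseteq> \<F>"
      "\<forall>w. w \<in> W \<longrightarrow> (\<forall>E\<in>\<E>. w \<in> E) \<longrightarrow> w \<in> Z x"
      and y: "y \<in> carrier R" "finite \<E>'" "\<E>' \<subseteq> \<F>"
      "\<forall>w. w \<in> W \<longrightarrow> (\<forall>E\<in>\<E>'. w \<in> E) \<longrightarrow> w \<in> Z y"
      using KD[of x] KD[of y] by metis
    show "x \<oplus> y \<in> K"
    proof (rule KI[of _ "\<E> \<union> \<E>'"])
      fix w assume w: "w \<in> W" "\<forall>E\<in>\<E> \<union> \<E>'. w \<in> E"
      then have "w \<in> Z x" "w \<in> Z y"
        using x(4) y(4) by simp_all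
      then show "w \<in> Z (x \<oplus> y)"
        using x(1) y(1) W_carrier[OF w(1)] e by (simp add: Z_def l_distr r_distr)
    qed (use x y in auto)
  next
    fix x a assume "x \<in> K" and a: "a \<in> carrier R"
    then obtain \<E> where x: "x \<in> carrier R" "finite \<E>" "\<E> \<subseteq> \<F>"
      "\<forall>w. w \<in> W \<longrightarrow> (\<forall>E\<in>\<E>. w \<in> E) \<longrightarrow> w \<in> Z x"
      using KD[of x] by metis
    show "x \<otimes> a \<in> K"
    proof (rule KI[OF _ x(2,3)])
      fix w assume w: "w \<in> W" "\<forall>E\<in>\<E>. w \<in> E"
      have "e \<otimes> (x \<otimes> a \<otimes> (r \<otimes> w)) = e \<otimes> (x \<otimes> (a \<otimes> r \<otimes> w))" if "r \<in> carrier R" for r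
        using that x(1) a W_carrier[OF w(1)] by (simp add: m_assoc)
      then show "w \<in> Z (x \<otimes> a)"
        using x(4)[rule_format, OF w(1)] w a by (simp add: Z_def)
    qed (use x a in auto)
  qed (auto simp: K_def)
  moreover have "\<one> \<notin> K"
  proof
    assume "\<one> \<in> K"
    then obtain \<E> where E: "finite \<E>" "\<E> \<subseteq> \<F>" "\<forall>w. w \<in> W \<longrightarrow> (\<forall>E\<in>\<E>. w \<in> E) \<longrightarrow> w \<in> Z \<one>"
      using KD[of \<one>] by metis
    then obtain w where w: "w \<in> W" "w \<in> Z \<one>"
      using fip[OF E(1,2)] by metis
    then have "e \<otimes> (\<one> \<otimes> (\<one> \<otimes> w)) = \<zero>"
      unfolding Z_def by blast
    then show False
      using e_fixes[OF w(1)] W_carrier[OF w(1)] simple_elemD(2)[OF W_simple[OF w(1)]] by simp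
  qed
  ultimately obtain c where c: "simple_elem R c" "\<And>x. x \<in> K \<Longrightarrow> c \<otimes> x = \<zero>"
    by (rule proper_right_ideal_annihilated) (rule that)
  note cR = simple_elemD(1)[OF c(1)]
  \<comment> \<open>1 - e vanishes on all of W, so the empty subfamily suffices. Consequently ce =
    c, which makes cR a quotient of eR.\<close>
  have "\<one> \<ominus> e \<in> K"
  proof (rule KI[of _ "{}"])
    fix w assume w: "w \<in> W"
    have "e \<otimes> ((\<one> \<ominus> e) \<otimes> (r \<otimes> w)) = (e \<otimes> (\<one> \<ominus> e)) \<otimes> (r \<otimes> w)" if "r \<in> carrier R" for r
      using that e W_carrier[OF w] by (simp add: m_assoc)
    moreover have "e \<otimes> (\<one> \<ominus> e) = \<zero>"
      using e by (simp add: r_minus_distr minus_self)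
    ultimately show "w \<in> Z (\<one> \<ominus> e)"
      using w W_carrier by (simp add: Z_def)
  qed (use e in auto)
  then have "c \<otimes> (\<one> \<ominus> e) = \<zero>"
    by (rule c(2))
  then have ce: "c \<otimes> e = c"
    using cR e by (simp add: r_minus_distr minus_eq_zero_iff)
  have "kills E c" if E: "E \<in> \<F>" "E \<subseteq> W" for E
    unfolding kills_def
  proof (intro ballI impI)
    fix x assume x: "x \<in> carrier R" "\<forall>w\<in>E. \<forall>r\<in>carrier R. e \<otimes> (x \<otimes> (r \<otimes> w)) = \<zero>"
    have "x \<in> K"
      by (rule KI[of _ "{E}"]) (use E x in \<open>auto simp: Z_def\<close>)
    then show "c \<otimes> x = \<zero>"
      by (rule c(2))
  qed
  with that c(1) ce show ?thesis
    by blast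
qed

text \<open>Split eR into pR over D and qR over W - D. Then c factors through p and c' through q,
  and an isomorphism of the quotients would produce an endomorphism t that kills the socle while ct
  = c. Since e - t is invertible, c = 0.\<close>

lemma separated_not_iso:
  assumes D: "D \<subseteq> W" and c: "simple_elem R c" "c \<otimes> e = c" "kills D c"
    and c': "c' \<in> carrier R" "c' \<otimes> e = c'" "kills (W - D) c'"
  shows "\<not> iso_elem R c c'"
proof
  assume "iso_elem R c c'"
  then obtain x where x: "x \<in> carrier R" "c \<otimes> x \<noteq> \<zero>" "same_ann R (c \<otimes> x) c'"
    by (auto simp: iso_elem_def)
  obtain y where y: "y \<in> carrier R" "c \<otimes> x \<otimes> y = c"
    using simple_elemD(3)[OF c(1) x(1,2)] by blast
  note cR = simple_elemD(1)[OF c(1)] and e = e_idem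
  obtain p where p: "p \<in> carrier R" "e \<otimes> p = p" "p \<otimes> e = p"
    and zero: "\<And>w r. \<lbrakk>w \<in> W - D; r \<in> carrier R\<rbrakk> \<Longrightarrow> p \<otimes> (r \<otimes> w) = \<zero>"
    and compl: "\<And>w r. \<lbrakk>w \<in> D; r \<in> carrier R\<rbrakk> \<Longrightarrow> (e \<ominus> p) \<otimes> (r \<otimes> w) = \<zero>"
    by (rule socle_projection[OF D]) (rule that)
  define q where "q = e \<ominus> p"
  have q: "q \<in> carrier R"
    using e p by (simp add: q_def)
  have "c' \<otimes> p = \<zero>"
    by (rule killsD[OF c'(3) p(1)]) (simp add: zero e(1))
  then have c'q: "c' \<otimes> q = c'"
    using c' e p by (simp add: q_def r_minus_distr minus_zero_right)
  have "c \<otimes> q = \<zero>"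
    by (rule killsD[OF c(3) q]) (simp add: compl q_def e(1))
  then have cp: "c \<otimes> p = c"
    using c(2) cR e p by (simp add: q_def r_minus_distr minus_eq_zero_iff)
  \<comment> \<open>Since c' vanishes on p, replacing y by qy does not change c'y; through the
    isomorphism of cxR and c'R this gives c = cxqy.\<close>
  have "c' \<otimes> y = c' \<otimes> (q \<otimes> y)"
    using c'q c'(1) q y(1) by (simp add: m_assoc[symmetric])
  then have "c \<otimes> x \<otimes> (q \<otimes> y) = c"
    using same_ann_cancel[OF x(3) _ c'(1), of y "q \<otimes> y"] cR x(1) y q by simp
  \<comment> \<open>The path from pR to qR and back. It kills the whole socle: types outside D die
    under the first p, and types in D die under q, because yp only moves them to other
    copies.\<close>
  define t where "t = p \<otimes> (x \<otimes> (q \<otimes> (y \<otimes> p)))"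
  have t: "t \<in> carrier R" "e \<otimes> t = t" "t \<otimes> e = t"
    using p x(1) q y(1) e(1) by (simp_all add: t_def m_assoc) (simp add: m_assoc[symmetric])
  have "t \<otimes> w = \<zero>" if w: "w \<in> W" for w
  proof (cases "w \<in> D")
    case True
    have "q \<otimes> (y \<otimes> p \<otimes> w) = \<zero>"
      unfolding q_def using compl[OF True] y(1) p(1) by blast
    then show ?thesis
      using p x(1) q y(1) W_carrier[OF w] by (simp add: t_def m_assoc)
  next
    case False
    then have "p \<otimes> w = \<zero>"
      using zero[of w \<one>] w W_carrier[OF w] by simp
    then show ?thesis
      using p x(1) q y(1) W_carrier[OF w] by (simp add: t_def m_assoc)
  qed
  then obtain d where d: "d \<in> carrier R" "(e \<ominus> t) \<otimes> d = e"
    using hull_invertible[OF t] by blast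
  have "c \<otimes> t = (c \<otimes> p) \<otimes> (x \<otimes> (q \<otimes> (y \<otimes> p)))"
    using cR p(1) x(1) q y(1) by (simp add: t_def m_assoc)
  also have "\<dots> = (c \<otimes> x \<otimes> (q \<otimes> y)) \<otimes> p"
    unfolding cp using cR p(1) x(1) q y(1) by (simp add: m_assoc)
  also have "\<dots> = c"
    using \<open>c \<otimes> x \<otimes> (q \<otimes> y) = c\<close> cp by simp
  finally have "c \<otimes> (e \<ominus> t) = \<zero>"
    using c(2) cR e(1) t(1) by (simp add: r_minus_distr minus_self)
  moreover have "c \<otimes> (e \<ominus> t) \<otimes> d = c \<otimes> ((e \<ominus> t) \<otimes> d)"
    using cR e(1) t(1) d(1) by (intro m_assoc) auto
  ultimately have "c = \<zero>"
    using d c(2) by simp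
  then show False
    using simple_elemD(2)[OF c(1)] by blast
qed

lemma separated_types_distinct:
  assumes D: "D \<subseteq> W" and c: "simple_elem R c" "c \<otimes> e = c" "kills D c" "iso_elem R c w"
    and c': "simple_elem R c'" "c' \<otimes> e = c'" "kills (W - D) c'" "iso_elem R c' w'"
    and w: "w \<in> W" "w' \<in> W"
  shows "w \<noteq> w'"
proof
  assume "w = w'"
  note cR = simple_elemD(1)[OF c(1)] simple_elemD(1)[OF c'(1)] W_carrier[OF w(2)]
  have "iso_elem R w' c'"
    by (rule iso_elem_sym[OF c'(1) cR(3) c'(4)])
  then have "iso_elem R c c'"
    using iso_elem_trans[OF cR(1,3)] c(4) \<open>w = w'\<close> by blast
  then show False
    using separated_not_iso[OF D c(1-3) cR(2) c'(2,3)] by blast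
qed

text \<open>The contradiction is Cantor's theorem: the types of the quotients attached to subsets Z
  would inject \<open>Pow W\<close> into W.\<close>

lemma finite_W: "finite W"
proof (rule ccontr)
  assume "infinite W"
  then obtain D :: "'a \<Rightarrow> 'a set" where
    ind: "\<And>A B. \<lbrakk>finite A; A \<subseteq> W; B \<inter> A = {}; B \<subseteq> W\<rbrakk> \<Longrightarrow>
      \<exists>w\<in>W. (\<forall>i\<in>A. w \<in> D i) \<and> (\<forall>j\<in>B. w \<notin> D j)"
    and DW: "\<And>i. D i \<subseteq> W"
    by (rule independent_family) (rule that)
  define P where "P Z c w \<longleftrightarrow> simple_elem R c \<and> c \<otimes> e = c \<and> w \<in> W \<and> iso_elem R c w \<and>
    (\<forall>i\<in>Z. kills (D i) c) \<and> (\<forall>j\<in>W - Z. kills (W - D j) c)" for Z c w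
  have "\<exists>c w. P Z c w" if Z: "Z \<subseteq> W" for Z
  proof -
    let ?F = "D ` Z \<union> (\<lambda>j. W - D j) ` (W - Z)"
    have fip: "\<exists>w\<in>W. \<forall>E\<in>\<E>. w \<in> E" if E: "finite \<E>" "\<E> \<subseteq> ?F" for \<E>
    proof -
      \<comment> \<open>Only finitely many members of the form \<open>D i\<close> occur; the
        complements, possibly infinitely many, are all met at once because B may be infinite in the
        independence property.\<close>
      have "finite (\<E> \<inter> D ` Z)"
        using E(1) by blast
      then obtain A where A: "A \<subseteq> Z" "finite A" "\<E> \<inter> D ` Z = D ` A"
        by (meson finite_subset_image inf_le2)
      obtain w where w: "w \<in> W" "\<forall>i\<in>A. w \<in> D i" "\<forall>j\<in>W - Z. w \<notin> D j"
        using ind[of A "W - Z"] A(1,2) Z by blast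
      have "w \<in> E" if "E \<in> \<E>" for E
      proof (cases "E \<in> D ` Z")
        case True
        then show ?thesis
          using that A(3) w(2) by blast
      next
        case False
        then show ?thesis
          using that E(2) w(1,3) by blast
      qed
      then show ?thesis
        using w(1) by blast
    qed
    obtain c where c: "simple_elem R c" "c \<otimes> e = c" "\<And>E. \<lbrakk>E \<in> ?F; E \<subseteq> W\<rbrakk> \<Longrightarrow> kills E c"
      by (rule simple_quotient_for_filter[of ?F]) (erule (1) fip, rule that)
    obtain w where "w \<in> W" "iso_elem R c w"
      using simple_quotient_type[OF c(1,2)] by blast
    then have "P Z c w"
      using c DW unfolding P_def by blast
    then show ?thesis
      by blast
  qed
  then obtain \<kappa> \<gamma> where P: "\<And>Z. Z \<subseteq> W \<Longrightarrow> P Z (\<gamma> Z) (\<kappa> Z)"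
    by metis
  have "\<kappa> Z \<noteq> \<kappa> Z'" if Z: "Z \<subseteq> W" "Z' \<subseteq> W" "i \<in> Z" "i \<notin> Z'" for Z Z' i
  proof -
    note PZ = P[OF Z(1), unfolded P_def] and PZ' = P[OF Z(2), unfolded P_def]
    have "kills (D i) (\<gamma> Z)" "kills (W - D i) (\<gamma> Z')"
      using PZ PZ' Z by auto
    then show ?thesis
      using PZ PZ' separated_types_distinct[OF DW, of "\<gamma> Z" i "\<kappa> Z" "\<gamma> Z'" "\<kappa> Z'"] by simp
  qed
  then have eq: "Z = Z'" if "Z \<subseteq> W" "Z' \<subseteq> W" "\<kappa> Z = \<kappa> Z'" for Z Z'
    using that by (metis subsetI subset_antisym)
  have "inj_on \<kappa> (Pow W)"
    by (rule inj_onI, rule eq) simp_all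
  moreover have "\<kappa> ` Pow W \<subseteq> W"
    using P by (auto simp: P_def)
  ultimately have "Pow W \<lesssim> W"
    by (auto simp: lepoll_def)
  then show False
    using lesspoll_Pow_self[of W] lepoll_antisym[of W "Pow W"] by (simp add: lesspoll_def)
qed

text \<open>The quotient attached to the principal filter at i has some type \<kappa> i, in general
  different from i. Singletons separate, so \<kappa> is injective on the finite set W and hence
  onto; it is the analogue of the Nakayama permutation.\<close>

lemma simple_quotient_surj:
  assumes "w \<in> W"
  obtains c where "simple_elem R c" "c \<otimes> e = c" "iso_elem R c w"
proof -
  define P where "P i c v \<longleftrightarrow> simple_elem R c \<and> c \<otimes> e = c \<and> v \<in> W \<and> iso_elem R c v \<and> kills {i} c" for i c v
  have "\<exists>c v. P i c v" if i: "i \<in> W" for i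
  proof -
    have fip: "\<exists>w\<in>W. \<forall>E\<in>\<E>. w \<in> E" if "finite \<E>" "\<E> \<subseteq> {{i}}" for \<E>
      using that i by blast
    obtain c where c: "simple_elem R c" "c \<otimes> e = c" "\<And>E. \<lbrakk>E \<in> {{i}}; E \<subseteq> W\<rbrakk> \<Longrightarrow> kills E c"
      by (rule simple_quotient_for_filter[of "{{i}}"]) (erule (1) fip, rule that)
    obtain v where "v \<in> W" "iso_elem R c v"
      using simple_quotient_type[OF c(1,2)] by blast
    then have "P i c v"
      using c i unfolding P_def by blast
    then show ?thesis
      by blast
  qed
  then obtain \<kappa> \<gamma> where P: "\<And>i. i \<in> W \<Longrightarrow> P i (\<gamma> i) (\<kappa> i)"
    by metis
  have "\<kappa> i \<noteq> \<kappa> j" if ij: "i \<in> W" "j \<in> W" "i \<noteq> j" for i j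
  proof -
    note props_i = P[OF ij(1), unfolded P_def] and props_j = P[OF ij(2), unfolded P_def]
    have "kills (W - {i}) (\<gamma> j)"
      using props_j kills_mono[of "{j}" "\<gamma> j" "W - {i}"] ij by simp
    then show ?thesis
      using props_i props_j separated_types_distinct[of "{i}" "\<gamma> i" "\<kappa> i" "\<gamma> j" "\<kappa> j"] ij(1) by simp
  qed
  then have "inj_on \<kappa> W"
    unfolding inj_on_def by blast
  moreover have "\<kappa> ` W \<subseteq> W"
    using P by (auto simp: P_def)
  ultimately have "\<kappa> ` W = W"
    by (rule endo_inj_surj[OF finite_W, rotated])
  then obtain i where "i \<in> W" "w = \<kappa> i"
    using assms by blast
  then show ?thesis
    using P[of i] that unfolding P_def by blast
qed

section \<open>Generation by uniform right ideals and Baer's criterion\<close>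

lemma uniform_projection:
  assumes w: "w \<in> W"
  obtains p where "p \<in> carrier R" "e \<otimes> p = p" "p \<otimes> e = p" "uniform_idem R p w"
    "\<And>v. \<lbrakk>v \<in> W; v \<noteq> w\<rbrakk> \<Longrightarrow> p \<otimes> v = \<zero>"
proof -
  have wR: "w \<in> carrier R"
    using w by (rule W_carrier)
  have "{w} \<subseteq> W"
    using w by simp
  then obtain p where p: "p \<in> carrier R" "e \<otimes> p = p" "p \<otimes> e = p" "p \<otimes> p = p"
    and pw: "\<And>v. v \<in> {w} \<Longrightarrow> p \<otimes> v = v"
    and zero: "\<And>v r. \<lbrakk>v \<in> W - {w}; r \<in> carrier R\<rbrakk> \<Longrightarrow> p \<otimes> (r \<otimes> v) = \<zero>"
    by (rule socle_projection) (rule that)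
  have zero': "p \<otimes> v = \<zero>" if "v \<in> W" "v \<noteq> w" for v
    using zero[of v \<one>] that W_carrier[of v] by simp
  \<comment> \<open>The elements that p maps into wR. All of W is among them, so the part of the
    socle inside pR is contained in wR.\<close>
  let ?J = "{n \<in> carrier R. \<exists>b\<in>carrier R. p \<otimes> n = w \<otimes> b}"
  have J: "right_ideal R ?J"
  proof (rule right_idealI)
    show "\<zero> \<in> ?J"
      using p(1) wR by (auto intro!: bexI[of _ \<zero>])
  next
    fix x y assume "x \<in> ?J" "y \<in> ?J"
    then obtain b c where "x \<in> carrier R" "y \<in> carrier R" "b \<in> carrier R" "c \<in> carrier R"
      "p \<otimes> x = w \<otimes> b" "p \<otimes> y = w \<otimes> c" by blast
    then show "x \<oplus> y \<in> ?J"
      using p(1) wR by (auto simp: r_distr intro!: bexI[of _ "b \<oplus> c"])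
  next
    fix x a assume "x \<in> ?J" and a: "a \<in> carrier R"
    then obtain b where b: "x \<in> carrier R" "b \<in> carrier R" "p \<otimes> x = w \<otimes> b" by blast
    then have "p \<otimes> (x \<otimes> a) = w \<otimes> (b \<otimes> a)"
      using p(1) wR a by (simp add: m_assoc[symmetric])
    then show "x \<otimes> a \<in> ?J"
      using b a by auto
  qed auto
  have "v \<in> ?J" if v: "v \<in> W" for v
  proof (cases "v = w")
    case True
    then show ?thesis
      using wR pw by (auto intro!: bexI[of _ \<one>])
  next
    case False
    then show ?thesis
      using zero' v W_carrier wR by (auto intro!: bexI[of _ \<zero>])
  qed
  then have "W \<subseteq> ?J"
    by (rule subsetI)
  then have socJ: "soc W \<subseteq> ?J"
    by (rule rspan_minimal[OF J])
  have "\<exists>a\<in>carrier R. x \<otimes> a = w" if x: "x \<in> carrier R" "p \<otimes> x = x" "x \<noteq> \<zero>" for x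
  proof -
    have "e \<otimes> x = e \<otimes> (p \<otimes> x)"
      using x(2) by simp
    also have "\<dots> = (e \<otimes> p) \<otimes> x"
      using p(1) e_idem(1) x(1) by (intro m_assoc[symmetric])
    finally have "e \<otimes> x = x"
      using x(2) p(2) by simp
    then obtain a where a: "a \<in> carrier R" "x \<otimes> a \<in> soc W" "x \<otimes> a \<noteq> \<zero>"
      using essential_in_idemD(4)[OF e_hull x(1) _ x(3)] by blast
    have "p \<otimes> (x \<otimes> a) = x \<otimes> a"
      using x p(1) a(1) by (simp add: m_assoc[symmetric])
    then obtain b where b: "b \<in> carrier R" "x \<otimes> a = w \<otimes> b"
      using subsetD[OF socJ a(2)] by auto
    then obtain z where z: "z \<in> carrier R" "w \<otimes> b \<otimes> z = w"
      using simple_elemD(3)[OF W_simple[OF w] b(1)] a(3) by auto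
    then have "x \<otimes> (a \<otimes> z) = w"
      using b x(1) a(1) by (simp add: m_assoc[symmetric])
    then show ?thesis
      using a(1) z(1) by blast
  qed
  then have "uniform_idem R p w"
    using p(1,4) pw W_simple[OF w] by (simp add: uniform_idem_def)
  then show ?thesis
    using that[OF p(1-3)] zero' by blast
qed

text \<open>Two kinds of building blocks: hulls of singular simple types, with s in W, and simple
  projective right ideals, which are their own socle, so that s = h.\<close>

definition generator :: "'a \<Rightarrow> 'a \<Rightarrow> bool" where
  "generator h s \<longleftrightarrow> uniform_idem R h s \<and> (s \<in> W \<or> s = h)"

text \<open>The right ideals hR generate R in the sense of trace ideals. First e lies in A;
  otherwise-annihilating simple c are then excluded, the singular ones as quotients of eR and the
  others through an idempotent g with cg = c.\<close>

lemma generators_generate: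
  assumes A: "two_sided_ideal R A" and gen: "\<And>h s. generator h s \<Longrightarrow> h \<in> A"
  shows "\<one> \<in> A"
proof (rule ccontr)
  note AI = right_idealD[OF two_sided_idealD(1)[OF A]] and e = e_idem
  \<comment> \<open>The sum of the projections for the types in D. They are chosen separately, so
    the sum need not be idempotent; it only agrees with the identity on the socle elements, which is
    enough to invert it in the corner.\<close>
  have "\<exists>x\<in>A. e \<otimes> x = x \<and> x \<otimes> e = x \<and> (\<forall>w\<in>D. x \<otimes> w = w) \<and> (\<forall>w\<in>W - D. x \<otimes> w = \<zero>)"
    if "finite D" "D \<subseteq> W" for D
    using that
  proof (induction D)
    case empty
    show ?case
      by (rule bexI[OF _ AI(2)]) (use W_carrier e in auto)
  next
    case (insert v D)
    then obtain x where x: "x \<in> A" "e \<otimes> x = x" "x \<otimes> e = x"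
      "\<And>w. w \<in> D \<Longrightarrow> x \<otimes> w = w" "\<And>w. \<lbrakk>w \<in> W; w \<notin> D\<rbrakk> \<Longrightarrow> x \<otimes> w = \<zero>"
      by auto
    have v: "v \<in> W"
      using insert.prems by simp
    obtain p where p: "p \<in> carrier R" "e \<otimes> p = p" "p \<otimes> e = p" "uniform_idem R p v"
      "\<And>w. \<lbrakk>w \<in> W; w \<noteq> v\<rbrakk> \<Longrightarrow> p \<otimes> w = \<zero>"
      by (rule uniform_projection[OF v]) (rule that)
    have xR: "x \<in> carrier R" and pv: "p \<otimes> v = v"
      using AI(5)[OF x(1)] uniform_idemD(4)[OF p(4)] .
    have "p \<in> A"
      using gen[of p v] p(4) v by (simp add: generator_def)
    then have "x \<oplus> p \<in> A"
      using x(1) AI(3) by blast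
    moreover have "e \<otimes> (x \<oplus> p) = x \<oplus> p" "(x \<oplus> p) \<otimes> e = x \<oplus> p"
      using x(2,3) p(1-3) xR e(1) by (simp_all add: r_distr l_distr)
    moreover have "(x \<oplus> p) \<otimes> w = w" if w: "w \<in> insert v D" for w
    proof (cases "w = v")
      case True
      then show ?thesis
        using x(5)[OF v insert.hyps(2)] pv W_carrier[OF v] xR p(1) by (simp add: l_distr)
    next
      case False
      then have "w \<in> D" "w \<in> W"
        using w insert.prems by auto
      then show ?thesis
        using x(4) p(5)[of w] False W_carrier[of w] xR p(1) by (simp add: l_distr)
    qed
    moreover have "(x \<oplus> p) \<otimes> w = \<zero>" if w: "w \<in> W - insert v D" for w
      using x(5)[of w] p(5)[of w] w W_carrier[of w] xR p(1) by (simp add: l_distr)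
    ultimately show ?case
      by blast
  qed
  from this[OF finite_W subset_refl] obtain x where x: "x \<in> A" "e \<otimes> x = x" "x \<otimes> e = x"
    "\<And>w. w \<in> W \<Longrightarrow> x \<otimes> w = w" by blast
  have xR: "x \<in> carrier R"
    using AI(5)[OF x(1)] .
  have "(e \<ominus> x) \<otimes> w = \<zero>" if "w \<in> W" for w
    using x(4)[OF that] e_fixes[OF that] W_carrier[OF that] e(1) xR by (simp add: l_minus_distr minus_self)
  moreover have "e \<ominus> x \<in> carrier R" "e \<otimes> (e \<ominus> x) = e \<ominus> x" "(e \<ominus> x) \<otimes> e = e \<ominus> x"
    using x(2,3) xR e by (simp_all add: r_minus_distr l_minus_distr)
  ultimately obtain d where d: "d \<in> carrier R" "d \<otimes> (e \<ominus> (e \<ominus> x)) = e"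
    using hull_invertible[of "e \<ominus> x"] by blast
  have "e \<ominus> (e \<ominus> x) = x"
    using xR e(1) by (simp add: a_minus_def minus_add r_neg1 r_neg2)
  then have eA: "e \<in> A"
    using d two_sided_idealD(2)[OF A x(1) d(1)] by simp
  assume "\<one> \<notin> A"
  then obtain c where c: "simple_elem R c" and cA: "\<And>x. x \<in> A \<Longrightarrow> c \<otimes> x = \<zero>"
    using proper_right_ideal_annihilated[OF two_sided_idealD(1)[OF A]] by blast
  note cR = simple_elemD(1,2)[OF c]
  show False
  proof (cases "singular_elem R c")
    case True
    then obtain w where w: "w \<in> W" "iso_elem R c w"
      using W_complete c by blast
    obtain f where f: "simple_elem R f" "f \<otimes> e = f" "iso_elem R f w"
      by (rule simple_quotient_surj[OF w(1)])
    note fR = simple_elemD(1)[OF f(1)]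
    have "iso_elem R w c"
      by (rule iso_elem_sym[OF c W_carrier[OF w(1)] w(2)])
    then have "iso_elem R f c"
      by (rule iso_elem_trans[OF fR W_carrier[OF w(1)] f(3)])
    then obtain x where x: "x \<in> carrier R" "f \<otimes> x \<noteq> \<zero>" "same_ann R (f \<otimes> x) c"
      by (auto simp: iso_elem_def)
    obtain y where y: "y \<in> carrier R" "f \<otimes> x \<otimes> y = f"
      using simple_elemD(3)[OF f(1) x(1,2)] by blast
    \<comment> \<open>The goal is cy = cye, by transport of f = fe along the isomorphism. As ye lies
      in A, this gives cy = 0 and hence f = fxy = 0.\<close>
    have "f \<otimes> x \<otimes> (y \<otimes> e) = (f \<otimes> x \<otimes> y) \<otimes> e"
      using fR x(1) y(1) e(1) by (simp add: m_assoc)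
    then have "f \<otimes> x \<otimes> (y \<otimes> e) = f \<otimes> x \<otimes> y"
      using y(2) f(2) by simp
    then have "c \<otimes> (y \<otimes> e) = c \<otimes> y"
      using same_ann_cancel[OF x(3) _ cR(1), of "y \<otimes> e" y] fR x(1) y(1) e(1) by simp
    moreover have "y \<otimes> e \<in> A"
      by (rule two_sided_idealD(2)[OF A eA y(1)])
    ultimately have "c \<otimes> y = \<zero>"
      using cA by simp
    then have "f = \<zero>"
      using same_annD[OF x(3) y(1)] y(2) by simp
    then show False
      using simple_elemD(2)[OF f(1)] by blast
  next
    case False
    then obtain g where g: "g \<in> carrier R" "g \<otimes> g = g" "simple_elem R g" "c \<otimes> g = c"
      by (rule nonsingular_simple_elem[OF c])
    then have "generator g g"
      using uniform_idem_simple by (simp add: generator_def)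
    then show False
      using cA[OF gen] g(4) cR(2) by simp
  qed
qed

text \<open>Each q = hq is a map from R to hR, so Q embeds R in a finite sum of uniform right
  ideals. The trace argument is applied to the b whose annihilator contains that of some such finite
  set.\<close>

lemma finite_cogenerators:
  obtains Q where "finite Q" "Q \<subseteq> carrier R" "\<And>q. q \<in> Q \<Longrightarrow> \<exists>h s. generator h s \<and> h \<otimes> q = q"
    "\<And>x. \<lbrakk>x \<in> carrier R; \<forall>q\<in>Q. q \<otimes> x = \<zero>\<rbrakk> \<Longrightarrow> x = \<zero>"
proof -
  define C where "C Q \<longleftrightarrow> finite Q \<and> Q \<subseteq> carrier R \<and> (\<forall>q\<in>Q. \<exists>h s. generator h s \<and> h \<otimes> q = q)" for Q
  define A where "A = {b \<in> carrier R. \<exists>Q. C Q \<and> (\<forall>x\<in>carrier R. (\<forall>q\<in>Q. q \<otimes> x = \<zero>) \<longrightarrow> b \<otimes> x = \<zero>)}"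
  have genR: "h \<in> carrier R" "h \<otimes> h = h" if "generator h s" for h s
    using that uniform_idemD(1,2) by (auto simp: generator_def)
  have "right_ideal R A"
  proof (rule right_idealI)
    show "\<zero> \<in> A"
      by (auto simp: A_def C_def intro!: exI[of _ "{}"])
  next
    fix x y assume "x \<in> A" "y \<in> A"
    then obtain Q Q' where *: "x \<in> carrier R" "y \<in> carrier R" "C Q" "C Q'"
      "\<forall>z\<in>carrier R. (\<forall>q\<in>Q. q \<otimes> z = \<zero>) \<longrightarrow> x \<otimes> z = \<zero>"
      "\<forall>z\<in>carrier R. (\<forall>q\<in>Q'. q \<otimes> z = \<zero>) \<longrightarrow> y \<otimes> z = \<zero>"
      by (auto simp: A_def)
    have "C (Q \<union> Q')"
      using *(3,4) by (auto simp: C_def)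
    moreover have "\<forall>z\<in>carrier R. (\<forall>q\<in>Q \<union> Q'. q \<otimes> z = \<zero>) \<longrightarrow> (x \<oplus> y) \<otimes> z = \<zero>"
      using *(1,2,5,6) by (simp add: l_distr)
    ultimately show "x \<oplus> y \<in> A"
      using *(1,2) by (auto simp: A_def)
  next
    fix x a assume "x \<in> A" and a: "a \<in> carrier R"
    then obtain Q where x: "x \<in> carrier R" "C Q"
      "\<forall>z\<in>carrier R. (\<forall>q\<in>Q. q \<otimes> z = \<zero>) \<longrightarrow> x \<otimes> z = \<zero>"
      by (auto simp: A_def)
    have QR: "q \<in> carrier R" if "q \<in> Q" for q
      using that x(2) by (auto simp: C_def)
    have "C ((\<lambda>q. q \<otimes> a) ` Q)"
      unfolding C_def
    proof (intro conjI ballI)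
      fix q' assume "q' \<in> (\<lambda>q. q \<otimes> a) ` Q"
      then obtain q where q: "q \<in> Q" "q' = q \<otimes> a" by blast
      then obtain h s where h: "generator h s" "h \<otimes> q = q"
        using x(2) by (auto simp: C_def)
      then have "h \<otimes> q' = q'"
        using genR[OF h(1)] QR[OF q(1)] a q(2) by (simp add: m_assoc[symmetric])
      then show "\<exists>h s. generator h s \<and> h \<otimes> q' = q'"
        using h(1) by blast
    qed (use x(2) QR a in \<open>auto simp: C_def\<close>)
    moreover have "\<forall>z\<in>carrier R. (\<forall>q\<in>(\<lambda>q. q \<otimes> a) ` Q. q \<otimes> z = \<zero>) \<longrightarrow> x \<otimes> a \<otimes> z = \<zero>"
      using x(1,3) QR a by (simp add: m_assoc)
    ultimately show "x \<otimes> a \<in> A"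
      using x(1) a by (auto simp: A_def)
  qed (auto simp: A_def)
  moreover have "r \<otimes> x \<in> A" if "x \<in> A" "r \<in> carrier R" for x r
    using that by (auto simp: A_def m_assoc)
  ultimately have "two_sided_ideal R A"
    by (simp add: two_sided_ideal_def)
  moreover have "h \<in> A" if "generator h s" for h s
    using that genR[OF that] by (auto simp: A_def C_def intro!: exI[of _ "{h}"])
  ultimately have "\<one> \<in> A"
    by (rule generators_generate)
  then obtain Q where "C Q" "\<forall>x\<in>carrier R. (\<forall>q\<in>Q. q \<otimes> x = \<zero>) \<longrightarrow> \<one> \<otimes> x = \<zero>"
    by (auto simp: A_def)
  then show ?thesis
    using that[of Q] by (simp add: C_def)
qed

text \<open>As bs is nonzero, b is injective on hR; the claim is that this embedding of hR into R
  splits. Some q moves bs into a block h'R without killing it, and the socles s and s' must then be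
  isomorphic.\<close>

lemma generator_split:
  assumes gen: "generator h s" and b: "b \<in> carrier R" "b \<otimes> s \<noteq> \<zero>"
  obtains d where "d \<in> carrier R" "d \<otimes> (b \<otimes> h) = h"
proof -
  have h: "uniform_idem R h s"
    using gen by (simp add: generator_def)
  note hD = uniform_idemD[OF h] and sR = simple_elemD(1,2)[OF uniform_idemD(3)[OF h]]
  obtain Q where Q: "Q \<subseteq> carrier R" "\<And>q. q \<in> Q \<Longrightarrow> \<exists>h s. generator h s \<and> h \<otimes> q = q"
    "\<And>x. \<lbrakk>x \<in> carrier R; \<forall>q\<in>Q. q \<otimes> x = \<zero>\<rbrakk> \<Longrightarrow> x = \<zero>"
    by (rule finite_cogenerators) (rule that)
  obtain q where q: "q \<in> Q" "q \<otimes> (b \<otimes> s) \<noteq> \<zero>"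
    using Q(3)[of "b \<otimes> s"] b sR(1) by blast
  obtain h' s' where gen': "generator h' s'" and h'q: "h' \<otimes> q = q"
    using Q(2)[OF q(1)] by blast
  have h': "uniform_idem R h' s'"
    using gen' by (simp add: generator_def)
  note h'D = uniform_idemD[OF h'] and s'R = simple_elemD(1,2)[OF uniform_idemD(3)[OF h']]
  have qR: "q \<in> carrier R"
    using q(1) Q(1) by blast
  define x where "x = q \<otimes> (b \<otimes> s)"
  have x: "x \<in> carrier R" "x \<noteq> \<zero>" and x_eq: "x = (q \<otimes> b) \<otimes> s"
    using q(2) qR b(1) sR(1) by (simp_all add: x_def m_assoc)
  have "h' \<otimes> x = (h' \<otimes> q) \<otimes> (b \<otimes> s)"
    using qR b(1) sR(1) h'D(1) by (simp add: x_def m_assoc)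
  then have "h' \<otimes> x = x"
    using h'q by (simp add: x_def)
  then obtain a where a: "a \<in> carrier R" "x \<otimes> a = s'"
    using h'D(5) x by blast
  have sx: "same_ann R s x"
    unfolding x_eq by (rule simple_elem_lmult[OF hD(3)]) (use qR b(1) x(2) x_eq in auto)
  then have "iso_elem R s x"
    by (rule iso_elem_same_ann[OF iso_elem_refl[OF hD(3)]])
  moreover have "iso_elem R x s'"
    using iso_elem_rmult[OF x(1) a(1)] a(2) s'R(2) by simp
  ultimately have iso: "iso_elem R s s'"
    by (rule iso_elem_trans[OF sR(1) x(1)])
  consider "s \<in> W" "s' \<in> W" | "s \<in> W" "s' = h'" | "s = h" "s' \<in> W" | "s = h" "s' = h'"
    using gen gen' by (auto simp: generator_def)
  then show ?thesis
  proof cases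
    case 1
    then have "s' = s"
      using W_unique[OF _ _ iso] by simp
    then obtain z where z: "z \<in> carrier R" "x \<otimes> a \<otimes> z = x"
      using simple_elemD(3)[OF simple_elem_same_ann[OF hD(3) x(1) sx] a(1)] a(2) sR(2) by auto
    \<comment> \<open>x is a multiple of s, hence lies in hR. So one can return to h itself; h and
      h' may differ although their socles have the same type.\<close>
    then have "h \<otimes> x = x"
      using a(2) \<open>s' = s\<close> hD(1,4) sR(1) m_assoc[OF hD(1) sR(1) z(1)] by simp
    define t where "t = h \<otimes> (q \<otimes> (b \<otimes> h))"
    have t: "t \<in> carrier R" "h \<otimes> t = t" "t \<otimes> h = t"
      using hD(1,2) qR b(1) by (simp_all add: t_def m_assoc) (simp add: m_assoc[symmetric])
    have ts: "t \<otimes> s = x"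
      using hD(1,4) qR b(1) sR(1) \<open>h \<otimes> x = x\<close> by (simp add: t_def x_def m_assoc)
    have "y = \<zero>" if y: "y \<in> carrier R" "h \<otimes> y = y" "t \<otimes> y = \<zero>" for y
    proof (rule ccontr)
      assume "y \<noteq> \<zero>"
      then obtain c where c: "c \<in> carrier R" "y \<otimes> c = s"
        using hD(5) y by blast
      then have "x = t \<otimes> y \<otimes> c"
        using ts t(1) y(1) by (simp add: m_assoc)
      then show False
        using y(3) c(1) x(2) by simp
    qed
    then obtain d where d: "d \<in> carrier R" "d \<otimes> t = h"
      using corner_left_inverse[OF hD(1,2) t] by blast
    show ?thesis
      by (rule that[of "d \<otimes> (h \<otimes> q)"])
        (use d hD(1) qR b(1) in \<open>simp_all add: t_def m_assoc\<close>)
  next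
    \<comment> \<open>A nonzero idempotent would be singular, which is impossible. The third case is
      symmetric.\<close>
    case 2
    then show ?thesis
      using iso_elem_singular[OF W_singular sR(1) iso] idempotent_not_singular[OF h'D(1,2)] s'R(2)
      by simp
  next
    case 3
    then show ?thesis
      using iso_elem_singular[OF W_singular s'R(1) iso_elem_sym[OF hD(3) s'R(1) iso]]
        idempotent_not_singular[OF hD(1,2)] sR(2) by simp
  next
    \<comment> \<open>Here xa = h', so ax fixes x under left multiplication by x; equality of
      annihilators carries this over to h.\<close>
    case 4
    have "x \<otimes> (a \<otimes> x) = h' \<otimes> x"
      using a 4 x(1) by (simp add: m_assoc[symmetric])
    then have "x \<otimes> (a \<otimes> x) = x \<otimes> \<one>"
      using \<open>h' \<otimes> x = x\<close> x(1) by simp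
    then have "h \<otimes> (a \<otimes> x) = h \<otimes> \<one>"
      using same_ann_cancel[OF sx sR(1) x(1), of "a \<otimes> x" \<one>] a(1) x(1) 4 by simp
    then show ?thesis
      using that[of "h \<otimes> (a \<otimes> q)"] hD(1) a(1) qR b(1) 4 by (simp add: x_def m_assoc)
  qed
qed

text \<open>Baer's condition, by the trace argument. For a block h the graph of hf is cut out by
  equations ax + by = 0; one of them has bs nonzero, and splitting b on hR solves it for hf.\<close>

lemma right_ideal_hom_left_mult:
  assumes I: "right_ideal R I"
    and f: "f \<in> rmodule_hom R (regular_rmodule R\<lparr>carrier := I\<rparr>) (regular_rmodule R)"
  shows "\<exists>a\<in>carrier R. \<forall>x\<in>I. f x = a \<otimes> x"
proof -
  let ?M = "regular_rmodule R"
  let ?H = "rmodule_hom R (?M\<lparr>carrier := I\<rparr>) ?M"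
  interpret P: right_module R "prod_rmodule ?M ?M"
    by (intro prod_right_module regular_right_module)
  note ID = right_idealD[OF I]
  \<comment> \<open>All f are quantified inside A: closure under right multiplication by r replaces
    f by its composite with left multiplication by r.\<close>
  define A where "A = {b \<in> carrier R. \<forall>f\<in>?H. \<exists>a\<in>carrier R. \<forall>x\<in>I. b \<otimes> f x = a \<otimes> x}"
  have AD: "\<exists>a\<in>carrier R. \<forall>x\<in>I. b \<otimes> f x = a \<otimes> x" if "b \<in> A" "f \<in> ?H" for b f
    using that unfolding A_def by simp
  have H: "f x \<in> carrier R" if "f \<in> ?H" "x \<in> I" for f x
    using rmodule_homD(1)[OF that(1)] that(2) by simp
  have Hadd: "f (x \<oplus> y) = f x \<oplus> f y" if "f \<in> ?H" "x \<in> I" "y \<in> I" for f x y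
    using rmodule_homD(2)[OF that(1)] that(2,3) by simp
  have Hmult: "f (x \<otimes> a) = f x \<otimes> a" if "f \<in> ?H" "x \<in> I" "a \<in> carrier R" for f x a
    using rmodule_homD(3)[OF that(1)] that(2,3) by simp
  have "right_ideal R A"
  proof (rule right_idealI)
    have "\<exists>a\<in>carrier R. \<forall>x\<in>I. \<zero> \<otimes> f x = a \<otimes> x" if "f \<in> ?H" for f
      using H[OF that] ID(5) by (intro bexI[of _ \<zero>]) simp_all
    then show "\<zero> \<in> A"
      by (simp add: A_def)
  next
    fix b c assume bc: "b \<in> A" "c \<in> A"
    have "\<exists>a\<in>carrier R. \<forall>x\<in>I. (b \<oplus> c) \<otimes> f x = a \<otimes> x" if f: "f \<in> ?H" for f
    proof -
      obtain u v where "u \<in> carrier R" "v \<in> carrier R" "\<forall>x\<in>I. b \<otimes> f x = u \<otimes> x"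
        "\<forall>x\<in>I. c \<otimes> f x = v \<otimes> x"
        using AD[OF bc(1) f] AD[OF bc(2) f] by metis
      then show ?thesis
        using bc H[OF f] ID(5) by (intro bexI[of _ "u \<oplus> v"]) (simp_all add: A_def l_distr)
    qed
    then show "b \<oplus> c \<in> A"
      using bc by (simp add: A_def)
  next
    fix b r assume b: "b \<in> A" and r: "r \<in> carrier R"
    have "\<exists>a\<in>carrier R. \<forall>x\<in>I. b \<otimes> r \<otimes> f x = a \<otimes> x" if f: "f \<in> ?H" for f
    proof -
      have "(\<lambda>x. r \<otimes> f x) \<in> ?H"
        using H[OF f] Hadd[OF f] Hmult[OF f] r by (simp add: rmodule_hom_def r_distr m_assoc)
      then obtain a where "a \<in> carrier R" "\<forall>x\<in>I. b \<otimes> (r \<otimes> f x) = a \<otimes> x"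
        using AD[OF b, of "\<lambda>x. r \<otimes> f x"] by metis
      then show ?thesis
        using b r H[OF f] by (intro bexI[of _ a]) (simp_all add: A_def m_assoc)
    qed
    then show "b \<otimes> r \<in> A"
      using b r by (simp add: A_def)
  qed (auto simp: A_def)
  moreover have "r \<otimes> b \<in> A" if b: "b \<in> A" and r: "r \<in> carrier R" for b r
  proof -
    have "\<exists>a\<in>carrier R. \<forall>x\<in>I. r \<otimes> b \<otimes> f x = a \<otimes> x" if f: "f \<in> ?H" for f
    proof -
      obtain a where "a \<in> carrier R" "\<forall>x\<in>I. b \<otimes> f x = a \<otimes> x"
        using AD[OF b f] by metis
      then show ?thesis
        using b r H[OF f] ID(5) by (intro bexI[of _ "r \<otimes> a"]) (simp_all add: A_def m_assoc)
    qed
    then show ?thesis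
      using b r by (simp add: A_def)
  qed
  ultimately have A: "two_sided_ideal R A"
    by (simp add: two_sided_ideal_def)
  have "h \<in> A" if gen: "generator h s" for h s
  proof -
    have h: "uniform_idem R h s"
      using gen by (simp add: generator_def)
    note hD = uniform_idemD[OF h] and sR = simple_elemD(1,2)[OF uniform_idemD(3)[OF h]]
    have "\<exists>a\<in>carrier R. \<forall>x\<in>I. h \<otimes> f x = a \<otimes> x" if f: "f \<in> ?H" for f
    proof -
      define K where "K = {(x, y). x \<in> I \<and> y = h \<otimes> f x}"
      have K_iff: "(x, y) \<in> K \<longleftrightarrow> x \<in> I \<and> y = h \<otimes> f x" for x y
        by (simp add: K_def)
      have f0: "f \<zero> = \<zero>"
        using Hmult[OF f ID(2) zero_closed] H[OF f ID(2)] by simp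
      have Ksub: "rsubmodule R (prod_rmodule ?M ?M) K"
      proof (rule P.rsubmoduleI)
        show "K \<subseteq> carrier (prod_rmodule ?M ?M)"
          using ID(5) H[OF f] hD(1) by (auto simp: K_def)
        show "\<zero>\<^bsub>prod_rmodule ?M ?M\<^esub> \<in> K"
          using ID(2) f0 hD(1) by (simp add: K_iff)
      next
        fix u v assume "u \<in> K" "v \<in> K"
        then obtain x y where xy: "x \<in> I" "y \<in> I" "u = (x, h \<otimes> f x)" "v = (y, h \<otimes> f y)"
          by (auto simp: K_def)
        then have "u \<oplus>\<^bsub>prod_rmodule ?M ?M\<^esub> v = (x \<oplus> y, h \<otimes> f (x \<oplus> y))"
          using Hadd[OF f xy(1,2)] H[OF f] hD(1) by (simp add: r_distr)
        then show "u \<oplus>\<^bsub>prod_rmodule ?M ?M\<^esub> v \<in> K"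
          using ID(3)[OF xy(1,2)] by (simp add: K_iff)
      next
        fix u a assume "u \<in> K" and a: "a \<in> carrier R"
        then obtain x where x: "x \<in> I" "u = (x, h \<otimes> f x)"
          by (auto simp: K_def)
        then have "u \<cdot>\<^bsub>prod_rmodule ?M ?M\<^esub> a = (x \<otimes> a, h \<otimes> f (x \<otimes> a))"
          using Hmult[OF f x(1) a] H[OF f x(1)] hD(1) a by (simp add: m_assoc)
        then show "u \<cdot>\<^bsub>prod_rmodule ?M ?M\<^esub> a \<in> K"
          using ID(4)[OF x(1) a] by (simp add: K_iff)
      qed
      obtain F where F: "F \<subseteq> carrier R \<times> carrier R"
        and rel: "\<forall>x\<in>carrier R. \<forall>y\<in>carrier R. (x, y) \<in> K \<longleftrightarrow> (\<forall>(a, b)\<in>F. a \<otimes> x \<oplus> b \<otimes> y = \<zero>)"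
        using relations[OF Ksub] by metis
      \<comment> \<open>A graph does not contain (0, s), so some equation fails there, and its
        coefficient b does not kill s.\<close>
      have "(\<zero>, s) \<notin> K"
        using f0 hD(1) sR by (simp add: K_iff)
      then obtain a b where ab: "(a, b) \<in> F" "a \<otimes> \<zero> \<oplus> b \<otimes> s \<noteq> \<zero>"
        using rel[THEN bspec, THEN bspec, OF zero_closed sR(1)] by auto
      have abR: "a \<in> carrier R" "b \<in> carrier R"
        using F ab(1) by auto
      then obtain d where d: "d \<in> carrier R" "d \<otimes> (b \<otimes> h) = h"
        using generator_split[OF gen] ab(2) sR(1) by auto
      have "h \<otimes> f x = (\<ominus> (d \<otimes> a)) \<otimes> x" if x: "x \<in> I" for x
      proof -
        have xR: "x \<in> carrier R" "f x \<in> carrier R"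
          using ID(5)[OF x] H[OF f x] .
        have "(x, h \<otimes> f x) \<in> K"
          using x by (simp add: K_iff)
        then have "a \<otimes> x \<oplus> b \<otimes> (h \<otimes> f x) = \<zero>"
          using rel[THEN bspec, THEN bspec, OF xR(1), of "h \<otimes> f x"] xR hD(1) ab(1) by auto
        then have "b \<otimes> (h \<otimes> f x) = \<ominus> (a \<otimes> x)"
          using abR xR hD(1) by (metis a_comm m_closed minus_equality)
        have "h \<otimes> f x = d \<otimes> (b \<otimes> h) \<otimes> f x"
          using d(2) by simp
        also have "\<dots> = d \<otimes> (b \<otimes> (h \<otimes> f x))"
          using d(1) abR hD(1) xR by (simp add: m_assoc)
        also have "\<dots> = (\<ominus> (d \<otimes> a)) \<otimes> x"
          unfolding \<open>b \<otimes> (h \<otimes> f x) = \<ominus> (a \<otimes> x)\<close> using d(1) abR xR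
          by (simp add: r_minus l_minus m_assoc)
        finally show ?thesis .
      qed
      then show ?thesis
        using d(1) abR(1) by (intro bexI[of _ "\<ominus> (d \<otimes> a)"]) simp_all
    qed
    then show ?thesis
      using hD(1) by (simp add: A_def)
  qed
  then have "\<one> \<in> A"
    by (rule generators_generate[OF A])
  then obtain a where "a \<in> carrier R" "\<forall>x\<in>I. \<one> \<otimes> f x = a \<otimes> x"
    using AD[OF _ f] by metis
  then show ?thesis
    using H[OF f] by (intro bexI[of _ a]) simp_all
qed

end

section \<open>The quasi-Frobenius property\<close>

text \<open>Only the quotient by the intersection I of the chain matters. It embeds in a finite sum
  of uniform right ideals with simple socle, and a chain with intersection I must then reach
  I.\<close>

lemma (in socle_hull) right_artinian: "artinian_rmodule R (regular_rmodule R)"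
  unfolding artinian_rmodule_def
proof (intro allI impI)
  fix N :: "nat \<Rightarrow> 'a set"
  assume "(\<forall>i. right_ideal R (N i)) \<and> (\<forall>i. N (Suc i) \<subseteq> N i)"
  then have N: "right_ideal R (N i)" and step: "N (Suc i) \<subseteq> N i" for i
    by auto
  have desc: "N j \<subseteq> N i" if "i \<le> j" for i j
    by (rule lift_Suc_antimono_le[of N, OF step that])
  note ND = right_idealD[OF N]
  define I where "I = (\<Inter>i. N i)"
  have "right_ideal R I"
    by (rule right_idealI) (use ND in \<open>auto simp: I_def\<close>)
  then obtain F where F: "finite F" "F \<subseteq> carrier R"
    and ann: "\<And>x. x \<in> carrier R \<Longrightarrow> x \<in> I \<longleftrightarrow> (\<forall>a\<in>F. a \<otimes> x = \<zero>)"
    by (rule right_ideal_annihilator) (rule that)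
  obtain Q where Q: "finite Q" "Q \<subseteq> carrier R" "\<And>q. q \<in> Q \<Longrightarrow> \<exists>h s. generator h s \<and> h \<otimes> q = q"
    "\<And>x. \<lbrakk>x \<in> carrier R; \<forall>q\<in>Q. q \<otimes> x = \<zero>\<rbrakk> \<Longrightarrow> x = \<zero>"
    by (rule finite_cogenerators) (rule that)
  define C where "C = (\<lambda>(q, a). q \<otimes> a) ` (Q \<times> F)"
  have C: "finite C" "C \<subseteq> carrier R"
    using Q(1,2) F by (auto simp: C_def)
  have C_gen: "\<exists>h s. uniform_idem R h s \<and> h \<otimes> c = c" if "c \<in> C" for c
  proof -
    obtain q a where c: "q \<in> Q" "a \<in> F" "c = q \<otimes> a"
      using \<open>c \<in> C\<close> by (auto simp: C_def)
    then obtain h s where h: "uniform_idem R h s" "h \<otimes> q = q"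
      using Q(3)[OF c(1)] by (auto simp: generator_def)
    then have "h \<otimes> c = c"
      using uniform_idemD(1)[OF h(1)] c Q(2) F(2) m_assoc[of h q a, symmetric] by auto
    then show ?thesis
      using h(1) by blast
  qed
  have I_C: "x \<in> I \<longleftrightarrow> (\<forall>c\<in>C. c \<otimes> x = \<zero>)" if x: "x \<in> carrier R" for x
  proof
    assume "x \<in> I"
    then have "\<forall>a\<in>F. a \<otimes> x = \<zero>"
      using ann x by blast
    then show "\<forall>c\<in>C. c \<otimes> x = \<zero>"
      using Q(2) F(2) x by (auto simp: C_def m_assoc subset_iff)
  next
    assume *: "\<forall>c\<in>C. c \<otimes> x = \<zero>"
    have "a \<otimes> x = \<zero>" if a: "a \<in> F" for a
    proof (rule Q(4))
      show "a \<otimes> x \<in> carrier R"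
        using a F(2) x by blast
      have "q \<otimes> (a \<otimes> x) = \<zero>" if "q \<in> Q" for q
      proof -
        have "q \<otimes> a \<in> C"
          using a that by (auto simp: C_def)
        then have "q \<otimes> a \<otimes> x = \<zero>"
          using * by blast
        then show ?thesis
          using that a Q(2) F(2) x m_assoc[of q a x] by (simp add: subset_iff)
      qed
      then show "\<forall>q\<in>Q. q \<otimes> (a \<otimes> x) = \<zero>"
        by blast
    qed
    then show "x \<in> I"
      using ann x by blast
  qed
  have "\<exists>k. N k \<subseteq> I"
  proof (rule ccontr)
    assume none: "\<not> ?thesis"
    \<comment> \<open>A largest G such that every member of the chain still has an element outside I
      killed by G. Adding a further c fails from some k on, so c is injective modulo I on the
      elements of \<open>N k\<close> killed by G.\<close>
    define P where "P G \<longleftrightarrow> G \<subseteq> C \<and> (\<forall>k. \<exists>x\<in>N k. (\<forall>c\<in>G. c \<otimes> x = \<zero>) \<and> x \<notin> I)" for G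
    have "P {}"
      using none by (auto simp: P_def)
    moreover have "\<forall>G. P G \<longrightarrow> card G < Suc (card C)"
      using C(1) by (simp add: P_def card_mono less_Suc_eq_le)
    ultimately obtain G where G: "P G" and max: "\<And>G'. P G' \<Longrightarrow> card G' \<le> card G"
      using ex_has_greatest_nat[of P "{}" card] by blast
    have "G \<noteq> C"
      using G I_C ND(5) unfolding P_def by blast
    then obtain c where c: "c \<in> C" "c \<notin> G"
      using G by (auto simp: P_def)
    have "finite G"
      using G C(1) finite_subset by (auto simp: P_def)
    then have "\<not> P (insert c G)"
      using max[of "insert c G"] c(2) by auto
    moreover have "insert c G \<subseteq> C"
      using G c(1) by (simp add: P_def)
    ultimately obtain k where "\<forall>x\<in>N k. c \<otimes> x = \<zero> \<longrightarrow> (\<exists>c\<in>G. c \<otimes> x \<noteq> \<zero>) \<or> x \<in> I"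
      unfolding P_def by auto
    then have k: "x \<in> I" if "x \<in> N k" "\<forall>c\<in>G. c \<otimes> x = \<zero>" "c \<otimes> x = \<zero>" for x
      using that by blast
    obtain h s where h: "uniform_idem R h s" and hc: "h \<otimes> c = c"
      using C_gen[OF c(1)] by blast
    note hD = uniform_idemD[OF h]
    have GR: "g \<in> carrier R" if "g \<in> G" for g
      using C(2) G that by (auto simp: P_def)
    have cR: "c \<in> carrier R"
      using c C(2) by blast
    \<comment> \<open>Every later member reaches the same socle generator s under c.\<close>
    have solve: "\<exists>y\<in>N l. (\<forall>g\<in>G. g \<otimes> y = \<zero>) \<and> c \<otimes> y = s" if l: "k \<le> l" for l
    proof -
      obtain x where x: "x \<in> N l" "\<forall>g\<in>G. g \<otimes> x = \<zero>" "x \<notin> I"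
        using G unfolding P_def by blast
      have xR: "x \<in> carrier R"
        using ND(5)[OF x(1)] .
      have "c \<otimes> x \<noteq> \<zero>"
        using k[of x] x desc[OF l] by blast
      moreover have "h \<otimes> (c \<otimes> x) = c \<otimes> x"
        using hc hD(1) cR xR by (simp add: m_assoc[symmetric])
      ultimately obtain a where a: "a \<in> carrier R" "c \<otimes> x \<otimes> a = s"
        using hD(5)[of "c \<otimes> x"] cR xR by blast
      have "g \<otimes> (x \<otimes> a) = \<zero>" if "g \<in> G" for g
        using x(2) that GR[OF that] xR a(1) by (simp add: m_assoc[symmetric])
      then show ?thesis
        using a cR xR ND(4)[OF x(1) a(1)] by (intro bexI[of _ "x \<otimes> a"]) (simp_all add: m_assoc)
    qed
    then obtain y where y: "y \<in> N k" "\<forall>g\<in>G. g \<otimes> y = \<zero>" "c \<otimes> y = s"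
      by blast
    have yR: "y \<in> carrier R"
      using ND(5)[OF y(1)] .
    \<comment> \<open>y and z have the same image s, so they differ by an element of I, and y lies
      in every member of the chain. Then s = cy = 0.\<close>
    have "y \<in> N l" if l: "k \<le> l" for l
    proof -
      obtain z where z: "z \<in> N l" "\<forall>g\<in>G. g \<otimes> z = \<zero>" "c \<otimes> z = s"
        using solve[OF l] by blast
      have zR: "z \<in> carrier R"
        using ND(5)[OF z(1)] .
      have "z \<in> N k"
        using z(1) desc[OF l] by blast
      then have "y \<ominus> z \<in> N k"
        by (rule right_ideal_minus[OF N y(1)])
      moreover have "\<forall>g\<in>G. g \<otimes> (y \<ominus> z) = \<zero>"
        using y(2) z(2) GR yR zR by (simp add: r_minus_distr minus_self)
      moreover have "c \<otimes> (y \<ominus> z) = \<zero>"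
        using y(3) z(3) cR yR zR simple_elemD(1)[OF hD(3)] by (simp add: r_minus_distr minus_self)
      ultimately have "y \<ominus> z \<in> I"
        by (rule k)
      then have "(y \<ominus> z) \<oplus> z \<in> N l"
        using ND(3)[OF _ z(1)] by (auto simp: I_def)
      then show ?thesis
        using yR zR by (simp add: a_minus_def a_assoc l_neg)
    qed
    then have "y \<in> N l" for l
      using desc[of l k] y(1) by (cases "k \<le> l") (auto simp: subset_iff)
    then have "y \<in> I"
      by (simp add: I_def)
    then have "s = \<zero>"
      using I_C[OF yR] c(1) y(3) by simp
    then show False
      using simple_elemD(2)[OF hD(3)] by blast
  qed
  then obtain k where k: "N k \<subseteq> I" ..
  have "N i = N k" if "k \<le> i" for i
    using desc[OF that] k by (auto simp: I_def)
  then show "\<exists>k. \<forall>i\<ge>k. N i = N k"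
    by blast
qed

text \<open>Baer's criterion, with partial homomorphisms represented by their graphs in M x R and
  Zorn's lemma applied to these.\<close>

lemma (in ring) injective_regular_rmodule:
  assumes baer: "\<And>I f. \<lbrakk>right_ideal R I; f \<in> rmodule_hom R (regular_rmodule R\<lparr>carrier := I\<rparr>) (regular_rmodule R)\<rbrakk>
    \<Longrightarrow> \<exists>a\<in>carrier R. \<forall>x\<in>I. f x = a \<otimes> x"
  shows "injective_rmodule TYPE('c) R (regular_rmodule R)"
  unfolding injective_rmodule_def
proof (intro allI impI ballI)
  fix M :: "('a, 'c) rmodule" and N f
  assume "right_module R M \<and> rsubmodule R M N"
    and f: "f \<in> rmodule_hom R (M\<lparr>carrier := N\<rparr>) (regular_rmodule R)"
  then have M: "right_module R M" and N: "rsubmodule R M N"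
    by auto
  interpret M: right_module R M by fact
  let ?P = "prod_rmodule M (regular_rmodule R)"
  interpret P: right_module R ?P
    by (intro prod_right_module regular_right_module M)
  interpret N: right_module R "M\<lparr>carrier := N\<rparr>"
    using N by (rule M.rsubmodule_right_module)
  note ND = rsubmoduleD[OF N]
  have fR: "f x \<in> carrier R" if "x \<in> N" for x
    using rmodule_homD(1)[OF f] that by simp
  define \<Gamma> where "\<Gamma> = {(x, y). x \<in> N \<and> y = f x}"
  have \<Gamma>: "rsubmodule R ?P \<Gamma>"
  proof (rule P.rsubmoduleI)
    show "\<Gamma> \<subseteq> carrier ?P"
      using ND(1) fR by (auto simp: \<Gamma>_def)
    show "\<zero>\<^bsub>?P\<^esub> \<in> \<Gamma>"
      using ND(2) N.hom_zero[OF regular_right_module f] by (simp add: \<Gamma>_def)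
  next
    fix u v assume "u \<in> \<Gamma>" "v \<in> \<Gamma>"
    then show "u \<oplus>\<^bsub>?P\<^esub> v \<in> \<Gamma>"
      using ND(3) rmodule_homD(2)[OF f] by (auto simp: \<Gamma>_def)
  next
    fix u a assume "u \<in> \<Gamma>" "a \<in> carrier R"
    then show "u \<cdot>\<^bsub>?P\<^esub> a \<in> \<Gamma>"
      using ND(4) rmodule_homD(3)[OF f] by (auto simp: \<Gamma>_def)
  qed
  \<comment> \<open>For a submodule, having only zero above zero already makes it the graph of a
    partial homomorphism.\<close>
  define \<A> where "\<A> = {G. rsubmodule R ?P G \<and> \<Gamma> \<subseteq> G \<and> (\<forall>y. (\<zero>\<^bsub>M\<^esub>, y) \<in> G \<longrightarrow> y = \<zero>)}"
  have "\<exists>G\<in>\<A>. \<forall>X\<in>\<A>. G \<subseteq> X \<longrightarrow> X = G"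
  proof (rule subset_Zorn_nonempty)
    have "\<Gamma> \<in> \<A>"
      using \<Gamma> N.hom_zero[OF regular_right_module f] by (simp add: \<A>_def \<Gamma>_def)
    then show "\<A> \<noteq> {}"
      by blast
    fix \<C> assume C: "\<C> \<noteq> {}" "subset.chain \<A> \<C>"
    then have "rsubmodule R ?P (\<Union>\<C>)"
      by (intro P.rsubmodule_Union_chain) (auto simp: \<A>_def subset_chain_def)
    then show "\<Union>\<C> \<in> \<A>"
      using C by (auto simp: \<A>_def subset_chain_def)
  qed
  then obtain G where G: "rsubmodule R ?P G" "\<Gamma> \<subseteq> G" and G0: "\<And>y. (\<zero>\<^bsub>M\<^esub>, y) \<in> G \<Longrightarrow> y = \<zero>"
    and max: "\<And>X. \<lbrakk>rsubmodule R ?P X; G \<subseteq> X; \<And>y. (\<zero>\<^bsub>M\<^esub>, y) \<in> X \<Longrightarrow> y = \<zero>\<rbrakk> \<Longrightarrow> X = G"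
    unfolding \<A>_def by force
  note GD = rsubmoduleD[OF G(1)]
  have GC: "x \<in> carrier M" "y \<in> carrier R" if "(x, y) \<in> G" for x y
    using GD(1) that by auto
  have Gadd: "(x \<oplus>\<^bsub>M\<^esub> x', y \<oplus> y') \<in> G" if "(x, y) \<in> G" "(x', y') \<in> G" for x y x' y'
    using GD(3)[OF that] by simp
  have Gmult: "(x \<cdot>\<^bsub>M\<^esub> a, y \<otimes> a) \<in> G" if "(x, y) \<in> G" "a \<in> carrier R" for x y a
    using GD(4)[OF that] by simp
  have Gneg: "(\<ominus>\<^bsub>M\<^esub> x, \<ominus> y) \<in> G" if "(x, y) \<in> G" for x y
    using Gmult[OF that, of "\<ominus> \<one>"] GC[OF that] by (simp add: M.rsmult_uminus_one r_minus)
  have fun_G: "y = y'" if "(x, y) \<in> G" "(x, y') \<in> G" for x y y'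
  proof -
    have "(x \<oplus>\<^bsub>M\<^esub> \<ominus>\<^bsub>M\<^esub> x, y \<oplus> \<ominus> y') \<in> G"
      using Gadd that(1) Gneg[OF that(2)] by blast
    then have "y \<ominus> y' = \<zero>"
      using G0 GC[OF that(1)] by (simp add: M.M.r_neg a_minus_def)
    then show ?thesis
      using GC that by (simp add: minus_eq_zero_iff)
  qed
  have total: "\<exists>y. (m, y) \<in> G" if m: "m \<in> carrier M" for m
  proof -
    define I where "I = {x \<in> carrier R. \<exists>y. (m \<cdot>\<^bsub>M\<^esub> x, y) \<in> G}"
    define \<phi> where "\<phi> x = (THE y. (m \<cdot>\<^bsub>M\<^esub> x, y) \<in> G)" for x
    have \<phi>I: "\<phi> x = y" if "(m \<cdot>\<^bsub>M\<^esub> x, y) \<in> G" for x y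
      unfolding \<phi>_def using that fun_G by blast
    have \<phi>: "(m \<cdot>\<^bsub>M\<^esub> x, \<phi> x) \<in> G" "x \<in> carrier R" if "x \<in> I" for x
      using that \<phi>I by (auto simp: I_def)
    have add: "(m \<cdot>\<^bsub>M\<^esub> (x \<oplus> y), \<phi> x \<oplus> \<phi> y) \<in> G" if "x \<in> I" "y \<in> I" for x y
      using Gadd[OF \<phi>(1)[OF that(1)] \<phi>(1)[OF that(2)]] \<phi>(2)[OF that(1)] \<phi>(2)[OF that(2)] m
      by (simp add: M.rsmult_add_right)
    have mult: "(m \<cdot>\<^bsub>M\<^esub> (x \<otimes> a), \<phi> x \<otimes> a) \<in> G" if "x \<in> I" "a \<in> carrier R" for x a
      using Gmult[OF \<phi>(1)[OF that(1)] that(2)] \<phi>(2)[OF that(1)] that(2) m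
      by (simp add: M.rsmult_assoc)
    have "right_ideal R I"
    proof (rule right_idealI)
      have "(\<zero>\<^bsub>M\<^esub>, \<zero>) \<in> G"
        using GD(2) by simp
      then show "\<zero> \<in> I"
        using m by (auto simp: I_def)
      show "x \<oplus> y \<in> I" if "x \<in> I" "y \<in> I" for x y
        using add[OF that] \<phi>(2) that by (auto simp: I_def)
      show "x \<otimes> a \<in> I" if "x \<in> I" "a \<in> carrier R" for x a
        using mult[OF that] \<phi>(2) that by (auto simp: I_def)
    qed (auto simp: I_def)
    moreover have "\<phi> \<in> rmodule_hom R (regular_rmodule R\<lparr>carrier := I\<rparr>) (regular_rmodule R)"
      using GC(2)[OF \<phi>(1)] \<phi>I[OF add] \<phi>I[OF mult] by (simp add: rmodule_hom_def)
    ultimately obtain a where a: "a \<in> carrier R" "\<forall>x\<in>I. \<phi> x = a \<otimes> x"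
      using baer by blast
    \<comment> \<open>The extension sends m to a. It is well defined because a acts on I as the
      given map \<phi> does.\<close>
    define X where "X = {g \<oplus>\<^bsub>?P\<^esub> (m, a) \<cdot>\<^bsub>?P\<^esub> x | g x. g \<in> G \<and> x \<in> carrier R}"
    have ma: "(m, a) \<in> carrier ?P"
      using m a(1) by simp
    note X = P.rsubmodule_add_cyclic[OF G(1) ma, folded X_def]
    have "y = \<zero>" if y: "(\<zero>\<^bsub>M\<^esub>, y) \<in> X" for y
    proof -
      obtain k z x where kz: "(k, z) \<in> G" and x: "x \<in> carrier R"
        and eq: "\<zero>\<^bsub>M\<^esub> = k \<oplus>\<^bsub>M\<^esub> m \<cdot>\<^bsub>M\<^esub> x" "y = z \<oplus> a \<otimes> x"
        using y by (auto simp: X_def)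
      note kzC = GC[OF kz]
      have "m \<cdot>\<^bsub>M\<^esub> x = \<ominus>\<^bsub>M\<^esub> k"
        using eq(1) kzC(1) m x M.M.minus_equality[of "m \<cdot>\<^bsub>M\<^esub> x" k] M.M.a_comm[of k "m \<cdot>\<^bsub>M\<^esub> x"] by simp
      then have mem: "(m \<cdot>\<^bsub>M\<^esub> x, \<ominus> z) \<in> G"
        using Gneg[OF kz] by simp
      then have "x \<in> I"
        using x by (auto simp: I_def)
      then have "\<ominus> z = a \<otimes> x"
        using a(2) \<phi>I[OF mem] by simp
      then show ?thesis
        using eq(2) kzC(2) by (metis r_neg)
    qed
    then have "X = G"
      by (rule max[OF X(1,2)])
    then show ?thesis
      using X(3) by blast
  qed
  define g where "g m = (THE y. (m, y) \<in> G)" for m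
  have gI: "g m = y" if "(m, y) \<in> G" for m y
    unfolding g_def using that fun_G by blast
  have g: "(m, g m) \<in> G" if "m \<in> carrier M" for m
    using total[OF that] gI by auto
  have "g \<in> rmodule_hom R M (regular_rmodule R)"
    using GC(2)[OF g] gI[OF Gadd[OF g g]] gI[OF Gmult[OF g]] by (simp add: rmodule_hom_def)
  moreover have "\<forall>x\<in>N. g x = f x"
    using G(2) gI by (auto simp: \<Gamma>_def)
  ultimately show "\<exists>g\<in>rmodule_hom R M (regular_rmodule R). \<forall>x\<in>N. g x = f x"
    by blast
qed

theorem proposition8:
  fixes R :: "('a, 'm) ring_scheme"
  assumes "ring R"
    and "right_GC2 R"
    and "right_FGF R"
  shows "(right_weak_CS R \<longrightarrow> quasi_frobenius TYPE('c) R) \<and>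
         (right_s_CS R \<longrightarrow> quasi_frobenius TYPE('c) R)"
proof -
  interpret R: ring R by fact
  have "quasi_frobenius TYPE('c) R" if CS: "right_weak_CS R \<or> right_s_CS R"
  proof -
    interpret fgf_ring R
    proof
      fix K assume K: "rsubmodule R (prod_rmodule (regular_rmodule R) (regular_rmodule R)) K"
      obtain F where F: "finite F" "F \<subseteq> carrier R \<times> carrier R"
        "\<And>x y. \<lbrakk>x \<in> carrier R; y \<in> carrier R\<rbrakk> \<Longrightarrow>
          (x, y) \<in> K \<longleftrightarrow> (\<forall>(a, b)\<in>F. a \<otimes>\<^bsub>R\<^esub> x \<oplus>\<^bsub>R\<^esub> b \<otimes>\<^bsub>R\<^esub> y = \<zero>\<^bsub>R\<^esub>)"
        by (rule R.right_FGF_relations[OF assms(3) K]) (rule that)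
      show "\<exists>F. finite F \<and> F \<subseteq> carrier R \<times> carrier R \<and> (\<forall>x\<in>carrier R. \<forall>y\<in>carrier R.
        (x, y) \<in> K \<longleftrightarrow> (\<forall>(a, b)\<in>F. a \<otimes>\<^bsub>R\<^esub> x \<oplus>\<^bsub>R\<^esub> b \<otimes>\<^bsub>R\<^esub> y = \<zero>\<^bsub>R\<^esub>))"
        by (intro exI[of _ F] conjI ballI F)
    next
      fix a assume "a \<in> carrier R" "\<And>x. \<lbrakk>x \<in> carrier R; a \<otimes>\<^bsub>R\<^esub> x = \<zero>\<^bsub>R\<^esub>\<rbrakk> \<Longrightarrow> x = \<zero>\<^bsub>R\<^esub>"
      then obtain b where "b \<in> carrier R" "b \<otimes>\<^bsub>R\<^esub> a = \<one>\<^bsub>R\<^esub>"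
        by (rule R.right_GC2_left_inverse[OF assms(2)])
      then show "\<exists>b\<in>carrier R. b \<otimes>\<^bsub>R\<^esub> a = \<one>\<^bsub>R\<^esub>" ..
    next
      fix \<S> assume "\<And>S. S \<in> \<S> \<Longrightarrow> minimal_right_ideal R S"
        "\<And>S x. \<lbrakk>S \<in> \<S>; x \<in> S\<rbrakk> \<Longrightarrow> singular_elem R x"
      then obtain e where "essential_in_idem R (right_ideal_sum R \<S>) e"
        by (rule R.singular_socle_essential[OF CS])
      then show "\<exists>e. essential_in_idem R (right_ideal_sum R \<S>) e" ..
    qed
    obtain W where W: "\<And>w. w \<in> W \<Longrightarrow> simple_elem R w" "\<And>w. w \<in> W \<Longrightarrow> singular_elem R w"
      "\<And>w w'. \<lbrakk>w \<in> W; w' \<in> W; iso_elem R w w'\<rbrakk> \<Longrightarrow> w = w'"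
      "\<And>c. \<lbrakk>simple_elem R c; singular_elem R c\<rbrakk> \<Longrightarrow> \<exists>w\<in>W. iso_elem R c w"
      by (rule R.iso_elem_representatives) (rule that)
    \<comment> \<open>The CS condition enters here once more, for the sum of all representatives at
      once.\<close>
    obtain e where e: "essential_in_idem R (rspan R (regular_rmodule R) W) e"
      by (rule rspan_essential[OF W(1,2)])
    interpret socle_hull R W e
      by unfold_locales (fact W e)+
    show ?thesis
      unfolding quasi_frobenius_def
      by (intro conjI right_artinian R.injective_regular_rmodule right_ideal_hom_left_mult)
  qed
  then show ?thesis
    by blast
qed

end
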